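(* Let $n,m\ge 1$ be integers, let $W:\mathbb{R}^m\to\mathbb{R}$ satisfy hypothesis (HA) at a point $a\in\mathbb{R}^m$, and let $M>0$. Let $d_0=\mathrm{dist}(a,\{W=0\}\setminus\{a\})$ (with $d_0=+\infty$ if $\{W=0\}=\{a\}$). For every $\mu_0>0$ and every $0<\lambda<d_0$ there is a constant $C=C(\mu_0,\lambda,M)>0$ such that the following holds for every open $D\subset\mathbb{R}^n$, every $u:D\to\mathbb{R}^m$ satisfying hypothesis (HB) with the constant $M$, and every $x_0\in D$. If $$\mathcal{L}^n\big(B_1(x_0)\cap\{|u-a|>\lambda\}\big)\ge\mu_0,$$ then $$\mathcal{L}^n\big(B_R(x_0)\cap\{|u-a|>\lambda\}\big)\ge C R^n\quad\text{for every } R\ge 1 \text{ with } B_R(x_0)\subset D.$$ In particular $C$ is independent of $x_0$ and of $u$.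
   Context: $B_r(x_0)\subset\mathbb{R}^n$ is the open ball of center $x_0$ and radius $r$; $\mathcal{L}^n$ is $n$-dimensional Lebesgue measure; $W_u$ is the gradient and $W_{uu}$ the Hessian matrix of $W$; $\cdot$ is the Euclidean inner product. Hypothesis (HA) at $a$: $W:\mathbb{R}^m\to\mathbb{R}$ is nonnegative, $W(a)=0$, and for some $\alpha\in(0,2]$, $W\in C^\alpha(\mathbb{R}^m;\mathbb{R})\cap C^1(\mathbb{R}^m\setminus\{a\};\mathbb{R})$ (here $C^\alpha$ means locally Hölder of exponent $\alpha$ if $0<\alpha<1$, locally Lipschitz if $\alpha=1$, $C^{1,\alpha-1}$ locally if $1<\alpha<2$, and $C^2$ if $\alpha=2$). If $0<\alpha<2$, there are constants $C^*>0$, $\rho_0>0$ with $W_u(a+\rho\nu)\cdot\nu\ge C^*\rho^{\alpha-1}$ for $0<\rho\le\rho_0$, $|\nu|=1$. If $\alpha=2$, there is a constant $C_0>0$ with $W_{uu}(a)\nu\cdot\nu\ge C_0$ for $|\nu|=1$. Hypothesis (HB) with constant $M$: $u\in W^{1,2}_{\rm loc}(D;\mathbb{R}^m)\cap L^\infty(D;\mathbb{R}^m)$ is minimal, i.e. for every open bounded set $\Omega\subset D$ and every $v\in W^{1,2}_0(\Omega;\mathbb{R}^m)$ one has $J_\Omega(u)\le J_\Omega(u+v)$, where $J_\Omega(u)=\int_\Omega\big(\frac12|\nabla u|^2+W(u)\big)dx$; moreover $|u-a|<M$ and $|\nabla u|<M$ on $D$. *)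

theory Defs
  imports "HOL-Analysis.Analysis"
begin

section \<open>Classical differentiability\<close>

text \<open>\<^term>\<open>S\<close> is meant to be open. Asking that all directional derivatives be of class
  $C^k$ is the same as asking it of all partial derivatives.\<close>

primrec Ck_on :: "nat \<Rightarrow> 'a::real_normed_vector set \<Rightarrow> ('a \<Rightarrow> 'b::real_normed_vector) \<Rightarrow> bool" where
  "Ck_on 0 S f \<longleftrightarrow> continuous_on S f"
| "Ck_on (Suc k) S f \<longleftrightarrow>
     (\<forall>x\<in>S. f differentiable (at x)) \<and> (\<forall>v. Ck_on k S (\<lambda>x. frechet_derivative f (at x) v))"

definition partial_deriv :: "'n \<Rightarrow> (real^'n \<Rightarrow> real) \<Rightarrow> real^'n \<Rightarrow> real" where
  "partial_deriv j f x = frechet_derivative f (at x) (axis j 1)"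

definition gradient :: "(real^'n \<Rightarrow> real) \<Rightarrow> real^'n \<Rightarrow> real^'n" where
  "gradient f x = (\<chi> i. partial_deriv i f x)"

definition hessian :: "(real^'n \<Rightarrow> real) \<Rightarrow> real^'n \<Rightarrow> real^'n^'n" where
  "hessian f x = (\<chi> i j. partial_deriv j (partial_deriv i f) x)"

text \<open>For \<^term>\<open>\<gamma> = (1::real)\<close> this is local Lipschitz continuity.\<close>

definition locally_holder :: "real \<Rightarrow> ('a::metric_space \<Rightarrow> 'b::metric_space) \<Rightarrow> bool" where
  "locally_holder \<gamma> f \<longleftrightarrow>
     (\<forall>x. \<exists>r>0. \<exists>L. \<forall>y\<in>ball x r. \<forall>z\<in>ball x r. dist (f y) (f z) \<le> L * dist y z powr \<gamma>)"

definition C_alpha :: "real \<Rightarrow> (real^'m \<Rightarrow> real) \<Rightarrow> bool" where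
  "C_alpha \<alpha> f \<longleftrightarrow>
     (if \<alpha> \<le> 1 then locally_holder \<alpha> f
      else if \<alpha> < 2 then Ck_on 1 UNIV f \<and> locally_holder (\<alpha> - 1) (gradient f)
      else Ck_on 2 UNIV f)"

section \<open>The potential\<close>

definition hypothesis_HA :: "(real^'m \<Rightarrow> real) \<Rightarrow> real^'m \<Rightarrow> bool" where
  "hypothesis_HA W a \<longleftrightarrow>
     (\<forall>z. 0 \<le> W z) \<and> W a = 0 \<and>
     (\<exists>\<alpha>. 0 < \<alpha> \<and> \<alpha> \<le> 2 \<and> C_alpha \<alpha> W \<and> Ck_on 1 (- {a}) W \<and>
        (\<alpha> < 2 \<longrightarrow>
           (\<exists>Cs>0. \<exists>\<rho>0>0. \<forall>\<rho> \<nu>. 0 < \<rho> \<and> \<rho> \<le> \<rho>0 \<and> norm \<nu> = 1 \<longrightarrow>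
              gradient W (a + \<rho> *\<^sub>R \<nu>) \<bullet> \<nu> \<ge> Cs * \<rho> powr (\<alpha> - 1))) \<and>
        (\<alpha> = 2 \<longrightarrow>
           (\<exists>C0>0. \<forall>\<nu>. norm \<nu> = 1 \<longrightarrow> (hessian W a *v \<nu>) \<bullet> \<nu> \<ge> C0)))"

text \<open>The infimum is taken in the extended reals, so it is $+\infty$ when \<^term>\<open>a\<close> is the
  only zero; \<^const>\<open>infdist\<close> would be 0 in that case.\<close>

definition dist_other_zeros :: "(real^'m \<Rightarrow> real) \<Rightarrow> real^'m \<Rightarrow> ereal" where
  "dist_other_zeros W a = (INF z\<in>{z. W z = 0} - {a}. ereal (dist a z))"

section \<open>Sobolev spaces\<close>

text \<open>A function on a set is represented by a total function whose values outside the set are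
  irrelevant. Test functions, on the other hand, are extended by 0.\<close>

definition test_function :: "(real^'n) set \<Rightarrow> (real^'n \<Rightarrow> 'b::real_normed_vector) \<Rightarrow> bool" where
  "test_function D \<phi> \<longleftrightarrow>
     (\<forall>k. Ck_on k UNIV \<phi>) \<and> (\<exists>K. compact K \<and> K \<subseteq> D \<and> (\<forall>x. x \<notin> K \<longrightarrow> \<phi> x = 0))"

definition locally_integrable ::
    "(real^'n) set \<Rightarrow> (real^'n \<Rightarrow> 'b::euclidean_space) \<Rightarrow> bool" where
  "locally_integrable D f \<longleftrightarrow> (\<forall>K. compact K \<and> K \<subseteq> D \<longrightarrow> integrable (lebesgue_on K) f)"

definition L2_on :: "(real^'n) set \<Rightarrow> (real^'n \<Rightarrow> 'b::euclidean_space) \<Rightarrow> bool" where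
  "L2_on D f \<longleftrightarrow>
     f \<in> borel_measurable (lebesgue_on D) \<and> integrable (lebesgue_on D) (\<lambda>x. (norm (f x))\<^sup>2)"

definition L2_loc :: "(real^'n) set \<Rightarrow> (real^'n \<Rightarrow> 'b::euclidean_space) \<Rightarrow> bool" where
  "L2_loc D f \<longleftrightarrow> (\<forall>K. compact K \<and> K \<subseteq> D \<longrightarrow> L2_on K f)"

definition Linfty_on :: "(real^'n) set \<Rightarrow> (real^'n \<Rightarrow> 'b::euclidean_space) \<Rightarrow> bool" where
  "Linfty_on D f \<longleftrightarrow>
     f \<in> borel_measurable (lebesgue_on D) \<and> (\<exists>B. AE x in lebesgue_on D. norm (f x) \<le> B)"

text \<open>The entry $G_{ij}$ is the weak derivative of $u_i$ with respect to $x_j$; the norm of the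
  type of \<^term>\<open>G x\<close> is the Frobenius norm, i.e. $|G|^2 = \sum_{ij} G_{ij}^2$.\<close>

definition has_weak_gradient ::
    "(real^'n) set \<Rightarrow> (real^'n \<Rightarrow> real^'m) \<Rightarrow> (real^'n \<Rightarrow> real^'n^'m) \<Rightarrow> bool" where
  "has_weak_gradient D u G \<longleftrightarrow>
     locally_integrable D u \<and> locally_integrable D G \<and>
     (\<forall>\<phi>. test_function D \<phi> \<longrightarrow>
        (\<forall>i j. (LINT x|lebesgue_on D. u x $ i * partial_deriv j \<phi> x) =
             - (LINT x|lebesgue_on D. G x $ i $ j * \<phi> x)))"

text \<open>The choice only matters up to a null set, as weak gradients are unique almost
  everywhere.\<close>

definition weak_gradient ::
    "(real^'n) set \<Rightarrow> (real^'n \<Rightarrow> real^'m) \<Rightarrow> real^'n \<Rightarrow> real^'n^'m" where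
  "weak_gradient D u = (SOME G. has_weak_gradient D u G)"

definition W12 :: "(real^'n) set \<Rightarrow> (real^'n \<Rightarrow> real^'m) \<Rightarrow> bool" where
  "W12 D u \<longleftrightarrow> L2_on D u \<and> (\<exists>G. has_weak_gradient D u G \<and> L2_on D G)"

definition W12_loc :: "(real^'n) set \<Rightarrow> (real^'n \<Rightarrow> real^'m) \<Rightarrow> bool" where
  "W12_loc D u \<longleftrightarrow> L2_loc D u \<and> (\<exists>G. has_weak_gradient D u G \<and> L2_loc D G)"

definition W12_norm :: "(real^'n) set \<Rightarrow> (real^'n \<Rightarrow> real^'m) \<Rightarrow> real" where
  "W12_norm D u = sqrt ((LINT x|lebesgue_on D. (norm (u x))\<^sup>2) +
                        (LINT x|lebesgue_on D. (norm (weak_gradient D u x))\<^sup>2))"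

definition W12_0 :: "(real^'n) set \<Rightarrow> (real^'n \<Rightarrow> real^'m) \<Rightarrow> bool" where
  "W12_0 D v \<longleftrightarrow> W12 D v \<and>
     (\<exists>\<phi>. (\<forall>k. test_function D (\<phi> k)) \<and>
          (\<lambda>k::nat. W12_norm D (\<lambda>x. \<phi> k x - v x)) \<longlonglongrightarrow> 0)"

section \<open>Minimizers\<close>

text \<open>The integrand is nonnegative whenever \<^term>\<open>W\<close> is, and the integral may be $\infty$.\<close>

definition energy ::
    "(real^'m \<Rightarrow> real) \<Rightarrow> (real^'n) set \<Rightarrow> (real^'n \<Rightarrow> real^'m) \<Rightarrow> ennreal" where
  "energy W \<Omega> u =
     (\<integral>\<^sup>+ x. ennreal (1/2 * (norm (weak_gradient \<Omega> u x))\<^sup>2 + W (u x)) \<partial>lebesgue_on \<Omega>)"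

definition minimal ::
    "(real^'m \<Rightarrow> real) \<Rightarrow> (real^'n) set \<Rightarrow> (real^'n \<Rightarrow> real^'m) \<Rightarrow> bool" where
  "minimal W D u \<longleftrightarrow>
     (\<forall>\<Omega> v. open \<Omega> \<and> bounded \<Omega> \<and> \<Omega> \<subseteq> D \<and> W12_0 \<Omega> v \<longrightarrow>
        energy W \<Omega> u \<le> energy W \<Omega> (\<lambda>x. u x + v x))"

definition hypothesis_HB ::
    "(real^'m \<Rightarrow> real) \<Rightarrow> real^'m \<Rightarrow> real \<Rightarrow> (real^'n) set \<Rightarrow> (real^'n \<Rightarrow> real^'m) \<Rightarrow> bool" where
  "hypothesis_HB W a M D u \<longleftrightarrow>
     W12_loc D u \<and> Linfty_on D u \<and> minimal W D u \<and>
     (AE x in lebesgue_on D. norm (u x - a) < M) \<and>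
     (AE x in lebesgue_on D. norm (weak_gradient D u x) < M)"

end

theory Submission
  imports Defs
begin

text \<open>
  Write $q = |u - a|$, let $e$ be the energy density, and let $\lambda'$ be the smaller of $\lambda$ and the
  radius of the ball around $a$ in which \<^term>\<open>W\<close> grows at least quadratically and increases along rays
  (\<open>HA_quadratic_growth\<close>). With $E(R) = \int_{B_R} e$ and $V(R) = |B_R \cap \{q > \lambda'\}|$, the proof shows
  that the \<^emph>\<open>mass\<close> $F = E + V$ grows like $R^n$, and then that $E$ contributes only $O(R^{n-1})$.

  \<^bold>\<open>Comparison.\<close> Let $\eta$ be a cutoff function that equals 1 on $B_R$ and has compact support in $B_{R+1}$.
  The competitor $u - \eta\,(u - a)$ equals $a$ on $B_R$ and has no energy there. In the annulus its density is
  at most $C e$ where $q \le \lambda'$, because there $W$ decreases when the argument is scaled towards $a$ and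
  $q^2 \le C\,W(u)$, and it is bounded where $q > \lambda'$. Minimality gives $E(R+1) \le C\,(F(R+1) - F(R))$
  (\<open>energy_comparison\<close>). Since the density of $F$ is bounded, also $E(R) \le C R^{n-1}$ (\<open>energy_le_area\<close>).

  \<^bold>\<open>Isoperimetry.\<close> The function $\eta\,(u - a)$ has compact support and bounded gradient. Hence its norm has a
  Lipschitz representative $g$, and the layer where $g$ lies between $\lambda'/2$ and $\lambda'$ consists of points
  with $\lambda'/2 < q \le \lambda'$, at which $W(u)$ is bounded below, and of points of the annulus with
  $q > \lambda'$. Its volume is therefore at most $C\,(F(R+1) - F(R))$. An isoperimetric inequality for layers
  of Lipschitz functions (\<open>transition_layer_isoperimetric\<close>), proved by averaging over translations, bounds
  $V(R)$ by $C r\,(F(R+1) - F(R))$, for each $r$ such that $F(R+1)$ is at most a small multiple of $r^n$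
  (\<open>volume_growth_step\<close>).

  \<^bold>\<open>Iteration.\<close> Together, $F(R) \le (C + C r)\,(F(R+1) - F(R))$. If $F(k) \ge c k^n$ but $F(k+1) < c (k+1)^n$,
  then $r$ may be chosen as a small multiple of $k$, and the increment would be at least a large multiple
  of $c k^{n-1}$, which is impossible (\<open>growth_iteration\<close>). So $F(k) \ge c k^n$ for all large $k$. The part
  of $\{\lambda' < q \le \lambda\}$ in $B_k$ has measure at most $C E(k)$, since $W$ has no zero at distance between $\lambda'$ and
  $\lambda$ from $a$. As $E(k) \le C k^{n-1}$, the set $\{q > \lambda\}$ must carry the growth.

  The admissible variations in the definition of minimality are limits of test functions, and weak gradients
  are determined only almost everywhere. The first part of the theory therefore provides mollifiers and their
  convergence. They give the uniqueness of weak gradients (\<open>has_weak_gradient_unique\<close>), the fact that bounded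
  functions with compact support and bounded weak gradient are admissible variations (\<open>compact_sobolev_W12_0\<close>), the Lipschitz
  representative (\<open>compact_sobolev_lipschitz\<close>) and the cutoff functions (\<open>cutoff_exists\<close>).
\<close>

section \<open>Smooth functions\<close>

lemma Ck_on_Suc_imp:
  "Ck_on (Suc k) S f \<Longrightarrow> Ck_on k S f"
proof (induction k arbitrary: f)
  case 0
  then show ?case
    by (metis Ck_on.simps(1) Ck_on.simps(2) differentiable_at_imp_differentiable_on
        differentiable_imp_continuous_on)
next
  case (Suc k)
  then show ?case by auto
qed

lemma Ck_on_continuous: "Ck_on k S f \<Longrightarrow> continuous_on S f"
proof (induction k)
  case (Suc k)
  then show ?case using Ck_on_Suc_imp by blast
qed auto

lemma frechet_derivative_eqI:
  "(f has_derivative f') (at x) \<Longrightarrow> frechet_derivative f (at x) v = f' v"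
  using frechet_derivative_at by metis

lemma Ck_on_const: "Ck_on k UNIV (\<lambda>x::'a::real_normed_vector. c::'b::real_normed_vector)"
  by (induction k arbitrary: c) (auto)

lemma Ck_on_add:
  fixes f g :: "'a::real_normed_vector \<Rightarrow> 'b::real_normed_vector"
  shows "Ck_on k UNIV f \<Longrightarrow> Ck_on k UNIV g \<Longrightarrow> Ck_on k UNIV (\<lambda>x. f x + g x)"
proof (induction k arbitrary: f g)
  case 0
  then show ?case by (auto intro: continuous_on_add)
next
  case (Suc k)
  have d: "((\<lambda>x. f x + g x) has_derivative
      (\<lambda>v. frechet_derivative f (at x) v + frechet_derivative g (at x) v)) (at x)" for x
    using Suc.prems by (auto intro!: has_derivative_add simp: frechet_derivative_works)
  then have "frechet_derivative (\<lambda>x. f x + g x) (at x) v =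
      frechet_derivative f (at x) v + frechet_derivative g (at x) v" for x v
    by (rule frechet_derivative_eqI)
  with Suc d show ?case by (auto simp: differentiable_def)
qed

lemma Ck_on_scaleR:
  fixes f :: "'a::real_normed_vector \<Rightarrow> real" and g :: "'a \<Rightarrow> 'b::real_normed_vector"
  shows "Ck_on k UNIV f \<Longrightarrow> Ck_on k UNIV g \<Longrightarrow> Ck_on k UNIV (\<lambda>x. f x *\<^sub>R g x)"
proof (induction k arbitrary: f g)
  case 0
  then show ?case by (auto intro: continuous_on_scaleR)
next
  case (Suc k)
  have d: "((\<lambda>x. f x *\<^sub>R g x) has_derivative
      (\<lambda>v. f x *\<^sub>R frechet_derivative g (at x) v + frechet_derivative f (at x) v *\<^sub>R g x)) (at x)" for x
    using Suc.prems by (auto intro!: has_derivative_scaleR simp: frechet_derivative_works)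
  then have "frechet_derivative (\<lambda>x. f x *\<^sub>R g x) (at x) v =
      f x *\<^sub>R frechet_derivative g (at x) v + frechet_derivative f (at x) v *\<^sub>R g x" for x v
    by (rule frechet_derivative_eqI)
  with Suc d Ck_on_Suc_imp[of k UNIV f] Ck_on_Suc_imp[of k UNIV g] show ?case
    by (auto simp: differentiable_def intro!: Ck_on_add)
qed

lemma Ck_on_mult:
  fixes f g :: "'a::real_normed_vector \<Rightarrow> real"
  shows "Ck_on k UNIV f \<Longrightarrow> Ck_on k UNIV g \<Longrightarrow> Ck_on k UNIV (\<lambda>x. f x * g x)"
  using Ck_on_scaleR[of k f g] by simp

lemma Ck_on_prod:
  fixes f :: "'i \<Rightarrow> 'a::real_normed_vector \<Rightarrow> real"
  assumes "finite I" and "\<And>i. i \<in> I \<Longrightarrow> Ck_on k UNIV (f i)"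
  shows "Ck_on k UNIV (\<lambda>x. \<Prod>i\<in>I. f i x)"
  using assms by (induction I rule: finite_induct) (auto intro: Ck_on_const Ck_on_mult)

lemma Ck_on_compose_affine:
  fixes f :: "'a::real_normed_vector \<Rightarrow> 'b::real_normed_vector"
  shows "Ck_on k UNIV f \<Longrightarrow> Ck_on k UNIV (\<lambda>y. f (c + s *\<^sub>R y))"
proof (induction k arbitrary: f)
  case 0
  then show ?case
    by (auto intro!: continuous_on_compose2[of UNIV f] continuous_intros)
next
  case (Suc k)
  have d: "((\<lambda>y. f (c + s *\<^sub>R y)) has_derivative
      (\<lambda>v. frechet_derivative f (at (c + s *\<^sub>R x)) (s *\<^sub>R v))) (at x)" for x
  proof (rule has_derivative_compose[of "\<lambda>y. c + s *\<^sub>R y" "\<lambda>v. s *\<^sub>R v"])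
    show "((\<lambda>y. c + s *\<^sub>R y) has_derivative (*\<^sub>R) s) (at x)"
      by (auto intro!: derivative_eq_intros)
    show "(f has_derivative frechet_derivative f (at (c + s *\<^sub>R x))) (at (c + s *\<^sub>R x))"
      using Suc.prems by (simp add: frechet_derivative_works)
  qed
  then have "frechet_derivative (\<lambda>y. f (c + s *\<^sub>R y)) (at x) v =
      frechet_derivative f (at (c + s *\<^sub>R x)) (s *\<^sub>R v)" for x v
    by (rule frechet_derivative_eqI)
  moreover have "Ck_on k UNIV (\<lambda>x. frechet_derivative f (at (c + s *\<^sub>R x)) (s *\<^sub>R v))" for v
    by (rule Suc.IH) (use Suc.prems in simp)
  moreover have "(\<lambda>y. f (c + s *\<^sub>R y)) differentiable at x" for x
    using d unfolding differentiable_def by blast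
  ultimately show ?case by simp
qed

section \<open>Test functions\<close>

lemma test_function_mono: "test_function D \<phi> \<Longrightarrow> D \<subseteq> D' \<Longrightarrow> test_function D' \<phi>"
  unfolding test_function_def by blast

lemma test_function_Ck: "test_function D \<phi> \<Longrightarrow> Ck_on k UNIV \<phi>"
  unfolding test_function_def by blast

lemma test_function_continuous: "test_function D \<phi> \<Longrightarrow> continuous_on S \<phi>"
  using test_function_Ck[of D \<phi> 0] by (auto intro: continuous_on_subset)

lemma test_function_has_derivative:
  "test_function D \<phi> \<Longrightarrow> (\<phi> has_derivative frechet_derivative \<phi> (at x)) (at x)"
  using test_function_Ck[of D \<phi> 1] by (simp add: frechet_derivative_works)

lemma test_function_derivative:
  assumes "test_function D \<phi>"
  shows "test_function D (\<lambda>x. frechet_derivative \<phi> (at x) v)"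
proof -
  obtain K where K: "compact K" "K \<subseteq> D" "\<And>x. x \<notin> K \<Longrightarrow> \<phi> x = 0"
    using assms unfolding test_function_def by blast
  have "frechet_derivative \<phi> (at x) v = 0" if "x \<notin> K" for x
  proof -
    have "open (- K)" using K(1) by (simp add: compact_imp_closed open_Compl)
    then have "(\<phi> has_derivative (\<lambda>_. 0)) (at x)"
      using that K(3) by (intro has_derivative_transform_within_open[of "\<lambda>_. 0" "\<lambda>_. 0" x UNIV "-K" \<phi>]) auto
    then show ?thesis by (rule frechet_derivative_eqI)
  qed
  moreover have "Ck_on k UNIV (\<lambda>x. frechet_derivative \<phi> (at x) v)" for k
    using test_function_Ck[OF assms, of "Suc k"] by simp
  ultimately show ?thesis using K unfolding test_function_def by blast
qed

lemma test_function_partial_deriv: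
  "test_function D \<phi> \<Longrightarrow> test_function D (partial_deriv j \<phi>)"
  unfolding partial_deriv_def[abs_def] by (rule test_function_derivative)

lemma test_function_mult:
  fixes \<phi> \<eta> :: "real^'n \<Rightarrow> real"
  assumes "test_function D \<phi>" and "\<And>k. Ck_on k UNIV \<eta>"
  shows "test_function D (\<lambda>x. \<eta> x * \<phi> x)"
proof -
  obtain K where "compact K" "K \<subseteq> D" "\<And>x. x \<notin> K \<Longrightarrow> \<phi> x = 0"
    using assms unfolding test_function_def by blast
  then have "\<exists>K. compact K \<and> K \<subseteq> D \<and> (\<forall>x. x \<notin> K \<longrightarrow> \<eta> x * \<phi> x = 0)"
    by auto
  then show ?thesis
    unfolding test_function_def using assms by (auto intro: Ck_on_mult test_function_Ck)
qed

lemma test_function_reflect: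
  fixes \<rho> :: "real^'n \<Rightarrow> 'b::real_normed_vector"
  assumes "test_function (ball 0 \<epsilon>) \<rho>"
  shows "test_function (ball x \<epsilon>) (\<lambda>y. \<rho> (x - y))"
proof -
  obtain K where K: "compact K" "K \<subseteq> ball 0 \<epsilon>" "\<And>x. x \<notin> K \<Longrightarrow> \<rho> x = 0"
    using assms unfolding test_function_def by blast
  have "compact ((\<lambda>y. x - y) ` K)"
    by (intro compact_continuous_image K continuous_intros)
  moreover have "(\<lambda>y. x - y) ` K \<subseteq> ball x \<epsilon>"
    using K(2) by (auto simp: dist_norm)
  moreover have "\<rho> (x - y) = 0" if "y \<notin> (\<lambda>y. x - y) ` K" for y
  proof (rule K(3))
    show "x - y \<notin> K" using that by (metis diff_diff_eq2 diff_add_cancel add_diff_cancel_left' image_eqI)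
  qed
  ultimately show ?thesis
    unfolding test_function_def
    using Ck_on_compose_affine[OF test_function_Ck[OF assms], of _ x "-1"] by auto
qed

lemma test_function_reflect_UNIV:
  fixes \<rho> :: "real^'n \<Rightarrow> 'b::real_normed_vector"
  assumes "test_function UNIV \<rho>"
  shows "test_function UNIV (\<lambda>y. \<rho> (x - y))"
proof -
  obtain K where K: "compact K" "\<And>x. x \<notin> K \<Longrightarrow> \<rho> x = 0"
    using assms unfolding test_function_def by blast
  then obtain r where "K \<subseteq> ball 0 r"
    using bounded_subset_ballD compact_imp_bounded by metis
  with K assms have "test_function (ball 0 r) \<rho>"
    unfolding test_function_def by blast
  then show ?thesis using test_function_reflect test_function_mono by blast
qed

lemma partial_deriv_reflect:
  fixes \<rho> :: "real^'n \<Rightarrow> real"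
  assumes "test_function D \<rho>"
  shows "partial_deriv j (\<lambda>y. \<rho> (x - y)) y = - partial_deriv j \<rho> (x - y)"
proof -
  have lin: "linear (frechet_derivative \<rho> (at (x - y)))"
    using test_function_has_derivative[OF assms] has_derivative_linear by blast
  have "((\<lambda>y. \<rho> (x - y)) has_derivative (\<lambda>v. frechet_derivative \<rho> (at (x - y)) (- v))) (at y)"
    by (rule has_derivative_compose[of "\<lambda>y. x - y" "\<lambda>v. - v"])
       (auto intro!: derivative_eq_intros test_function_has_derivative[OF assms])
  then show ?thesis
    unfolding partial_deriv_def using lin by (simp add: frechet_derivative_eqI linear_neg)
qed

lemma partial_deriv_mult:
  assumes "\<phi> differentiable at x" "\<eta> differentiable at x"
  shows "partial_deriv j (\<lambda>x. \<eta> x * \<phi> x) x = \<eta> x * partial_deriv j \<phi> x + partial_deriv j \<eta> x * \<phi> x"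
proof -
  have "((\<lambda>x. \<eta> x * \<phi> x) has_derivative
      (\<lambda>v. \<eta> x * frechet_derivative \<phi> (at x) v + frechet_derivative \<eta> (at x) v * \<phi> x)) (at x)"
    using assms by (auto intro!: has_derivative_mult simp: frechet_derivative_works)
  then show ?thesis unfolding partial_deriv_def by (rule frechet_derivative_eqI)
qed

lemma test_function_bounded:
  fixes \<phi> :: "real^'n \<Rightarrow> 'b::real_normed_vector"
  assumes "test_function D \<phi>"
  obtains B where "B \<ge> 0" "\<And>x. norm (\<phi> x) \<le> B"
proof -
  obtain K where K: "compact K" "\<And>x. x \<notin> K \<Longrightarrow> \<phi> x = 0"
    using assms unfolding test_function_def by blast
  have "compact (\<phi> ` K)"
    by (intro compact_continuous_image test_function_continuous[OF assms] K)
  then obtain B where "\<And>y. y \<in> \<phi> ` K \<Longrightarrow> norm y \<le> B"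
    using compact_imp_bounded bounded_iff by metis
  then have "norm (\<phi> x) \<le> max B 0" for x
    using K(2)[of x] by (cases "x \<in> K") (auto simp: le_max_iff_disj)
  then show ?thesis using that[of "max B 0"] by auto
qed

lemma test_function_measurable [measurable_dest]:
  fixes \<phi> :: "real^'n \<Rightarrow> 'b::real_normed_vector"
  shows "test_function D \<phi> \<Longrightarrow> \<phi> \<in> borel_measurable borel"
  by (rule borel_measurable_continuous_onI) (rule test_function_continuous)

lemma integrable_bounded_support:
  fixes f :: "real^'n \<Rightarrow> 'b::{banach, second_countable_topology}"
  assumes "f \<in> borel_measurable borel" "\<And>x. norm (f x) \<le> B"
    and "bounded K" "\<And>x. x \<notin> K \<Longrightarrow> f x = 0"
  shows "integrable lborel f"
proof -
  obtain r where r: "K \<subseteq> cball 0 r"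
    using bounded_subset_ballD[OF assms(3), of 0] ball_subset_cball by blast
  have "emeasure lborel (cball (0::real^'n) r) < \<infinity>"
    by (intro emeasure_bounded_finite) auto
  then have "integrable lborel (\<lambda>x. B * indicator (cball (0::real^'n) r) x :: real)"
    by (intro integrable_mult_right) (auto simp: integrable_indicator_iff)
  then show ?thesis
  proof (rule Bochner_Integration.integrable_bound)
    show "AE x in lborel. norm (f x) \<le> norm (B * indicator (cball 0 r) x :: real)"
    proof (intro AE_I2)
      fix x
      show "norm (f x) \<le> norm (B * indicator (cball 0 r) x :: real)"
        using assms(2)[of x] assms(4)[of x] r by (cases "x \<in> K") (auto simp: indicator_def subset_iff)
    qed
  qed (use assms(1) in simp)
qed

lemma test_function_integrable:
  fixes \<phi> :: "real^'n \<Rightarrow> 'b::{banach, second_countable_topology}"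
  assumes "test_function D \<phi>"
  shows "integrable lborel \<phi>"
proof -
  obtain K where "compact K" "\<And>x. x \<notin> K \<Longrightarrow> \<phi> x = 0"
    using assms unfolding test_function_def by blast
  moreover obtain B where "\<And>x. norm (\<phi> x) \<le> B"
    using test_function_bounded[OF assms] by blast
  ultimately show ?thesis
    using assms by (intro integrable_bounded_support[of \<phi> B K]) (auto intro: compact_imp_bounded test_function_measurable)
qed

text \<open>The family of functions $p(1/t)\,e^{-1/t}$, with a polynomial $p$, extended by 0 to $t \le 0$, is
  closed under differentiation. Hence its members are smooth, and they yield the bump functions below.\<close>

definition flat_exp :: "real poly \<Rightarrow> real \<Rightarrow> real" where
  "flat_exp p t = (if t > 0 then poly p (1/t) * exp (- (1/t)) else 0)"

lemma flat_exp_eq_0: "t \<le> 0 \<Longrightarrow> flat_exp p t = 0"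
  by (simp add: flat_exp_def)

text \<open>This limit is the derivative at 0: exponential decay in $1/t$ beats every polynomial.\<close>

lemma flat_exp_over_tendsto_0: "((\<lambda>t. flat_exp p t / t) \<longlongrightarrow> 0) (at 0)"
proof -
  have mono: "((\<lambda>s::real. s ^ k / exp s) \<longlongrightarrow> 0) at_top" for k
    by (rule tendsto_power_div_exp_0)
  have "((\<lambda>s. poly q s * exp (-s)) \<longlongrightarrow> 0) at_top" for q :: "real poly"
  proof -
    have "((\<lambda>s. \<Sum>i\<le>degree q. coeff q i * (s ^ i / exp s)) \<longlongrightarrow> (\<Sum>i\<le>degree q. coeff q i * 0)) at_top"
      by (intro tendsto_intros mono)
    then show ?thesis
      by (simp add: poly_altdef sum_distrib_right exp_minus field_simps sum_divide_distrib)
  qed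
  from this[of "pCons 0 p"] have "((\<lambda>t. poly (pCons 0 p) (inverse t) * exp (- inverse t)) \<longlongrightarrow> 0) (at_right 0)"
    by (rule filterlim_compose) (rule filterlim_inverse_at_top_right)
  then have "((\<lambda>t. flat_exp p t / t) \<longlongrightarrow> 0) (at_right 0)"
    by (rule Lim_transform_eventually)
       (auto simp: eventually_at_right_field flat_exp_def field_simps intro!: exI[of _ 1])
  moreover have "((\<lambda>t. flat_exp p t / t) \<longlongrightarrow> 0) (at_left 0)"
    by (rule Lim_transform_eventually[OF tendsto_const])
       (auto simp: eventually_at_left_field flat_exp_def intro!: exI[of _ "-1"])
  ultimately show ?thesis by (rule filterlim_split_at[rotated])
qed

text \<open>For $t>0$ the chain rule gives $t^{-2}\,(p - p')(1/t)\,e^{-1/t}$, which explains the polynomial.\<close>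

lemma flat_exp_has_derivative:
  "(flat_exp p has_field_derivative flat_exp ([:0,0,1:] * (p - pderiv p)) t) (at t)"
proof -
  consider "t > 0" | "t < 0" | "t = 0" by linarith
  then show ?thesis
  proof cases
    case 1
    have "((\<lambda>t. poly p (1/t) * exp (- (1/t))) has_field_derivative
        flat_exp ([:0,0,1:] * (p - pderiv p)) t) (at t)"
      using 1 unfolding flat_exp_def
      by (auto intro!: derivative_eq_intros DERIV_chain2[OF poly_DERIV] simp: field_simps power2_eq_square)
    then show ?thesis
      by (rule has_field_derivative_transform_within_open[of _ _ _ "{0<..}"])
         (use 1 in \<open>auto simp: flat_exp_def\<close>)
  next
    case 2
    have "((\<lambda>t. 0) has_field_derivative flat_exp ([:0,0,1:] * (p - pderiv p)) t) (at t)"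
      using 2 by (auto simp: flat_exp_def)
    then show ?thesis
      by (rule has_field_derivative_transform_within_open[of _ _ _ "{..<0}"])
         (use 2 in \<open>auto simp: flat_exp_def\<close>)
  next
    case 3
    then show ?thesis
      using flat_exp_over_tendsto_0[of p] by (auto simp: has_field_derivative_iff flat_exp_def[of _ 0])
  qed
qed

lemma Ck_on_flat_exp_component:
  "Ck_on k UNIV (\<lambda>x::real^'n. flat_exp p (c + s * x $ i))"
proof (induction k arbitrary: p)
  case 0
  have "continuous_on UNIV (flat_exp p)"
    by (intro continuous_at_imp_continuous_on ballI DERIV_isCont[OF flat_exp_has_derivative])
  then show ?case
    by (auto intro!: continuous_on_compose2[of UNIV "flat_exp p"] continuous_intros)
next
  case (Suc k)
  have d: "((\<lambda>x::real^'n. flat_exp p (c + s * x $ i)) has_derivative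
      (\<lambda>v. flat_exp ([:0,0,1:] * (p - pderiv p)) (c + s * x $ i) * (s * v $ i))) (at x)" for x
    by (rule has_derivative_compose[of "\<lambda>x. c + s * x $ i" "\<lambda>v. s * v $ i"])
       (auto intro!: derivative_eq_intros bounded_linear.has_derivative[OF bounded_linear_vec_nth]
         flat_exp_has_derivative[unfolded has_field_derivative_def] simp del: mult_pCons_left)
  have "Ck_on k UNIV (\<lambda>x::real^'n. flat_exp ([:0,0,1:] * (p - pderiv p)) (c + s * x $ i) * (s * v $ i))" for v :: "real^'n"
    by (intro Ck_on_mult Suc Ck_on_const)
  moreover have "(\<lambda>x::real^'n. flat_exp p (c + s * x $ i)) differentiable at x" for x
    using d unfolding differentiable_def by blast
  ultimately show ?case
    by (simp only: Ck_on.simps frechet_derivative_eqI[OF d]) simp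
qed

lemma bump_exists:
  assumes "\<epsilon> > 0"
  obtains \<rho> :: "real^'n \<Rightarrow> real" where "test_function (ball 0 \<epsilon>) \<rho>" "\<And>x. \<rho> x \<ge> 0"
    "integral\<^sup>L lborel \<rho> = 1"
proof -
  \<comment> \<open>The cube of half side \<open>\<delta>\<close> lies in the ball of radius \<open>\<epsilon> / 2\<close>, by the \<open>l\<^sup>1\<close> bound for the norm.\<close>
  define \<delta> where "\<delta> = \<epsilon> / (2 * CARD('n))"
  have \<delta>: "\<delta> > 0" using assms by (simp add: \<delta>_def)
  define b where "b = (\<lambda>x::real^'n. \<Prod>i\<in>UNIV. flat_exp 1 (\<delta> + 1 * x $ i) * flat_exp 1 (\<delta> + (-1) * x $ i))"
  have Ck: "Ck_on k UNIV b" for k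
    unfolding b_def by (intro Ck_on_prod Ck_on_mult Ck_on_flat_exp_component) auto
  have pos: "flat_exp 1 t \<ge> 0" for t by (simp add: flat_exp_def)
  have b0: "b x \<ge> 0" for x unfolding b_def by (intro prod_nonneg mult_nonneg_nonneg pos ballI)
  have bpos: "b x > 0 \<longleftrightarrow> (\<forall>i. \<bar>x $ i\<bar> < \<delta>)" for x
  proof
    assume "\<forall>i. \<bar>x $ i\<bar> < \<delta>"
    then have "\<delta> + x $ i > 0 \<and> \<delta> - x $ i > 0" for i by (auto simp: abs_less_iff dest: spec[of _ i])
    then show "b x > 0"
      unfolding b_def by (intro prod_pos mult_pos_pos ballI) (auto simp: flat_exp_def)
  next
    assume L: "b x > 0"
    show "\<forall>i. \<bar>x $ i\<bar> < \<delta>"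
    proof
      fix i
      have "flat_exp 1 (\<delta> + x $ i) \<noteq> 0" "flat_exp 1 (\<delta> - x $ i) \<noteq> 0"
        using L unfolding b_def by (auto dest!: less_imp_neq[THEN not_sym])
      then have "\<delta> + x $ i > 0" "\<delta> - x $ i > 0"
        using flat_exp_eq_0 by (meson not_less)+
      then show "\<bar>x $ i\<bar> < \<delta>" by linarith
    qed
  qed
  have nrm: "norm x \<le> \<epsilon> / 2" if "b x \<noteq> 0" for x
  proof -
    have "b x > 0" using that b0[of x] by simp
    then have "\<bar>x $ i\<bar> < \<delta>" for i unfolding bpos by blast
    then have "(\<Sum>i\<in>UNIV. \<bar>x $ i\<bar>) \<le> (\<Sum>i\<in>(UNIV::'n set). \<delta>)"
      by (intro sum_mono less_imp_le)
    also have "\<dots> = \<epsilon> / 2" by (simp add: \<delta>_def)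
    finally show ?thesis using norm_le_l1_cart[of x] by linarith
  qed
  have tb: "test_function (ball 0 \<epsilon>) b"
    unfolding test_function_def
  proof (intro conjI allI Ck exI[of _ "cball 0 (\<epsilon>/2)"] impI)
    show "cball 0 (\<epsilon> / 2) \<subseteq> ball (0::real^'n) \<epsilon>" using assms by auto
    show "b x = 0" if "x \<notin> cball 0 (\<epsilon> / 2)" for x using nrm[of x] that by auto
  qed simp
  have int: "integrable lborel b" using tb by (rule test_function_integrable)
  have "integral\<^sup>L lborel b \<noteq> 0"
  proof
    assume "integral\<^sup>L lborel b = 0"
    then have ae: "AE x in lborel. b x = 0"
      using integral_nonneg_eq_0_iff_AE[OF int] b0 by simp
    have "open {x. 0 < b x}"
      using test_function_continuous[OF tb, of UNIV] by (intro open_Collect_less) auto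
    moreover have "{x. 0 < b x} \<in> null_sets lborel"
    proof (rule AE_iff_null_sets[THEN iffD2])
      show "{x. 0 < b x} \<in> sets lborel" using calculation by simp
      show "AE x in lborel. x \<notin> {x. 0 < b x}" using ae by eventually_elim auto
    qed
    ultimately have "{x. 0 < b x} = {}"
      using open_not_negligible null_sets_completionI negligible_iff_null_sets by blast
    moreover have "0 \<in> {x. 0 < b x}" using bpos[of 0] \<delta> by simp
    ultimately show False by blast
  qed
  moreover have "integral\<^sup>L lborel b \<ge> 0" using b0 by (simp add: integral_nonneg)
  ultimately have I: "integral\<^sup>L lborel b > 0" by simp
  define \<rho> where "\<rho> = (\<lambda>x. inverse (integral\<^sup>L lborel b) * b x)"
  show ?thesis
  proof
    show "test_function (ball 0 \<epsilon>) \<rho>"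
      unfolding \<rho>_def by (intro test_function_mult tb Ck_on_const)
    show "\<rho> x \<ge> 0" for x unfolding \<rho>_def using b0 I by simp
    show "integral\<^sup>L lborel \<rho> = 1" unfolding \<rho>_def using I int by simp
  qed
qed

section \<open>Mollification\<close>

lemma distr_lborel_reflect: "distr lborel borel (\<lambda>x. t - x) = (lborel :: 'a::euclidean_space measure)"
proof -
  show ?thesis using lborel_affine[of "-1" t] by (simp add: density_1)
qed

lemma distr_lborel_translate: "distr lborel borel (\<lambda>x. x - h) = (lborel :: 'a::euclidean_space measure)"
proof -
  show ?thesis using lborel_affine[of 1 "- h"] by (simp add: density_1)
qed

lemma nn_integral_translate:
  fixes f :: "'a::euclidean_space \<Rightarrow> ennreal"
  assumes "f \<in> borel_measurable borel"
  shows "(\<integral>\<^sup>+x. f (x - h) \<partial>lborel) = (\<integral>\<^sup>+x. f x \<partial>lborel)"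
  by (subst (2) distr_lborel_translate[of h, symmetric]) (use assms in \<open>simp add: nn_integral_distr\<close>)

lemma integral_reflect:
  fixes f :: "'a::euclidean_space \<Rightarrow> 'b::{banach, second_countable_topology}"
  assumes "f \<in> borel_measurable borel"
  shows "(\<integral>x. f (t - x) \<partial>lborel) = (\<integral>x. f x \<partial>lborel)"
  by (subst (2) distr_lborel_reflect[of t, symmetric]) (use assms in \<open>simp add: integral_distr\<close>)

lemma integrable_reflect:
  fixes f :: "'a::euclidean_space \<Rightarrow> 'b::{banach, second_countable_topology}"
  assumes "integrable lborel f"
  shows "integrable lborel (\<lambda>x. f (t - x))"
proof -
  have "f \<in> borel_measurable borel" using assms by simp
  then show ?thesis
    using assms integrable_distr_eq[of "\<lambda>x. t - x" lborel borel f] by (simp add: distr_lborel_reflect)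
qed

lemma integral_translate:
  fixes f :: "'a::euclidean_space \<Rightarrow> 'b::{banach, second_countable_topology}"
  assumes "f \<in> borel_measurable borel"
  shows "(\<integral>x. f (x - h) \<partial>lborel) = (\<integral>x. f x \<partial>lborel)"
  by (subst (2) distr_lborel_translate[of h, symmetric]) (use assms in \<open>simp add: integral_distr\<close>)

lemma integrable_translate:
  fixes f :: "'a::euclidean_space \<Rightarrow> 'b::{banach, second_countable_topology}"
  assumes "integrable lborel f"
  shows "integrable lborel (\<lambda>x. f (x - h))"
proof -
  have "f \<in> borel_measurable borel" using assms by simp
  then show ?thesis
    using assms integrable_distr_eq[of "\<lambda>x. x - h" lborel borel f] by (simp add: distr_lborel_translate)
qed

subsection \<open>Translations are continuous in the mean\<close>

text \<open>Small translations keep each point of an open set inside it, so the indicator functions converge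
  pointwise on the set and dominated convergence applies. Points that enter the set are treated by
  translating back.\<close>

lemma translation_open_tendsto:
  fixes U :: "'a::euclidean_space set"
  assumes U: "open U" "emeasure lborel U < \<infinity>" and h: "h \<longlonglongrightarrow> 0"
  shows "(\<lambda>n. \<integral>x. \<bar>indicator U (x - h n) - indicator U x :: real\<bar> \<partial>lborel) \<longlonglongrightarrow> 0"
proof -
  have [measurable]: "U \<in> sets borel" using U by simp
  have intU: "integrable lborel (indicator U :: 'a \<Rightarrow> real)" using U by (simp add: integrable_indicator_iff)
  have dom: "(\<lambda>n. \<integral>x. (indicator U x * (1 - indicator U (x + g n)) :: real) \<partial>lborel) \<longlonglongrightarrow> 0"
    if g: "g \<longlonglongrightarrow> 0" for g :: "nat \<Rightarrow> 'a"
  proof -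
    have "(\<lambda>n. \<integral>x. indicator U x * (1 - indicator U (x + g n)) \<partial>lborel) \<longlonglongrightarrow> (\<integral>x. (0::real) \<partial>(lborel :: 'a measure))"
    proof (rule integral_dominated_convergence[where w = "indicator U"])
      show "AE x in lborel. (\<lambda>n. indicator U x * (1 - indicator U (x + g n)) :: real) \<longlonglongrightarrow> 0"
      proof (intro AE_I2)
        fix x
        show "(\<lambda>n. indicator U x * (1 - indicator U (x + g n)) :: real) \<longlonglongrightarrow> 0"
        proof (cases "x \<in> U")
          case True
          have "(\<lambda>n. x + g n) \<longlonglongrightarrow> x + 0" using g by (intro tendsto_intros)
          then have "eventually (\<lambda>n. x + g n \<in> U) sequentially"
            using True U topological_tendstoD by fastforce
          then show ?thesis
            using True by (intro tendsto_eventually) (auto elim!: eventually_mono simp: indicator_def)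
        qed simp
      qed
    qed (use intU in \<open>auto simp: indicator_def\<close>)
    then show ?thesis by simp
  qed
  have eq: "(\<integral>x. \<bar>indicator U (x - h n) - indicator U x :: real\<bar> \<partial>lborel) =
      (\<integral>x. indicator U x * (1 - indicator U (x + - h n)) \<partial>lborel) +
      (\<integral>x. indicator U x * (1 - indicator U (x + h n)) \<partial>lborel)" for n
  proof -
    have i: "integrable lborel (\<lambda>x. indicator U x * (1 - indicator U (x + k)) :: real)" for k
      by (rule Bochner_Integration.integrable_bound[OF intU]) (auto simp: indicator_def)
    have "(\<integral>x. indicator U x * (1 - indicator U (x + h n)) \<partial>lborel) =
        (\<integral>x. indicator U (x - h n) * (1 - indicator U (x - h n + h n)) \<partial>lborel :: real)"
      by (rule integral_translate[symmetric, where h = "h n"]) auto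
    moreover have "integrable lborel (\<lambda>x. indicator U (x - h n) * (1 - indicator U (x - h n + h n)) :: real)"
      by (rule integrable_translate[OF i[of "h n"]])
    moreover have "(\<integral>x. \<bar>indicator U (x - h n) - indicator U x :: real\<bar> \<partial>lborel) =
        (\<integral>x. indicator U x * (1 - indicator U (x + - h n)) +
          indicator U (x - h n) * (1 - indicator U (x - h n + h n)) \<partial>lborel)"
      by (rule Bochner_Integration.integral_cong) (auto simp: indicator_def)
    ultimately show ?thesis
      using Bochner_Integration.integral_add[OF i[of "- h n"]] by simp
  qed
  have "(\<lambda>n. (\<integral>x. indicator U x * (1 - indicator U (x + - h n)) \<partial>lborel) +
      (\<integral>x. indicator U x * (1 - indicator U (x + h n)) \<partial>lborel)) \<longlonglongrightarrow> (0::real) + 0"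
    using h tendsto_minus[OF h] by (intro tendsto_add dom) simp_all
  then show ?thesis unfolding eq by simp
qed

text \<open>Outer regularity reduces the case of an indicator function to open sets.\<close>

lemma translation_L1_tendsto:
  fixes f :: "'a::euclidean_space \<Rightarrow> 'b::{banach, second_countable_topology}"
  assumes "integrable lborel f" and h: "h \<longlonglongrightarrow> 0"
  shows "(\<lambda>n. \<integral>x. norm (f (x - h n) - f x) \<partial>lborel) \<longlonglongrightarrow> 0"
  using assms(1)
proof (induction f rule: integrable_induct)
  case (base A c)
  have [measurable]: "A \<in> sets borel" using base by simp
  have "(\<lambda>n. \<integral>x. \<bar>indicator A (x - h n) - indicator A x :: real\<bar> \<partial>lborel) \<longlonglongrightarrow> 0"
  proof (rule LIMSEQ_I)
    fix e :: real assume e: "0 < e"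
    obtain U where U: "open U" "A \<subseteq> U" "emeasure lborel (U - A) < e / 4"
      using outer_regular_lborel[of A "e/4"] e base by auto
    have [measurable]: "U \<in> sets borel" using U by simp
    have "emeasure lborel U \<le> emeasure lborel A + emeasure lborel (U - A)"
      using U emeasure_subadditive[of A lborel "U - A"] by (simp add: Un_absorb1)
    then have fU: "emeasure lborel U < \<infinity>"
      using base U(3) by (metis ennreal_add_less_top ennreal_less_top infinity_ennreal_def order_le_less_trans order_less_trans)
    have fD: "emeasure lborel (U - A) < \<infinity>"
      using U(3) by (metis ennreal_less_top infinity_ennreal_def order_less_trans)
    have iA: "integrable lborel (indicator A :: 'a \<Rightarrow> real)" using base by (simp add: integrable_indicator_iff)
    have iU: "integrable lborel (indicator U :: 'a \<Rightarrow> real)" using fU by (simp add: integrable_indicator_iff)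
    have iD: "integrable lborel (indicator (U - A) :: 'a \<Rightarrow> real)" using fD by (simp add: integrable_indicator_iff)
    have mD: "(\<integral>x. indicator (U - A) x \<partial>lborel) \<le> e / 4"
    proof -
      have "emeasure lborel (U - A) = ennreal (measure lborel (U - A))"
        using fD by (intro emeasure_eq_ennreal_measure) auto
      then have "measure lborel (U - A) < e / 4"
        using U(3) by (simp add: ennreal_less_iff)
      then show ?thesis by simp
    qed
    obtain N where N: "\<And>n. n \<ge> N \<Longrightarrow> (\<integral>x. \<bar>indicator U (x - h n) - indicator U x :: real\<bar> \<partial>lborel) < e / 4"
      using LIMSEQ_D[OF translation_open_tendsto[OF U(1) fU h], of "e/4"] e by (auto simp: abs_less_iff)
    have "(\<integral>x. \<bar>indicator A (x - h n) - indicator A x :: real\<bar> \<partial>lborel) < e" if "n \<ge> N" for n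
    proof -
      have "(\<integral>x. \<bar>indicator A (x - h n) - indicator A x :: real\<bar> \<partial>lborel) \<le>
          (\<integral>x. (\<bar>indicator U (x - h n) - indicator U x\<bar> + indicator (U - A) (x - h n)) + indicator (U - A) x \<partial>lborel)"
        using U(2)
        by (intro integral_mono Bochner_Integration.integrable_add Bochner_Integration.integrable_diff
            integrable_abs integrable_translate iA iU iD) (auto simp: indicator_def)
      also have "\<dots> = (\<integral>x. \<bar>indicator U (x - h n) - indicator U x :: real\<bar> \<partial>lborel) +
          (\<integral>x. indicator (U - A) (x - h n) \<partial>lborel) + (\<integral>x. indicator (U - A) x \<partial>lborel)"
        using iU iD by (simp add: Bochner_Integration.integral_add Bochner_Integration.integrable_add
            Bochner_Integration.integrable_diff integrable_translate integrable_abs)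
      also have "(\<integral>x. indicator (U - A) (x - h n) \<partial>lborel) = (\<integral>x. indicator (U - A) x \<partial>lborel :: real)"
        by (rule integral_translate) simp
      finally show ?thesis using mD N[OF that] e by linarith
    qed
    then show "\<exists>no. \<forall>n\<ge>no. norm ((\<integral>x. \<bar>indicator A (x - h n) - indicator A x :: real\<bar> \<partial>lborel) - 0) < e"
      by (intro exI[of _ N]) (auto simp: abs_of_nonneg)
  qed
  then have "(\<lambda>n. (\<integral>x. \<bar>indicator A (x - h n) - indicator A x :: real\<bar> \<partial>lborel) * norm c) \<longlonglongrightarrow> 0 * norm c"
    by (rule tendsto_mult_right)
  then show ?case
    by (simp add: scaleR_diff_left[symmetric] del: scaleR_diff_left)
next
  case (add f g)
  have "(\<lambda>n. (\<integral>x. norm (f (x - h n) - f x) \<partial>lborel) + (\<integral>x. norm (g (x - h n) - g x) \<partial>lborel)) \<longlonglongrightarrow> 0 + 0"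
    by (intro tendsto_add add)
  then have lim0: "(\<lambda>n. (\<integral>x. norm (f (x - h n) - f x) \<partial>lborel) + (\<integral>x. norm (g (x - h n) - g x) \<partial>lborel)) \<longlonglongrightarrow> 0"
    by simp
  show ?case
  proof (rule Lim_null_comparison[OF _ lim0])
    show "\<forall>\<^sub>F n in sequentially. norm (\<integral>x. norm (f (x - h n) + g (x - h n) - (f x + g x)) \<partial>lborel)
        \<le> (\<integral>x. norm (f (x - h n) - f x) \<partial>lborel) + (\<integral>x. norm (g (x - h n) - g x) \<partial>lborel)"
    proof (intro always_eventually allI)
      fix n
      have "(\<integral>x. norm (f (x - h n) + g (x - h n) - (f x + g x)) \<partial>lborel) \<le>
          (\<integral>x. norm (f (x - h n) - f x) + norm (g (x - h n) - g x) \<partial>lborel)"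
        using \<open>integrable lborel f\<close> \<open>integrable lborel g\<close> by (intro integral_mono Bochner_Integration.integrable_add Bochner_Integration.integrable_diff
            integrable_norm integrable_translate) (auto simp: add_diff_add norm_triangle_ineq)
      also have "\<dots> = (\<integral>x. norm (f (x - h n) - f x) \<partial>lborel) + (\<integral>x. norm (g (x - h n) - g x) \<partial>lborel)"
        using \<open>integrable lborel f\<close> \<open>integrable lborel g\<close> by (intro Bochner_Integration.integral_add integrable_norm Bochner_Integration.integrable_diff
            integrable_translate)
      finally show "norm (\<integral>x. norm (f (x - h n) + g (x - h n) - (f x + g x)) \<partial>lborel)
        \<le> (\<integral>x. norm (f (x - h n) - f x) \<partial>lborel) + (\<integral>x. norm (g (x - h n) - g x) \<partial>lborel)"
        by (simp add: abs_of_nonneg)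
    qed
  qed
next
  case (lim f s)
  have s_int: "integrable lborel (s i)" and f_int: "integrable lborel f"
    and s_lim: "(\<lambda>i. s i x) \<longlonglongrightarrow> f x" and s_bd: "norm (s i x) \<le> 2 * norm (f x)"
    and s_IH: "(\<lambda>n. \<integral>x. norm (s i (x - h n) - s i x) \<partial>lborel) \<longlonglongrightarrow> 0" for i x
    using lim by auto
  have i1: "integrable lborel (\<lambda>x. norm (s i x - f x))" for i
    using s_int f_int by (intro integrable_norm Bochner_Integration.integrable_diff)
  have "(\<lambda>i. \<integral>x. norm (s i x - f x) \<partial>lborel) \<longlonglongrightarrow> (\<integral>x. 0 \<partial>(lborel :: 'a measure))"
  proof (rule integral_dominated_convergence[where w = "\<lambda>x. 3 * norm (f x)"])
    show "AE x in lborel. (\<lambda>i. norm (s i x - f x)) \<longlonglongrightarrow> 0"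
      using s_lim by (auto intro!: tendsto_norm_zero LIM_zero)
    show "AE x in lborel. norm (norm (s i x - f x)) \<le> 3 * norm (f x)" for i
    proof (intro AE_I2)
      fix x
      show "norm (norm (s i x - f x)) \<le> 3 * norm (f x)"
        using s_bd[of i x] norm_triangle_ineq4[of "s i x" "f x"] by simp
    qed
  qed (use f_int i1 in auto)
  then have l0: "(\<lambda>i. \<integral>x. norm (s i x - f x) \<partial>lborel) \<longlonglongrightarrow> 0" by simp
  show ?case
  proof (rule LIMSEQ_I)
    fix e :: real assume e: "0 < e"
    obtain i where i: "(\<integral>x. norm (s i x - f x) \<partial>lborel) < e / 3"
      using LIMSEQ_D[OF l0, of "e/3"] e by force
    obtain N where N: "\<And>n. n \<ge> N \<Longrightarrow> (\<integral>x. norm (s i (x - h n) - s i x) \<partial>lborel) < e / 3"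
      using LIMSEQ_D[OF s_IH[of i], of "e/3"] e by force
    have "(\<integral>x. norm (f (x - h n) - f x) \<partial>lborel) < e" if "n \<ge> N" for n
    proof -
      have "(\<integral>x. norm (f (x - h n) - f x) \<partial>lborel) \<le>
          (\<integral>x. (norm (s i (x - h n) - f (x - h n)) + norm (s i (x - h n) - s i x)) + norm (s i x - f x) \<partial>lborel)"
      proof (rule integral_mono)
        fix x
        have "f (x - h n) - f x = - (s i (x - h n) - f (x - h n)) + (s i (x - h n) - s i x) + (s i x - f x)" by simp
        then show "norm (f (x - h n) - f x) \<le> norm (s i (x - h n) - f (x - h n)) + norm (s i (x - h n) - s i x) + norm (s i x - f x)"
          by (metis norm_minus_cancel norm_triangle_le norm_triangle_mono order_refl)
      qed (use s_int f_int in \<open>auto intro!: Bochner_Integration.integrable_add Bochner_Integration.integrable_diff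
            integrable_norm integrable_translate integrable_translate[OF i1]\<close>)
      also have "\<dots> = (\<integral>x. norm (s i (x - h n) - f (x - h n)) \<partial>lborel) + (\<integral>x. norm (s i (x - h n) - s i x) \<partial>lborel)
          + (\<integral>x. norm (s i x - f x) \<partial>lborel)"
        using s_int f_int by (simp add: Bochner_Integration.integral_add Bochner_Integration.integrable_add
            Bochner_Integration.integrable_diff integrable_translate integrable_norm)
      also have "(\<integral>x. norm (s i (x - h n) - f (x - h n)) \<partial>lborel) = (\<integral>x. norm (s i x - f x) \<partial>lborel)"
        by (rule integral_translate) (use i1[of i] in simp)
      finally show ?thesis using i N[OF that] by linarith
    qed
    then show "\<exists>no. \<forall>n\<ge>no. norm ((\<integral>x. norm (f (x - h n) - f x) \<partial>lborel) - 0) < e"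
      by (intro exI[of _ N]) (auto simp: abs_of_nonneg)
  qed
qed

lemma translation_L1_small:
  fixes f :: "'a::euclidean_space \<Rightarrow> 'b::{banach, second_countable_topology}"
  assumes f: "integrable lborel f" and "e > 0"
  obtains d where "d > 0" "\<And>h. norm h < d \<Longrightarrow> (\<integral>\<^sup>+x. norm (f (x - h) - f x) \<partial>lborel) \<le> ennreal e"
proof -
  have "\<exists>d>0. \<forall>h. norm h < d \<longrightarrow> (\<integral>x. norm (f (x - h) - f x) \<partial>lborel) \<le> e"
  proof (rule ccontr)
    assume "\<not> ?thesis"
    then have "\<exists>h. norm h < inverse (Suc n) \<and> \<not> (\<integral>x. norm (f (x - h) - f x) \<partial>lborel) \<le> e" for n
      by (metis inverse_positive_iff_positive of_nat_0_less_iff zero_less_Suc)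
    then obtain h where h: "\<And>n. norm (h n) < inverse (Suc n)" "\<And>n. (\<integral>x. norm (f (x - h n) - f x) \<partial>lborel) > e"
      by (metis not_le)
    have "h \<longlonglongrightarrow> 0"
      by (rule Lim_null_comparison[OF _ LIMSEQ_inverse_real_of_nat])
         (intro always_eventually allI less_imp_le h(1))
    from LIMSEQ_D[OF translation_L1_tendsto[OF f this] assms(2)] obtain n
      where "norm ((\<integral>x. norm (f (x - h n) - f x) \<partial>lborel) - 0) < e" by blast
    with h(2)[of n] show False by simp
  qed
  then obtain d where d: "d > 0" "\<And>h. norm h < d \<Longrightarrow> (\<integral>x. norm (f (x - h) - f x) \<partial>lborel) \<le> e" by blast
  show ?thesis
  proof (rule that[OF d(1)])
    fix h :: 'a assume "norm h < d"
    have "integrable lborel (\<lambda>x. norm (f (x - h) - f x))"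
      using f by (intro integrable_norm Bochner_Integration.integrable_diff integrable_translate)
    then show "(\<integral>\<^sup>+x. norm (f (x - h) - f x) \<partial>lborel) \<le> ennreal e"
      using d(2)[OF \<open>norm h < d\<close>] by (subst nn_integral_eq_integral) (auto intro: ennreal_leI)
  qed
qed

subsection \<open>Mollified functions are smooth\<close>

definition mollify ::
    "(real^'n \<Rightarrow> real) \<Rightarrow> (real^'n \<Rightarrow> 'b::euclidean_space) \<Rightarrow> real^'n \<Rightarrow> 'b" where
  "mollify \<rho> f x = (\<integral>y. \<rho> (x - y) *\<^sub>R f y \<partial>lborel)"

lemma frechet_derivative_eq_sum_partial_deriv:
  fixes \<phi> :: "real^'n \<Rightarrow> real"
  assumes "\<phi> differentiable at x"
  shows "frechet_derivative \<phi> (at x) h = (\<Sum>j\<in>UNIV. h $ j * partial_deriv j \<phi> x)"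
proof -
  have lin: "linear (frechet_derivative \<phi> (at x))"
    using assms by (rule linear_frechet_derivative)
  have "frechet_derivative \<phi> (at x) h = frechet_derivative \<phi> (at x) (\<Sum>j\<in>UNIV. (h $ j) *\<^sub>R axis j 1)"
    using basis_expansion[of h] by (simp add: scalar_mult_eq_scaleR)
  also have "\<dots> = (\<Sum>j\<in>UNIV. h $ j * partial_deriv j \<phi> x)"
    by (simp add: linear_sum[OF lin] linear_scale[OF lin] partial_deriv_def)
  finally show ?thesis .
qed

lemma test_function_mvt:
  fixes \<phi> :: "real^'n \<Rightarrow> real"
  assumes "test_function D \<phi>"
  obtains t where "0 < t" "t < 1" "\<phi> (z + h) - \<phi> z = (\<Sum>j\<in>UNIV. h $ j * partial_deriv j \<phi> (z + t *\<^sub>R h))"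
proof -
  have "((\<lambda>t. \<phi> (z + t *\<^sub>R h)) has_derivative (\<lambda>s. frechet_derivative \<phi> (at (z + t *\<^sub>R h)) (s *\<^sub>R h))) (at t within {0..1})" for t
    by (rule has_derivative_compose[of "\<lambda>t. z + t *\<^sub>R h" "\<lambda>s. s *\<^sub>R h"])
       (auto intro!: derivative_eq_intros test_function_has_derivative[OF assms])
  from mvt_simple[OF zero_less_one this]
  obtain t where t: "0 < t" "t < 1" "\<phi> (z + h) - \<phi> z = frechet_derivative \<phi> (at (z + t *\<^sub>R h)) h"
    by auto
  moreover have "\<phi> differentiable at (z + t *\<^sub>R h)"
    using test_function_has_derivative[OF assms] by (auto simp: differentiable_def)
  ultimately have "\<phi> (z + h) - \<phi> z = (\<Sum>j\<in>UNIV. h $ j * partial_deriv j \<phi> (z + t *\<^sub>R h))"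
    by (simp add: frechet_derivative_eq_sum_partial_deriv)
  then show ?thesis using that t by blast
qed

lemma test_function_lipschitz:
  fixes \<phi> :: "real^'n \<Rightarrow> real"
  assumes "test_function D \<phi>"
  obtains C where "C \<ge> 0" "\<And>z h. \<bar>\<phi> (z + h) - \<phi> z\<bar> \<le> C * norm h"
proof -
  have "\<exists>B. \<forall>x. \<bar>partial_deriv j \<phi> x\<bar> \<le> B" for j
    using test_function_bounded[OF test_function_partial_deriv[OF assms, of j]] by (metis real_norm_def)
  then obtain B where B: "\<And>j x. \<bar>partial_deriv j \<phi> x\<bar> \<le> B j" by metis
  have B0: "B j \<ge> 0" for j using B[of j 0] by simp
  show ?thesis
  proof (rule that[of "\<Sum>j\<in>UNIV. B j"])
    show "sum B UNIV \<ge> 0" using B0 by (simp add: sum_nonneg)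
    fix z h
    obtain t where t: "\<phi> (z + h) - \<phi> z = (\<Sum>j\<in>UNIV. h $ j * partial_deriv j \<phi> (z + t *\<^sub>R h))"
      using test_function_mvt[OF assms] by metis
    have "\<bar>\<phi> (z + h) - \<phi> z\<bar> \<le> (\<Sum>j\<in>UNIV. \<bar>h $ j * partial_deriv j \<phi> (z + t *\<^sub>R h)\<bar>)"
      unfolding t by (rule sum_abs)
    also have "\<dots> \<le> (\<Sum>j\<in>UNIV. norm h * B j)"
      unfolding abs_mult by (intro sum_mono mult_mono component_le_norm_cart B) auto
    finally show "\<bar>\<phi> (z + h) - \<phi> z\<bar> \<le> sum B UNIV * norm h"
      by (simp add: sum_distrib_left mult.commute)
  qed
qed

text \<open>The remainder estimate is uniform in the base point; this is what allows to differentiate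
  under the integral that defines a mollification.\<close>

lemma test_function_taylor:
  fixes \<phi> :: "real^'n \<Rightarrow> real"
  assumes "test_function D \<phi>"
  obtains C where "C \<ge> 0"
    "\<And>z h. \<bar>\<phi> (z + h) - \<phi> z - frechet_derivative \<phi> (at z) h\<bar> \<le> C * (norm h)\<^sup>2"
proof -
  have "\<exists>C. C \<ge> 0 \<and> (\<forall>z h. \<bar>partial_deriv j \<phi> (z + h) - partial_deriv j \<phi> z\<bar> \<le> C * norm h)" for j
    using test_function_lipschitz[OF test_function_partial_deriv[OF assms, of j]] by metis
  then obtain C where C0: "\<And>j. C j \<ge> 0"
    and C: "\<And>j z h. \<bar>partial_deriv j \<phi> (z + h) - partial_deriv j \<phi> z\<bar> \<le> C j * norm h" by metis
  show ?thesis
  proof (rule that[of "\<Sum>j\<in>UNIV. C j"])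
    show "sum C UNIV \<ge> 0" using C0 by (simp add: sum_nonneg)
    fix z h
    obtain t where t: "0 < t" "t < 1"
      "\<phi> (z + h) - \<phi> z = (\<Sum>j\<in>UNIV. h $ j * partial_deriv j \<phi> (z + t *\<^sub>R h))"
      using test_function_mvt[OF assms] by metis
    have "\<phi> differentiable at z"
      using test_function_has_derivative[OF assms] by (auto simp: differentiable_def)
    then have "\<phi> (z + h) - \<phi> z - frechet_derivative \<phi> (at z) h =
        (\<Sum>j\<in>UNIV. h $ j * (partial_deriv j \<phi> (z + t *\<^sub>R h) - partial_deriv j \<phi> z))"
      by (simp add: t(3) frechet_derivative_eq_sum_partial_deriv sum_subtractf right_diff_distrib)
    also have "\<bar>\<dots>\<bar> \<le> (\<Sum>j\<in>UNIV. \<bar>h $ j * (partial_deriv j \<phi> (z + t *\<^sub>R h) - partial_deriv j \<phi> z)\<bar>)"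
      by (rule sum_abs)
    also have "\<dots> \<le> (\<Sum>j\<in>UNIV. norm h * (C j * norm h))"
      unfolding abs_mult
    proof (intro sum_mono mult_mono component_le_norm_cart)
      fix j
      have "\<bar>partial_deriv j \<phi> (z + t *\<^sub>R h) - partial_deriv j \<phi> z\<bar> \<le> C j * norm (t *\<^sub>R h)" by (rule C)
      also have "\<dots> \<le> C j * norm h"
        using t C0[of j] by (intro mult_left_mono) (auto simp: mult_left_le_one_le)
      finally show "\<bar>partial_deriv j \<phi> (z + t *\<^sub>R h) - partial_deriv j \<phi> z\<bar> \<le> C j * norm h" .
    qed auto
    finally show "\<bar>\<phi> (z + h) - \<phi> z - frechet_derivative \<phi> (at z) h\<bar> \<le> sum C UNIV * (norm h)\<^sup>2"
      by (simp add: sum_distrib_left sum_distrib_right power2_eq_square algebra_simps)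
  qed
qed

lemma mollify_integrable:
  fixes f :: "real^'n \<Rightarrow> 'b::euclidean_space"
  assumes "test_function D \<rho>" "integrable lborel f"
  shows "integrable lborel (\<lambda>y. \<rho> (x - y) *\<^sub>R f y)"
proof -
  obtain B where B: "B \<ge> 0" "\<And>x. norm (\<rho> x) \<le> B"
    using test_function_bounded[OF assms(1)] by blast
  have [measurable]: "\<rho> \<in> borel_measurable borel" "f \<in> borel_measurable borel"
    using assms by (auto intro: test_function_measurable)
  show ?thesis
  proof (rule Bochner_Integration.integrable_bound)
    show "integrable lborel (\<lambda>y. B * norm (f y))" using assms(2) by simp
    show "AE y in lborel. norm (\<rho> (x - y) *\<^sub>R f y) \<le> norm (B * norm (f y))"
      using B by (intro AE_I2) (auto intro!: mult_right_mono)
  qed measurable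
qed

lemma mollify_has_derivative:
  fixes f :: "real^'n \<Rightarrow> 'b::euclidean_space"
  assumes \<rho>: "test_function D \<rho>" and f: "integrable lborel f"
  shows "(mollify \<rho> f has_derivative (\<lambda>h. mollify (\<lambda>z. frechet_derivative \<rho> (at z) h) f x)) (at x)"
proof -
  let ?L = "\<lambda>h. mollify (\<lambda>z. frechet_derivative \<rho> (at z) h) f x"
  have diff: "\<rho> differentiable at z" for z
    using test_function_has_derivative[OF \<rho>] by (auto simp: differentiable_def)
  note lin = linear_frechet_derivative[OF diff]
  note int = mollify_integrable[OF \<rho> f] mollify_integrable[OF test_function_derivative[OF \<rho>] f]
  have linL: "linear ?L"
  proof (rule linearI)
    show "?L (a + b) = ?L a + ?L b" for a b
      unfolding mollify_def linear_add[OF lin] scaleR_add_left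
      by (rule Bochner_Integration.integral_add) (rule int)+
    show "?L (c *\<^sub>R a) = c *\<^sub>R ?L a" for a c
      unfolding mollify_def linear_scale[OF lin] real_scaleR_def scaleR_scaleR[symmetric]
      by (rule integral_scaleR_right)
  qed
  then have bl: "bounded_linear ?L" by (simp add: linear_conv_bounded_linear)
  obtain C where C: "C \<ge> 0"
    "\<And>z h. \<bar>\<rho> (z + h) - \<rho> z - frechet_derivative \<rho> (at z) h\<bar> \<le> C * (norm h)\<^sup>2"
    using test_function_taylor[OF \<rho>] by blast
  let ?I = "\<integral>y. norm (f y) \<partial>lborel"
  have est: "norm (mollify \<rho> f y - mollify \<rho> f x - ?L (y - x)) \<le> C * (norm (y - x))\<^sup>2 * ?I" for y
  proof -
    have "mollify \<rho> f y - mollify \<rho> f x - ?L (y - x) =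
        (\<integral>z. (\<rho> (y - z) - \<rho> (x - z) - frechet_derivative \<rho> (at (x - z)) (y - x)) *\<^sub>R f z \<partial>lborel)"
      unfolding mollify_def scaleR_diff_left
      by (simp add: int Bochner_Integration.integral_diff Bochner_Integration.integrable_diff)
    also have "norm \<dots> \<le> (\<integral>z. C * (norm (y - x))\<^sup>2 * norm (f z) \<partial>lborel)"
    proof (rule order_trans[OF integral_norm_bound integral_mono[OF integrable_norm]])
      show "integrable lborel (\<lambda>z. (\<rho> (y - z) - \<rho> (x - z) - frechet_derivative \<rho> (at (x - z)) (y - x)) *\<^sub>R f z)"
        unfolding scaleR_diff_left by (intro Bochner_Integration.integrable_diff int)
      show "integrable lborel (\<lambda>z. C * (norm (y - x))\<^sup>2 * norm (f z))" using f by simp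
      fix z
      show "norm ((\<rho> (y - z) - \<rho> (x - z) - frechet_derivative \<rho> (at (x - z)) (y - x)) *\<^sub>R f z)
          \<le> C * (norm (y - x))\<^sup>2 * norm (f z)"
        using C(2)[of "x - z" "y - x"] by (simp add: mult_right_mono)
    qed
    also have "\<dots> = C * (norm (y - x))\<^sup>2 * ?I" by simp
    finally show ?thesis .
  qed
  show ?thesis
  proof (rule has_derivativeI_sandwich[OF zero_less_one bl])
    show "norm (mollify \<rho> f y - mollify \<rho> f x - ?L (y - x)) / norm (y - x) \<le> C * ?I * norm (y - x)"
      if "y \<noteq> x" for y
      using est[of y] that by (simp add: divide_le_eq power2_eq_square mult_ac)
    have "((\<lambda>y. C * ?I * norm (y - x)) \<longlongrightarrow> C * ?I * norm (x - x)) (at x)"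
      by (intro tendsto_intros)
    then show "((\<lambda>y. C * ?I * norm (y - x)) \<longlongrightarrow> 0) (at x)" by simp
  qed
qed

lemma Ck_on_mollify:
  fixes f :: "real^'n \<Rightarrow> 'b::euclidean_space"
  assumes f: "integrable lborel f"
  shows "test_function D \<rho> \<Longrightarrow> Ck_on k UNIV (mollify \<rho> f)"
proof (induction k arbitrary: \<rho>)
  case 0
  then show ?case
    using has_derivative_continuous[OF mollify_has_derivative[OF 0 f]]
    by (auto intro!: continuous_at_imp_continuous_on)
next
  case (Suc k)
  note d = mollify_has_derivative[OF Suc.prems f]
  have "mollify \<rho> f differentiable at x" for x
    using d unfolding differentiable_def by blast
  moreover have "Ck_on k UNIV (mollify (\<lambda>z. frechet_derivative \<rho> (at z) v) f)" for v
    by (intro Suc.IH test_function_derivative Suc.prems)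
  ultimately show ?case
    by (simp only: Ck_on.simps frechet_derivative_eqI[OF d]) simp
qed

lemma frechet_derivative_mollify:
  fixes f :: "real^'n \<Rightarrow> 'b::euclidean_space"
  assumes "test_function D \<rho>" "integrable lborel f"
  shows "frechet_derivative (mollify \<rho> f) (at x) v = mollify (\<lambda>z. frechet_derivative \<rho> (at z) v) f x"
  by (rule frechet_derivative_eqI[OF mollify_has_derivative[OF assms]])

lemma mollify_eq_0:
  assumes "test_function (ball 0 \<epsilon>) \<rho>" "\<And>y. y \<in> ball x \<epsilon> \<Longrightarrow> f y = 0"
  shows "mollify \<rho> f x = 0"
proof -
  have "\<rho> (x - y) *\<^sub>R f y = 0" for y
  proof (cases "y \<in> ball x \<epsilon>")
    case False
    then have "x - y \<notin> ball 0 \<epsilon>" by (simp add: dist_norm norm_minus_commute)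
    then have "\<rho> (x - y) = 0" using assms(1) unfolding test_function_def by blast
    then show ?thesis by simp
  qed (simp add: assms)
  then have "(\<lambda>y. \<rho> (x - y) *\<^sub>R f y) = (\<lambda>_. 0)" by (intro ext)
  then show ?thesis unfolding mollify_def by simp
qed

lemma test_function_mollify:
  fixes f :: "real^'n \<Rightarrow> 'b::euclidean_space"
  assumes \<rho>: "test_function (ball 0 \<epsilon>) \<rho>" and f: "integrable lborel f"
    and K: "compact K" "\<And>x. x \<notin> K \<Longrightarrow> f x = 0" and D: "\<And>x y. x \<in> K \<Longrightarrow> norm y \<le> \<epsilon> \<Longrightarrow> x + y \<in> D"
  shows "test_function D (mollify \<rho> f)"
  unfolding test_function_def
proof (intro conjI allI exI[of _ "{x + y | x y. x \<in> K \<and> y \<in> cball 0 \<epsilon>}"] impI)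
  show "Ck_on k UNIV (mollify \<rho> f)" for k by (rule Ck_on_mollify[OF f \<rho>])
  show "compact {x + y | x y. x \<in> K \<and> y \<in> cball 0 \<epsilon>}"
    using K by (intro compact_sums) auto
  show "{x + y | x y. x \<in> K \<and> y \<in> cball 0 \<epsilon>} \<subseteq> D" using D by auto
  fix x assume x: "x \<notin> {x + y | x y. x \<in> K \<and> y \<in> cball 0 \<epsilon>}"
  show "mollify \<rho> f x = 0"
  proof (rule mollify_eq_0[OF \<rho>])
    fix y assume "y \<in> ball x \<epsilon>"
    then have "x - y \<in> cball 0 \<epsilon>" by (simp add: dist_norm norm_minus_commute)
    moreover have "x = y + (x - y)" by simp
    ultimately have "y \<notin> K" using x by blast
    then show "f y = 0" by (rule K(2))
  qed
qed

subsection \<open>Convergence of mollifications\<close>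

text \<open>A mollification is an average of translates by vectors of length less than \<^term>\<open>\<epsilon>\<close>, so its
  distance to the function is at most that of the worst translate.\<close>

lemma mollify_L1_le:
  fixes f :: "real^'n \<Rightarrow> 'b::euclidean_space"
  assumes \<rho>: "test_function (ball 0 \<epsilon>) \<rho>" "\<And>x. \<rho> x \<ge> 0" "integral\<^sup>L lborel \<rho> = 1"
    and f: "integrable lborel f"
    and small: "\<And>h. norm h < \<epsilon> \<Longrightarrow> (\<integral>\<^sup>+x. norm (f (x - h) - f x) \<partial>lborel) \<le> e"
  shows "(\<integral>\<^sup>+x. norm (mollify \<rho> f x - f x) \<partial>lborel) \<le> e"
proof -
  have [measurable]: "\<rho> \<in> borel_measurable borel" "f \<in> borel_measurable borel"
    using \<rho> f by (auto intro: test_function_measurable)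
  have \<rho>int: "integrable lborel \<rho>" by (rule test_function_integrable[OF \<rho>(1)])
  have eq: "mollify \<rho> f x - f x = (\<integral>h. \<rho> h *\<^sub>R (f (x - h) - f x) \<partial>lborel)"
    and int: "integrable lborel (\<lambda>h. \<rho> h *\<^sub>R (f (x - h) - f x))" for x
  proof -
    have i1: "integrable lborel (\<lambda>h. \<rho> h *\<^sub>R f (x - h))"
      using integrable_reflect[OF mollify_integrable[OF \<rho>(1) f, of x], of x] by simp
    have i2: "integrable lborel (\<lambda>h. \<rho> h *\<^sub>R f x)" using \<rho>int by simp
    have "mollify \<rho> f x = (\<integral>h. \<rho> h *\<^sub>R f (x - h) \<partial>lborel)"
      unfolding mollify_def
      using integral_reflect[of "\<lambda>h. \<rho> (x - h) *\<^sub>R f h" x] by simp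
    moreover have "f x = (\<integral>h. \<rho> h *\<^sub>R f x \<partial>lborel)" using \<rho>int \<rho>(3) by simp
    ultimately show "mollify \<rho> f x - f x = (\<integral>h. \<rho> h *\<^sub>R (f (x - h) - f x) \<partial>lborel)"
      using Bochner_Integration.integral_diff[OF i1 i2] by (simp add: scaleR_diff_right)
    show "integrable lborel (\<lambda>h. \<rho> h *\<^sub>R (f (x - h) - f x))"
      using Bochner_Integration.integrable_diff[OF i1 i2] by (simp add: scaleR_diff_right)
  qed
  have "(\<integral>\<^sup>+x. norm (mollify \<rho> f x - f x) \<partial>lborel)
      \<le> (\<integral>\<^sup>+x. \<integral>\<^sup>+h. ennreal (\<rho> h) * norm (f (x - h) - f x) \<partial>lborel \<partial>lborel)"
  proof (rule nn_integral_mono)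
    fix x
    have "ennreal (norm (mollify \<rho> f x - f x)) \<le> (\<integral>\<^sup>+h. norm (\<rho> h *\<^sub>R (f (x - h) - f x)) \<partial>lborel)"
      unfolding eq by (rule integral_norm_bound_ennreal[OF int])
    then show "ennreal (norm (mollify \<rho> f x - f x)) \<le> (\<integral>\<^sup>+h. ennreal (\<rho> h) * norm (f (x - h) - f x) \<partial>lborel)"
      using \<rho>(2) by (simp add: ennreal_mult)
  qed
  also have "\<dots> = (\<integral>\<^sup>+h. \<integral>\<^sup>+x. ennreal (\<rho> h) * norm (f (x - h) - f x) \<partial>lborel \<partial>lborel)"
    by (rule lborel_pair.Fubini') measurable
  also have "\<dots> \<le> (\<integral>\<^sup>+h. ennreal (\<rho> h) * e \<partial>lborel)"
  proof (rule nn_integral_mono)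
    fix h :: "real^'n"
    have "(\<integral>\<^sup>+x. ennreal (\<rho> h) * norm (f (x - h) - f x) \<partial>lborel) =
        ennreal (\<rho> h) * (\<integral>\<^sup>+x. norm (f (x - h) - f x) \<partial>lborel)"
      by (rule nn_integral_cmult) measurable
    also have "\<dots> \<le> ennreal (\<rho> h) * e"
    proof (cases "norm h < \<epsilon>")
      case False
      then have "\<rho> h = 0" using \<rho>(1) unfolding test_function_def by (metis mem_ball_0 subsetD)
      then show ?thesis by simp
    qed (intro mult_left_mono small, auto)
    finally show "(\<integral>\<^sup>+x. ennreal (\<rho> h) * norm (f (x - h) - f x) \<partial>lborel) \<le> ennreal (\<rho> h) * e" .
  qed
  also have "\<dots> = (\<integral>\<^sup>+h. ennreal (\<rho> h) \<partial>lborel) * e"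
    by (rule nn_integral_multc) measurable
  also have "(\<integral>\<^sup>+h. ennreal (\<rho> h) \<partial>lborel) = 1"
    using nn_integral_eq_integral[OF \<rho>int] \<rho> by simp
  finally show ?thesis by simp
qed

text \<open>A single kernel that approximates two functions at once is what is needed to approximate a
  Sobolev function together with its gradient.\<close>

lemma mollifier_exists:
  fixes f :: "real^'n \<Rightarrow> 'b::euclidean_space" and g :: "real^'n \<Rightarrow> 'c::euclidean_space"
  assumes "integrable lborel f" "integrable lborel g" "e > 0" "r > 0"
  obtains \<rho> :: "real^'n \<Rightarrow> real" where "test_function (ball 0 r) \<rho>" "\<And>x. \<rho> x \<ge> 0" "integral\<^sup>L lborel \<rho> = 1"
    "(\<integral>\<^sup>+x. norm (mollify \<rho> f x - f x) \<partial>lborel) \<le> ennreal e"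
    "(\<integral>\<^sup>+x. norm (mollify \<rho> g x - g x) \<partial>lborel) \<le> ennreal e"
proof -
  obtain d1 where d1: "d1 > 0" "\<And>h. norm h < d1 \<Longrightarrow> (\<integral>\<^sup>+x. norm (f (x - h) - f x) \<partial>lborel) \<le> ennreal e"
    using translation_L1_small[OF assms(1,3)] by blast
  obtain d2 where d2: "d2 > 0" "\<And>h. norm h < d2 \<Longrightarrow> (\<integral>\<^sup>+x. norm (g (x - h) - g x) \<partial>lborel) \<le> ennreal e"
    using translation_L1_small[OF assms(2,3)] by blast
  define \<epsilon> where "\<epsilon> = min r (min d1 d2)"
  have "\<epsilon> > 0" using assms d1 d2 by (simp add: \<epsilon>_def)
  then obtain \<rho> :: "real^'n \<Rightarrow> real" where \<rho>: "test_function (ball 0 \<epsilon>) \<rho>" "\<And>x. \<rho> x \<ge> 0" "integral\<^sup>L lborel \<rho> = 1"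
    using bump_exists by blast
  show ?thesis
  proof
    show "test_function (ball 0 r) \<rho>" by (rule test_function_mono[OF \<rho>(1)]) (auto simp: \<epsilon>_def)
    show "(\<integral>\<^sup>+x. norm (mollify \<rho> f x - f x) \<partial>lborel) \<le> ennreal e"
      by (rule mollify_L1_le[OF \<rho> assms(1) d1(2)]) (simp add: \<epsilon>_def)
    show "(\<integral>\<^sup>+x. norm (mollify \<rho> g x - g x) \<partial>lborel) \<le> ennreal e"
      by (rule mollify_L1_le[OF \<rho> assms(2) d2(2)]) (simp add: \<epsilon>_def)
  qed (use \<rho> in auto)
qed

section \<open>Weak gradients\<close>

subsection \<open>Borel representatives\<close>

text \<open>Mollification integrates $(x, y) \mapsto f(x - y)$ in both variables. For this to be measurable in the
  product, $f$ should be Borel; the functions of the problem are only Lebesgue measurable.\<close>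

lemma ex_borel_representative:
  fixes f :: "'a::euclidean_space \<Rightarrow> 'b::euclidean_space"
  assumes "f \<in> borel_measurable lebesgue"
  obtains g where "g \<in> borel_measurable borel" "AE x in lborel. f x = g x"
proof -
  have "\<exists>g\<in>borel_measurable lborel. AE x in lborel. f x \<bullet> b = g x" for b
    by (rule completion_ex_borel_measurable_real) (use assms in measurable)
  then obtain g where g: "\<And>b. g b \<in> borel_measurable lborel" "\<And>b. AE x in lborel. f x \<bullet> b = g b x"
    by metis
  show ?thesis
  proof
    show "(\<lambda>x. \<Sum>b\<in>Basis. g b x *\<^sub>R b) \<in> borel_measurable borel"
      using g(1) by (auto intro!: borel_measurable_sum borel_measurable_scaleR)
    have "AE x in lborel. \<forall>b\<in>Basis. f x \<bullet> b = g b x"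
      using g(2) by (intro AE_finite_allI) auto
    then show "AE x in lborel. f x = (\<Sum>b\<in>Basis. g b x *\<^sub>R b)"
    proof eventually_elim
      case (elim x)
      have "f x = (\<Sum>b\<in>Basis. (f x \<bullet> b) *\<^sub>R b)" by (simp add: euclidean_representation)
      also have "\<dots> = (\<Sum>b\<in>Basis. g b x *\<^sub>R b)" using elim by (intro sum.cong) auto
      finally show ?case .
    qed
  qed
qed

lemma AE_lebesgue_on_iff:
  fixes D :: "'a::euclidean_space set"
  assumes "open D"
  shows "(AE x in lebesgue_on D. P x) \<longleftrightarrow> (AE x in lborel. x \<in> D \<longrightarrow> P x)"
  using assms by (simp add: AE_restrict_space_iff AE_completion_iff)

lemma LINT_lebesgue_on_eq_lborel:
  fixes f :: "'a::euclidean_space \<Rightarrow> 'b::euclidean_space"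
  assumes "open D" "g \<in> borel_measurable borel" "\<And>x. x \<notin> D \<Longrightarrow> g x = 0"
    and "f \<in> borel_measurable (lebesgue_on D)" "AE x in lborel. x \<in> D \<longrightarrow> f x = g x"
  shows "(LINT x|lebesgue_on D. f x) = (\<integral>x. g x \<partial>lborel)"
proof -
  have D: "D \<inter> space lebesgue \<in> sets lebesgue" using assms(1) by simp
  have "(LINT x|lebesgue_on D. f x) = (\<integral>x. indicator D x *\<^sub>R f x \<partial>lebesgue)"
    by (rule integral_restrict_space[OF D])
  also have "\<dots> = (\<integral>x. g x \<partial>lebesgue)"
  proof (rule integral_cong_AE)
    show "(\<lambda>x. indicator D x *\<^sub>R f x) \<in> borel_measurable lebesgue"
      using assms(4) borel_measurable_restrict_space_iff[OF D] by blast
    show "AE x in lebesgue. indicator D x *\<^sub>R f x = g x"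
      unfolding AE_completion_iff using assms(5)
      by eventually_elim (use assms(3) in \<open>auto simp: indicator_def\<close>)
  qed (use assms(2) in \<open>auto intro: measurable_completion\<close>)
  also have "\<dots> = (\<integral>x. g x \<partial>lborel)" using assms(2) by (intro integral_completion) simp
  finally show ?thesis .
qed

lemma borel_imp_lebesgue_on: "f \<in> borel_measurable borel \<Longrightarrow> f \<in> borel_measurable (lebesgue_on D)"
  by (intro measurable_restrict_space1 measurable_completion) simp

subsection \<open>Uniqueness\<close>

text \<open>The fundamental lemma of the calculus of variations: locally, the mollifications of
  \<^term>\<open>\<psi>\<close> vanish and converge to \<^term>\<open>\<psi>\<close> in the mean.\<close>

lemma fundamental_lemma:
  fixes \<psi> :: "real^'n \<Rightarrow> real"
  assumes D: "open D" and li: "locally_integrable D \<psi>"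
    and z: "\<And>\<phi>. test_function D \<phi> \<Longrightarrow> (LINT x|lebesgue_on D. \<psi> x * \<phi> x) = 0"
  shows "AE x in lebesgue_on D. \<psi> x = 0"
proof -
  let ?S = "{x \<in> D. \<psi> x \<noteq> 0}"
  have loc: "negligible (?S \<inter> ball x r)" if r: "r > 0" "cball x (2*r) \<subseteq> D" for x r
  proof -
    let ?K = "cball x (2*r)"
    define f0 where "f0 = (\<lambda>y. indicator ?K y *\<^sub>R \<psi> y)"
    have "integrable (lebesgue_on ?K) \<psi>"
      using li r unfolding locally_integrable_def by auto
    then have f0: "integrable lebesgue f0"
      unfolding f0_def by (subst (asm) integrable_restrict_space) auto
    obtain f where f[measurable]: "f \<in> borel_measurable borel" and ff: "AE y in lborel. f0 y = f y"
      using ex_borel_representative[OF borel_measurable_integrable[OF f0]] by blast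
    have ff': "AE y in lebesgue. f0 y = f y" using ff by (simp add: AE_completion_iff)
    have "integrable lebesgue f"
      by (rule integrable_cong_AE_imp[OF f0 _ ff']) (simp add: measurable_completion)
    then have fint: "integrable lborel f" by (simp add: integrable_completion)
    have le: "(\<integral>\<^sup>+y. ennreal \<bar>f y\<bar> * indicator (ball x r) y \<partial>lborel) \<le> ennreal e" if e: "e > 0" for e :: real
    proof -
      obtain \<rho> :: "real^'n \<Rightarrow> real" where \<rho>: "test_function (ball 0 r) \<rho>"
        "(\<integral>\<^sup>+x. norm (mollify \<rho> f x - f x) \<partial>lborel) \<le> ennreal e"
        using mollifier_exists[OF fint fint e r(1)] by metis
      have mz: "mollify \<rho> f w = 0" if w: "w \<in> ball x r" for w
      proof -
        let ?\<phi> = "\<lambda>y. \<rho> (w - y)"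
        have "ball w r \<subseteq> ?K"
        proof
          fix y assume "y \<in> ball w r"
          then show "y \<in> ?K" using w dist_triangle[of x y w] by simp
        qed
        then have tf: "test_function ?K ?\<phi>"
          by (rule test_function_mono[OF test_function_reflect[OF \<rho>(1)]])
        then have zero: "y \<notin> ?K \<Longrightarrow> ?\<phi> y = 0" for y
          unfolding test_function_def by blast
        have [measurable]: "?\<phi> \<in> borel_measurable borel" by (rule test_function_measurable[OF tf])
        have "mollify \<rho> f w = (\<integral>y. ?\<phi> y * f y \<partial>lborel)" by (simp add: mollify_def)
        also have "\<dots> = (\<integral>y. ?\<phi> y * f y \<partial>lebesgue)"
          by (rule integral_completion[symmetric]) simp
        also have "\<dots> = (\<integral>y. ?\<phi> y * f0 y \<partial>lebesgue)"
        proof (rule integral_cong_AE)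
          show "(\<lambda>y. ?\<phi> y * f y) \<in> borel_measurable lebesgue"
            by (rule measurable_completion) simp
          show "(\<lambda>y. ?\<phi> y * f0 y) \<in> borel_measurable lebesgue"
            by (intro borel_measurable_times measurable_completion borel_measurable_integrable[OF f0]) simp
          show "AE y in lebesgue. ?\<phi> y * f y = ?\<phi> y * f0 y" using ff' by eventually_elim auto
        qed
        also have "\<dots> = (\<integral>y. indicator D y *\<^sub>R (\<psi> y * ?\<phi> y) \<partial>lebesgue)"
          using r(2) zero by (intro Bochner_Integration.integral_cong) (auto simp: f0_def indicator_def)
        also have "\<dots> = (LINT y|lebesgue_on D. \<psi> y * ?\<phi> y)"
          using D by (intro integral_restrict_space[symmetric]) auto
        also have "\<dots> = 0" by (rule z[OF test_function_mono[OF tf r(2)]])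
        finally show ?thesis .
      qed
      have "(\<integral>\<^sup>+y. ennreal \<bar>f y\<bar> * indicator (ball x r) y \<partial>lborel) \<le> (\<integral>\<^sup>+y. norm (mollify \<rho> f y - f y) \<partial>lborel)"
        using mz by (intro nn_integral_mono) (auto simp: indicator_def)
      with \<rho>(2) show ?thesis by (rule order_trans[rotated])
    qed
    have "(\<integral>\<^sup>+y. ennreal \<bar>f y\<bar> * indicator (ball x r) y \<partial>lborel) = 0"
    proof (rule antisym[OF ennreal_le_epsilon])
      show "(\<integral>\<^sup>+y. ennreal \<bar>f y\<bar> * indicator (ball x r) y \<partial>lborel) \<le> 0 + ennreal e" if "0 < e" for e :: real
        using le[OF that] by simp
    qed simp
    then have "AE y in lborel. ennreal \<bar>f y\<bar> * indicator (ball x r) y = 0"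
    proof (subst (asm) nn_integral_0_iff_AE)
      have [measurable]: "ball x r \<in> sets borel" by simp
      show "(\<lambda>y. ennreal \<bar>f y\<bar> * indicator (ball x r) y) \<in> borel_measurable lborel"
        by measurable
    qed
    then have "AE y in lborel. y \<notin> ?S \<inter> ball x r"
      using ff
    proof eventually_elim
      case (elim y)
      then show ?case using r by (auto simp: f0_def indicator_def split: if_splits)
    qed
    then obtain N where "N \<in> null_sets lborel" "{y \<in> space lborel. \<not> y \<notin> ?S \<inter> ball x r} \<subseteq> N"
      unfolding eventually_ae_filter by blast
    then have "N \<in> null_sets lborel" "?S \<inter> ball x r \<subseteq> N" by auto
    then show ?thesis
      unfolding negligible_iff_null_sets null_sets_completion_iff2 by blast
  qed
  have "negligible ?S"
  proof (subst locally_negligible_alt, intro ballI)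
    fix x assume "x \<in> ?S"
    then obtain e where e: "e > 0" "cball x e \<subseteq> D" using D open_contains_cball by blast
    have "negligible (?S \<inter> ball x (e/2))" using e by (intro loc) auto
    then show "\<exists>U. openin (top_of_set ?S) U \<and> x \<in> U \<and> negligible U"
      using \<open>x \<in> ?S\<close> e by (intro exI[of _ "?S \<inter> ball x (e/2)"]) (auto simp: openin_open_Int)
  qed
  then have "AE x in lebesgue. x \<notin> ?S"
    unfolding negligible_iff_null_sets by (rule AE_not_in)
  then show ?thesis using D by (subst AE_restrict_space_iff) auto
qed

lemma locally_integrable_bounded_linear:
  "bounded_linear T \<Longrightarrow> locally_integrable D f \<Longrightarrow> locally_integrable D (\<lambda>x. T (f x))"
  unfolding locally_integrable_def by (auto intro: integrable_bounded_linear)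

lemma bounded_linear_entry: "bounded_linear (\<lambda>A::real^'n^'m. A $ i $ j)"
  by (rule bounded_linear_compose[OF bounded_linear_vec_nth bounded_linear_vec_nth])

lemma integrable_times_test_function:
  fixes f :: "real^'n \<Rightarrow> real"
  assumes D: "open D" and f: "locally_integrable D f" and \<phi>: "test_function D \<phi>"
  shows "integrable (lebesgue_on D) (\<lambda>x. f x * \<phi> x)"
proof -
  obtain K where K: "compact K" "K \<subseteq> D" "\<And>x. x \<notin> K \<Longrightarrow> \<phi> x = 0"
    using \<phi> unfolding test_function_def by blast
  obtain B where B: "\<And>x. norm (\<phi> x) \<le> B" using test_function_bounded[OF \<phi>] by blast
  have Ks: "K \<inter> space lebesgue \<in> sets lebesgue" using K by (simp add: compact_imp_closed)
  have "integrable (lebesgue_on K) f" using f K unfolding locally_integrable_def by blast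
  then have fK: "integrable lebesgue (\<lambda>x. indicator K x * f x)"
    using integrable_restrict_space[OF Ks, of f] by simp
  have "integrable lebesgue (\<lambda>x. indicator K x * f x * \<phi> x)"
  proof (rule Bochner_Integration.integrable_bound)
    show "integrable lebesgue (\<lambda>x. B * (indicator K x * f x))" using fK by simp
    show "(\<lambda>x. indicator K x * f x * \<phi> x) \<in> borel_measurable lebesgue"
      using \<phi> by (intro borel_measurable_times[OF borel_measurable_integrable[OF fK]] measurable_completion)
        (simp add: test_function_measurable)
    show "AE x in lebesgue. norm (indicator K x * f x * \<phi> x) \<le> norm (B * (indicator K x * f x))"
    proof (intro AE_I2)
      fix x
      show "norm (indicator K x * f x * \<phi> x) \<le> norm (B * (indicator K x * f x))"
        using mult_right_mono[OF order_trans[OF B[of x] abs_ge_self], of "\<bar>indicator K x * f x\<bar>"]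
        by (simp add: abs_mult mult_ac)
    qed
  qed
  moreover have "(\<lambda>x. indicator K x * f x * \<phi> x) = (\<lambda>x. indicator D x *\<^sub>R (f x * \<phi> x))"
    using K by (auto simp: indicator_def fun_eq_iff)
  ultimately show ?thesis
    using D by (subst integrable_restrict_space) auto
qed

lemma has_weak_gradient_unique:
  fixes u :: "real^'n \<Rightarrow> real^'m"
  assumes D: "open D" and G: "has_weak_gradient D u G" and H: "has_weak_gradient D u H"
  shows "AE x in lebesgue_on D. G x = H x"
proof -
  have liG: "locally_integrable D G" and liH: "locally_integrable D H"
    using G H unfolding has_weak_gradient_def by auto
  have "AE x in lebesgue_on D. G x $ i $ j - H x $ i $ j = 0" for i j
  proof (rule fundamental_lemma[OF D])
    show "locally_integrable D (\<lambda>x. G x $ i $ j - H x $ i $ j)"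
      unfolding locally_integrable_def
    proof (intro allI impI)
      fix K assume "compact K \<and> K \<subseteq> D"
      then have "integrable (lebesgue_on K) (\<lambda>x. G x - H x)"
        using liG liH unfolding locally_integrable_def by blast
      from integrable_bounded_linear[OF bounded_linear_compose[OF bounded_linear_vec_nth[of j] bounded_linear_vec_nth[of i]] this]
      show "integrable (lebesgue_on K) (\<lambda>x. G x $ i $ j - H x $ i $ j)" by simp
    qed
    fix \<phi> :: "real^'n \<Rightarrow> real" assume \<phi>: "test_function D \<phi>"
    have "(LINT x|lebesgue_on D. (G x $ i $ j - H x $ i $ j) * \<phi> x) =
        (LINT x|lebesgue_on D. G x $ i $ j * \<phi> x) - (LINT x|lebesgue_on D. H x $ i $ j * \<phi> x)"
      unfolding left_diff_distrib
      by (intro Bochner_Integration.integral_diff integrable_times_test_function[OF D _ \<phi>]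
          locally_integrable_bounded_linear[OF bounded_linear_entry] liG liH)
    also have "\<dots> = 0"
    proof -
      have "(LINT x|lebesgue_on D. u x $ i * partial_deriv j \<phi> x) = - (LINT x|lebesgue_on D. G x $ i $ j * \<phi> x)"
        using G \<phi> unfolding has_weak_gradient_def by blast
      moreover have "(LINT x|lebesgue_on D. u x $ i * partial_deriv j \<phi> x) = - (LINT x|lebesgue_on D. H x $ i $ j * \<phi> x)"
        using H \<phi> unfolding has_weak_gradient_def by blast
      ultimately show ?thesis by simp
    qed
    finally show "(LINT x|lebesgue_on D. (G x $ i $ j - H x $ i $ j) * \<phi> x) = 0" .
  qed
  then have "AE x in lebesgue_on D. \<forall>i\<in>UNIV. \<forall>j\<in>UNIV. G x $ i $ j - H x $ i $ j = 0"
    by (intro AE_finite_allI) auto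
  then show ?thesis by eventually_elim (simp add: vec_eq_iff)
qed

lemma has_weak_gradient_subset:
  fixes u :: "real^'n \<Rightarrow> real^'m"
  assumes "open D" "open \<Omega>" "\<Omega> \<subseteq> D" and G: "has_weak_gradient D u G"
  shows "has_weak_gradient \<Omega> u G"
proof -
  have eq: "(LINT x|lebesgue_on \<Omega>. f x * \<phi> x) = (LINT x|lebesgue_on D. f x * \<phi> x)"
    if "test_function \<Omega> \<phi>" for f \<phi> :: "real^'n \<Rightarrow> real"
  proof -
    have "\<And>x. x \<notin> \<Omega> \<Longrightarrow> \<phi> x = 0" using that unfolding test_function_def by blast
    then have "(\<lambda>x. indicator \<Omega> x *\<^sub>R (f x * \<phi> x)) = (\<lambda>x. indicator D x *\<^sub>R (f x * \<phi> x))"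
      using assms(3) by (auto simp: indicator_def fun_eq_iff)
    then show ?thesis using assms(1,2) by (simp add: integral_restrict_space)
  qed
  have sub: "locally_integrable \<Omega> f" if "locally_integrable D f" for f :: "real^'n \<Rightarrow> 'c::euclidean_space"
    using that assms(3) unfolding locally_integrable_def by (metis subset_trans)
  have "(LINT x|lebesgue_on \<Omega>. u x $ i * partial_deriv j \<phi> x) =
      - (LINT x|lebesgue_on \<Omega>. G x $ i $ j * \<phi> x)" if "test_function \<Omega> \<phi>" for \<phi> i j
    unfolding eq[OF that] eq[OF test_function_partial_deriv[OF that]]
    using G test_function_mono[OF that assms(3)] unfolding has_weak_gradient_def by blast
  moreover have "locally_integrable \<Omega> u" "locally_integrable \<Omega> G"
    using G by (auto intro!: sub simp: has_weak_gradient_def)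
  ultimately show ?thesis
    unfolding has_weak_gradient_def by (intro conjI allI impI)
qed

lemma weak_gradient_AE:
  fixes u :: "real^'n \<Rightarrow> real^'m"
  assumes "open D" "has_weak_gradient D u G"
  shows "AE x in lebesgue_on D. weak_gradient D u x = G x"
  unfolding weak_gradient_def
  by (rule has_weak_gradient_unique[OF assms(1) someI[of "has_weak_gradient D u", OF assms(2)] assms(2)])

section \<open>Compactly supported Sobolev functions\<close>

text \<open>A bounded Borel function with compact support on the whole space together with a bounded
  Borel weak gradient. All competitors below differ from the minimizer by such a pair.\<close>

definition compact_sobolev ::
    "(real^'n) set \<Rightarrow> (real^'n \<Rightarrow> real^'m) \<Rightarrow> (real^'n \<Rightarrow> real^'n^'m) \<Rightarrow> bool" where
  "compact_sobolev K v H \<longleftrightarrow>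
     compact K \<and> v \<in> borel_measurable borel \<and> H \<in> borel_measurable borel \<and>
     (\<exists>B. \<forall>x. norm (v x) \<le> B \<and> norm (H x) \<le> B) \<and>
     (\<forall>x. x \<notin> K \<longrightarrow> v x = 0 \<and> H x = 0) \<and>
     (\<forall>\<phi>. test_function UNIV \<phi> \<longrightarrow> (\<forall>i j.
        (\<integral>x. v x $ i * partial_deriv j \<phi> x \<partial>lborel) = - (\<integral>x. H x $ i $ j * \<phi> x \<partial>lborel)))"

lemma borel_measurable_vec_component [measurable (raw)]:
  fixes f :: "'a \<Rightarrow> ('b::real_normed_vector)^'m"
  assumes "f \<in> borel_measurable M"
  shows "(\<lambda>x. f x $ i) \<in> borel_measurable M"
  by (rule measurable_compose[OF assms borel_measurable_continuous_onI]) (intro continuous_intros)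

lemma compact_sobolev_integrable:
  assumes "compact_sobolev K v H"
  shows "integrable lborel v" "integrable lborel H"
proof -
  obtain B where B: "\<And>x. norm (v x) \<le> B" "\<And>x. norm (H x) \<le> B"
    using assms unfolding compact_sobolev_def by blast
  show "integrable lborel v"
    using assms B unfolding compact_sobolev_def
    by (intro integrable_bounded_support[of v B K]) (auto intro: compact_imp_bounded)
  show "integrable lborel H"
    using assms B unfolding compact_sobolev_def
    by (intro integrable_bounded_support[of H B K]) (auto intro: compact_imp_bounded)
qed

lemma integrable_lebesgue_on_borel:
  fixes f :: "'a::euclidean_space \<Rightarrow> 'b::{banach, second_countable_topology}"
  assumes f: "integrable lborel f" and "S \<in> sets lebesgue"
  shows "integrable (lebesgue_on S) f"
proof -
  have "integrable lebesgue f" using f by (simp add: integrable_completion)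
  then have "integrable lebesgue (\<lambda>x. indicator S x *\<^sub>R f x)"
    using assms(2) by (rule integrable_mult_indicator[rotated])
  then show ?thesis using assms(2) by (subst integrable_restrict_space) auto
qed

lemma compact_sobolev_square_integrable:
  assumes "compact_sobolev K v H"
  shows "integrable lborel (\<lambda>x. (norm (v x))\<^sup>2)" "integrable lborel (\<lambda>x. (norm (H x))\<^sup>2)"
proof -
  obtain B where B: "\<And>x. norm (v x) \<le> B" "\<And>x. norm (H x) \<le> B"
    using assms unfolding compact_sobolev_def by blast
  have [measurable]: "v \<in> borel_measurable borel" "H \<in> borel_measurable borel"
    and K: "bounded K" "\<And>x. x \<notin> K \<Longrightarrow> v x = 0 \<and> H x = 0"
    using assms unfolding compact_sobolev_def by (auto intro: compact_imp_bounded)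
  show "integrable lborel (\<lambda>x. (norm (v x))\<^sup>2)"
    by (rule integrable_bounded_support[of _ "B\<^sup>2" K]) (use B K in \<open>auto intro!: power_mono\<close>)
  show "integrable lborel (\<lambda>x. (norm (H x))\<^sup>2)"
    by (rule integrable_bounded_support[of _ "B\<^sup>2" K]) (use B K in \<open>auto intro!: power_mono\<close>)
qed

lemma compact_sobolev_W12:
  assumes P: "compact_sobolev K v H" and \<Omega>: "open \<Omega>" "K \<subseteq> \<Omega>"
  shows "has_weak_gradient \<Omega> v H" "L2_on \<Omega> v" "L2_on \<Omega> H"
proof -
  have [measurable]: "v \<in> borel_measurable borel" "H \<in> borel_measurable borel"
    and z: "\<And>x. x \<notin> K \<Longrightarrow> v x = 0 \<and> H x = 0"
    using P unfolding compact_sobolev_def by auto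
  show "has_weak_gradient \<Omega> v H"
    unfolding has_weak_gradient_def
  proof (intro conjI allI impI)
    show "locally_integrable \<Omega> v" "locally_integrable \<Omega> H"
      unfolding locally_integrable_def
      using compact_sobolev_integrable[OF P]
      by (auto intro!: integrable_lebesgue_on_borel simp: compact_imp_closed)
    fix \<phi> :: "real^'a \<Rightarrow> real" and i j assume \<phi>: "test_function \<Omega> \<phi>"
    then have \<phi>': "test_function UNIV \<phi>" by (rule test_function_mono) simp
    have [measurable]: "\<phi> \<in> borel_measurable borel" "partial_deriv j \<phi> \<in> borel_measurable borel"
      using \<phi> test_function_partial_deriv[OF \<phi>] test_function_measurable by blast+
    have z\<Omega>: "v x = 0" "H x = 0" if "x \<notin> \<Omega>" for x
      using z[of x] that \<Omega>(2) by auto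
    have "(LINT x|lebesgue_on \<Omega>. v x $ i * partial_deriv j \<phi> x) = (\<integral>x. v x $ i * partial_deriv j \<phi> x \<partial>lborel)"
      using \<Omega>(1) z\<Omega> by (intro LINT_lebesgue_on_eq_lborel borel_imp_lebesgue_on) auto
    moreover have "(LINT x|lebesgue_on \<Omega>. H x $ i $ j * \<phi> x) = (\<integral>x. H x $ i $ j * \<phi> x \<partial>lborel)"
      using \<Omega>(1) z\<Omega> by (intro LINT_lebesgue_on_eq_lborel borel_imp_lebesgue_on) auto
    ultimately show "(LINT x|lebesgue_on \<Omega>. v x $ i * partial_deriv j \<phi> x) =
        - (LINT x|lebesgue_on \<Omega>. H x $ i $ j * \<phi> x)"
      using P \<phi>' unfolding compact_sobolev_def by auto
  qed
  show "L2_on \<Omega> v" "L2_on \<Omega> H"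
    unfolding L2_on_def using \<Omega> compact_sobolev_square_integrable[OF P]
    by (auto intro!: borel_imp_lebesgue_on integrable_lebesgue_on_borel)
qed

subsection \<open>Integration by parts\<close>

text \<open>The integral of a difference quotient vanishes by translation invariance, and difference quotients
  of a test function converge uniformly, with supports in a fixed ball.\<close>

lemma integral_partial_deriv_eq_0:
  fixes g :: "real^'n \<Rightarrow> real"
  assumes g: "test_function D g"
  shows "(\<integral>x. partial_deriv j g x \<partial>lborel) = 0"
proof -
  obtain K where K: "compact K" "\<And>x. x \<notin> K \<Longrightarrow> g x = 0"
    using g unfolding test_function_def by blast
  obtain r where r: "K \<subseteq> ball 0 r" using bounded_subset_ballD[OF compact_imp_bounded[OF K(1)]] by blast
  obtain C where C: "C \<ge> 0"
    "\<And>z h. \<bar>g (z + h) - g z - frechet_derivative g (at z) h\<bar> \<le> C * (norm h)\<^sup>2"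
    using test_function_taylor[OF g] by blast
  let ?B = "cball (0::real^'n) (r + 1)"
  let ?I = "\<integral>x. partial_deriv j g x \<partial>lborel"
  have [measurable]: "g \<in> borel_measurable borel" by (rule test_function_measurable[OF g])
  have ig: "integrable lborel g" by (rule test_function_integrable[OF g])
  have id: "integrable lborel (partial_deriv j g)"
    by (rule test_function_integrable[OF test_function_partial_deriv[OF g]])
  have iB: "integrable lborel (\<lambda>x. indicator ?B x :: real)"
    using emeasure_bounded_finite[OF bounded_cball, of "0::real^'n" "r + 1"]
    by (simp add: integrable_indicator_iff)
  have gd0: "partial_deriv j g x = 0" if "x \<notin> ball 0 r" for x
  proof -
    have "test_function (ball 0 r) g" using g K r unfolding test_function_def by blast
    from test_function_partial_deriv[OF this] that show ?thesis unfolding test_function_def by blast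
  qed
  have bd: "\<bar>?I\<bar> \<le> C * t * measure lborel ?B" if t: "0 < t" "t < 1" for t
  proof -
    let ?h = "t *\<^sub>R axis j 1 :: real^'n"
    have it: "integrable lborel (\<lambda>x. g (x + ?h))"
      using integrable_translate[OF ig, of "- ?h"] by simp
    have "(\<integral>x. g (x + ?h) \<partial>lborel) = (\<integral>x. g x \<partial>lborel)"
      using integral_translate[of g "- ?h"] by simp
    then have "t * ?I = - (\<integral>x. g (x + ?h) - g x - t * partial_deriv j g x \<partial>lborel)"
      using it ig id by (simp add: Bochner_Integration.integral_diff Bochner_Integration.integrable_diff)
    then have "\<bar>t * ?I\<bar> = \<bar>\<integral>x. g (x + ?h) - g x - t * partial_deriv j g x \<partial>lborel\<bar>" by simp
    also have "\<dots> \<le> (\<integral>x. C * t\<^sup>2 * indicator ?B x \<partial>lborel)"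
      unfolding real_norm_def[symmetric]
    proof (rule order_trans[OF integral_norm_bound integral_mono[OF integrable_norm]])
      show "integrable lborel (\<lambda>x. g (x + ?h) - g x - t * partial_deriv j g x)"
        using it ig id by (intro Bochner_Integration.integrable_diff) auto
      show "integrable lborel (\<lambda>x. C * t\<^sup>2 * indicator ?B x)" using iB by simp
      fix x
      show "norm (g (x + ?h) - g x - t * partial_deriv j g x) \<le> C * t\<^sup>2 * indicator ?B x"
      proof (cases "x \<in> ?B")
        case True
        have "linear (frechet_derivative g (at x))"
          using test_function_has_derivative[OF g] has_derivative_linear by blast
        then have "frechet_derivative g (at x) ?h = t * partial_deriv j g x"
          by (simp add: linear_scale partial_deriv_def)
        then show ?thesis using C(2)[of x ?h] True t by (simp add: norm_axis_1)
      next
        case False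
        have "norm ?h = t" using t by (simp add: norm_axis_1)
        then have "norm (x + ?h) > r" "norm x > r"
          using False t norm_triangle_ineq4[of "x + ?h" ?h] by auto
        then have "x + ?h \<notin> ball 0 r" "x \<notin> ball 0 r" by auto
        then have "g (x + ?h) = 0" "g x = 0" "partial_deriv j g x = 0"
          using K(2) r gd0 by blast+
        then show ?thesis using C by simp
      qed
    qed
    also have "\<dots> = C * t\<^sup>2 * measure lborel ?B" by simp
    finally have "t * \<bar>?I\<bar> \<le> t * (C * t * measure lborel ?B)"
      using t by (simp add: abs_mult power2_eq_square mult_ac)
    then show ?thesis using t by simp
  qed
  have "((\<lambda>t. C * t * measure lborel ?B) \<longlongrightarrow> C * 0 * measure lborel ?B) (at_right 0)"
    by (intro tendsto_intros)
  then have "\<bar>?I\<bar> \<le> C * 0 * measure lborel ?B"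
    by (rule tendsto_lowerbound) (auto intro!: bd exI[of _ 1] simp: eventually_at_right_field)
  then show ?thesis by simp
qed

lemma Ck_on_component:
  fixes f :: "'a::real_normed_vector \<Rightarrow> real^'m"
  shows "Ck_on k UNIV f \<Longrightarrow> Ck_on k UNIV (\<lambda>x. f x $ i)"
proof (induction k arbitrary: f)
  case 0
  then show ?case by (auto intro: continuous_on_component)
next
  case (Suc k)
  have d: "((\<lambda>x. f x $ i) has_derivative (\<lambda>v. frechet_derivative f (at x) v $ i)) (at x)" for x
    using Suc.prems
    by (intro bounded_linear.has_derivative[OF bounded_linear_vec_nth]) (simp add: frechet_derivative_works[symmetric])
  then have "(\<lambda>x. f x $ i) differentiable at x" for x
    unfolding differentiable_def by blast
  moreover have "Ck_on k UNIV (\<lambda>x. frechet_derivative f (at x) v $ i)" for v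
    by (rule Suc.IH) (use Suc.prems in simp)
  ultimately show ?case
    by (simp only: Ck_on.simps frechet_derivative_eqI[OF d]) simp
qed

lemma integral_by_parts_test_function:
  fixes f \<phi> :: "real^'n \<Rightarrow> real"
  assumes f: "test_function D f" and \<phi>: "test_function D' \<phi>"
  shows "(\<integral>x. f x * partial_deriv j \<phi> x \<partial>lborel) = - (\<integral>x. partial_deriv j f x * \<phi> x \<partial>lborel)"
proof -
  have dif: "f differentiable at x" "\<phi> differentiable at x" for x
    using test_function_has_derivative f \<phi> by (auto simp: differentiable_def)
  have p: "partial_deriv j (\<lambda>x. f x * \<phi> x) = (\<lambda>x. f x * partial_deriv j \<phi> x + partial_deriv j f x * \<phi> x)"
    using partial_deriv_mult[OF dif(2,1)] by (intro ext)
  have "test_function D' (\<lambda>x. f x * partial_deriv j \<phi> x)" "test_function D' (\<lambda>x. partial_deriv j f x * \<phi> x)"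
    and t: "test_function D' (\<lambda>x. f x * \<phi> x)"
    by (intro test_function_mult test_function_partial_deriv \<phi> test_function_Ck[OF f]
        test_function_Ck[OF test_function_partial_deriv[OF f]])+
  then have "(\<integral>x. f x * partial_deriv j \<phi> x + partial_deriv j f x * \<phi> x \<partial>lborel) =
      (\<integral>x. f x * partial_deriv j \<phi> x \<partial>lborel) + (\<integral>x. partial_deriv j f x * \<phi> x \<partial>lborel)"
    by (intro Bochner_Integration.integral_add test_function_integrable)
  then show ?thesis using integral_partial_deriv_eq_0[OF t, of j] unfolding p by simp
qed

subsection \<open>Approximation by test functions\<close>

lemma compact_sobolev_mono:
  "compact_sobolev K v H \<Longrightarrow> K \<subseteq> K' \<Longrightarrow> compact K' \<Longrightarrow> compact_sobolev K' v H"
  unfolding compact_sobolev_def by (auto simp: subset_iff)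

lemma integral_vec_component:
  fixes f :: "'a \<Rightarrow> ('b::euclidean_space)^'m"
  assumes "integrable M f"
  shows "(\<integral>x. f x \<partial>M) $ i = (\<integral>x. f x $ i \<partial>M)" "integrable M (\<lambda>x. f x $ i)"
  using integral_bounded_linear[OF bounded_linear_vec_nth assms, of i]
    integrable_bounded_linear[OF bounded_linear_vec_nth assms, of i] by auto

lemma compact_sobolev_integrable_mult:
  assumes P: "compact_sobolev K v H" and \<phi>: "test_function D \<phi>"
  shows "integrable lborel (\<lambda>x. v x $ i * \<phi> x)" "integrable lborel (\<lambda>x. H x $ i $ j * \<phi> x)"
proof -
  obtain B where B: "\<And>x. norm (\<phi> x) \<le> B" using test_function_bounded[OF \<phi>] by blast
  have [measurable]: "v \<in> borel_measurable borel" "H \<in> borel_measurable borel" "\<phi> \<in> borel_measurable borel"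
    using P test_function_measurable[OF \<phi>] unfolding compact_sobolev_def by auto
  have le: "\<bar>t * \<phi> x\<bar> \<le> \<bar>B * t\<bar>" for t x
    using mult_left_mono[OF order_trans[OF B[of x] abs_ge_self], of "\<bar>t\<bar>"]
    by (simp add: abs_mult mult_ac)
  have i: "integrable lborel (\<lambda>x. B * v x $ i)" "integrable lborel (\<lambda>x. B * H x $ i $ j)"
    using integral_vec_component(2)[OF compact_sobolev_integrable(1)[OF P], of i]
      integral_vec_component(2)[OF integral_vec_component(2)[OF compact_sobolev_integrable(2)[OF P], of i], of j]
    by simp_all
  show "integrable lborel (\<lambda>x. v x $ i * \<phi> x)"
    by (rule Bochner_Integration.integrable_bound[OF i(1)]) (use le in auto)
  show "integrable lborel (\<lambda>x. H x $ i $ j * \<phi> x)"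
    by (rule Bochner_Integration.integrable_bound[OF i(2)]) (use le in auto)
qed

lemma compact_sobolev_diff:
  assumes P: "compact_sobolev K v H" and Q: "compact_sobolev K w T"
  shows "compact_sobolev K (\<lambda>x. v x - w x) (\<lambda>x. H x - T x)"
  unfolding compact_sobolev_def
proof (intro conjI allI impI)
  obtain B B' where B: "\<And>x. norm (v x) \<le> B \<and> norm (H x) \<le> B" "\<And>x. norm (w x) \<le> B' \<and> norm (T x) \<le> B'"
    using P Q unfolding compact_sobolev_def by blast
  have "norm (v x - w x) \<le> B + B' \<and> norm (H x - T x) \<le> B + B'" for x
    using B[of x] norm_triangle_ineq4[of "v x" "w x"] norm_triangle_ineq4[of "H x" "T x"] by auto
  then show "\<exists>B. \<forall>x. norm (v x - w x) \<le> B \<and> norm (H x - T x) \<le> B" by blast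
  fix \<phi> :: "real^'a \<Rightarrow> real" and i j assume \<phi>: "test_function UNIV \<phi>"
  note d = test_function_partial_deriv[OF \<phi>, of j]
  have "(\<integral>x. v x $ i * partial_deriv j \<phi> x \<partial>lborel) = - (\<integral>x. H x $ i $ j * \<phi> x \<partial>lborel)"
    "(\<integral>x. w x $ i * partial_deriv j \<phi> x \<partial>lborel) = - (\<integral>x. T x $ i $ j * \<phi> x \<partial>lborel)"
    using P Q \<phi> unfolding compact_sobolev_def by blast+
  then show "(\<integral>x. (v x - w x) $ i * partial_deriv j \<phi> x \<partial>lborel) = - (\<integral>x. (H x - T x) $ i $ j * \<phi> x \<partial>lborel)"
    using compact_sobolev_integrable_mult[OF P d] compact_sobolev_integrable_mult[OF Q d]
      compact_sobolev_integrable_mult[OF P \<phi>] compact_sobolev_integrable_mult[OF Q \<phi>]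
    by (simp add: left_diff_distrib)
qed (use P Q in \<open>auto simp: compact_sobolev_def\<close>)

text \<open>The derivative falls on the kernel. The reflected kernel is a test function, and the definition
  of the weak gradient moves the derivative to \<^term>\<open>v\<close>.\<close>

lemma frechet_derivative_mollify_sobolev:
  assumes P: "compact_sobolev K v H" and \<rho>: "test_function UNIV \<rho>"
  shows "frechet_derivative (mollify \<rho> v) (at x) h = mollify \<rho> H x *v h"
proof -
  note iv = compact_sobolev_integrable[OF P]
  note t = test_function_reflect_UNIV[OF \<rho>, of x]
  have \<rho>d: "\<rho> differentiable at z" for z
    using test_function_has_derivative[OF \<rho>] by (auto simp: differentiable_def)
  have "frechet_derivative (mollify \<rho> v) (at x) h $ i = (mollify \<rho> H x *v h) $ i" for i
  proof -
    have ip: "integrable lborel (\<lambda>y. partial_deriv j \<rho> (x - y) * v y $ i)" for j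
      using integral_vec_component(2)[OF mollify_integrable[OF test_function_partial_deriv[OF \<rho>] iv(1)]] by simp
    have "frechet_derivative (mollify \<rho> v) (at x) h $ i = (\<integral>y. frechet_derivative \<rho> (at (x - y)) h * v y $ i \<partial>lborel)"
      unfolding frechet_derivative_mollify[OF \<rho> iv(1)] mollify_def
      by (subst integral_vec_component[OF mollify_integrable[OF test_function_derivative[OF \<rho>] iv(1)]]) simp
    also have "\<dots> = (\<integral>y. (\<Sum>j\<in>UNIV. h $ j * (partial_deriv j \<rho> (x - y) * v y $ i)) \<partial>lborel)"
      unfolding frechet_derivative_eq_sum_partial_deriv[OF \<rho>d]
      by (intro Bochner_Integration.integral_cong refl) (simp add: sum_distrib_left sum_distrib_right mult_ac)
    also have "\<dots> = (\<Sum>j\<in>UNIV. h $ j * (\<integral>y. partial_deriv j \<rho> (x - y) * v y $ i \<partial>lborel))"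
      using ip by (subst Bochner_Integration.integral_sum) auto
    also have "\<dots> = (\<Sum>j\<in>UNIV. mollify \<rho> H x $ i $ j * h $ j)"
    proof (rule sum.cong[OF refl])
      fix j
      have "(\<integral>y. v y $ i * partial_deriv j (\<lambda>y. \<rho> (x - y)) y \<partial>lborel) = - (\<integral>y. H y $ i $ j * \<rho> (x - y) \<partial>lborel)"
        using P t unfolding compact_sobolev_def by blast
      then have "(\<integral>y. partial_deriv j \<rho> (x - y) * v y $ i \<partial>lborel) = (\<integral>y. \<rho> (x - y) * H y $ i $ j \<partial>lborel)"
        by (simp add: partial_deriv_reflect[OF \<rho>] mult.commute)
      also have "\<dots> = mollify \<rho> H x $ i $ j"
        unfolding mollify_def
        using integral_vec_component[OF mollify_integrable[OF \<rho> iv(2)], of x i]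
          integral_vec_component(1)[OF integral_vec_component(2)[OF mollify_integrable[OF \<rho> iv(2)], of x i], of j]
        by simp
      finally show "h $ j * (\<integral>y. partial_deriv j \<rho> (x - y) * v y $ i \<partial>lborel) = mollify \<rho> H x $ i $ j * h $ j"
        by simp
    qed
    also have "\<dots> = (mollify \<rho> H x *v h) $ i" by (simp add: matrix_vector_mult_def)
    finally show ?thesis .
  qed
  then show ?thesis by (simp add: vec_eq_iff)
qed

lemma norm_mollify_le:
  fixes f :: "real^'n \<Rightarrow> 'b::euclidean_space"
  assumes \<rho>: "test_function D \<rho>" "\<And>x. \<rho> x \<ge> 0" "integral\<^sup>L lborel \<rho> = 1"
    and f: "integrable lborel f" "\<And>x. norm (f x) \<le> B"
  shows "norm (mollify \<rho> f x) \<le> B"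
proof -
  have i: "integrable lborel (\<lambda>y. \<rho> (x - y))"
    by (rule integrable_reflect[OF test_function_integrable[OF \<rho>(1)]])
  have "norm (mollify \<rho> f x) \<le> (\<integral>y. \<rho> (x - y) * B \<partial>lborel)"
    unfolding mollify_def
  proof (rule order_trans[OF integral_norm_bound integral_mono[OF integrable_norm]])
    show "integrable lborel (\<lambda>y. \<rho> (x - y) *\<^sub>R f y)" by (rule mollify_integrable[OF \<rho>(1) f(1)])
    show "integrable lborel (\<lambda>y. \<rho> (x - y) * B)" using i by simp
    show "norm (\<rho> (x - y) *\<^sub>R f y) \<le> \<rho> (x - y) * B" for y
      using \<rho>(2)[of "x - y"] f(2)[of y] by (simp add: mult_left_mono)
  qed
  also have "\<dots> = B"
    using integral_reflect[of \<rho> x] test_function_measurable[OF \<rho>(1)] \<rho>(3) by simp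
  finally show ?thesis .
qed

lemma compact_sobolev_test_function:
  fixes \<phi> :: "real^'n \<Rightarrow> real^'m"
  assumes \<phi>: "test_function D \<phi>" and T: "test_function D T"
    and d: "\<And>x h. frechet_derivative \<phi> (at x) h = T x *v h"
  shows "\<exists>K\<subseteq>D. compact_sobolev K \<phi> T"
proof -
  obtain K1 where K1: "compact K1" "K1 \<subseteq> D" "\<And>x. x \<notin> K1 \<Longrightarrow> \<phi> x = 0"
    using \<phi> unfolding test_function_def by blast
  obtain K2 where K2: "compact K2" "K2 \<subseteq> D" "\<And>x. x \<notin> K2 \<Longrightarrow> T x = 0"
    using T unfolding test_function_def by blast
  obtain B1 where B1: "\<And>x. norm (\<phi> x) \<le> B1" using test_function_bounded[OF \<phi>] by blast
  obtain B2 where B2: "\<And>x. norm (T x) \<le> B2" using test_function_bounded[OF T] by blast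
  have "compact_sobolev (K1 \<union> K2) \<phi> T"
    unfolding compact_sobolev_def
  proof (intro conjI allI impI)
    show "\<exists>B. \<forall>x. norm (\<phi> x) \<le> B \<and> norm (T x) \<le> B"
      using B1 B2 by (intro exI[of _ "max B1 B2"]) (auto simp: le_max_iff_disj)
    fix \<psi> :: "real^'n \<Rightarrow> real" and i j assume \<psi>: "test_function UNIV \<psi>"
    have c: "test_function D (\<lambda>x. \<phi> x $ i)"
      using Ck_on_component[OF test_function_Ck[OF \<phi>], of _ i] K1 unfolding test_function_def by auto
    have pd: "partial_deriv j (\<lambda>x. \<phi> x $ i) x = T x $ i $ j" for x
    proof -
      have "((\<lambda>x. \<phi> x $ i) has_derivative (\<lambda>h. frechet_derivative \<phi> (at x) h $ i)) (at x)"
        by (intro bounded_linear.has_derivative[OF bounded_linear_vec_nth] test_function_has_derivative[OF \<phi>])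
      then show ?thesis
        unfolding partial_deriv_def by (simp add: frechet_derivative_eqI d matrix_vector_mult_basis column_def)
    qed
    show "(\<integral>x. \<phi> x $ i * partial_deriv j \<psi> x \<partial>lborel) = - (\<integral>x. T x $ i $ j * \<psi> x \<partial>lborel)"
      using integral_by_parts_test_function[OF c \<psi>, of j] by (simp add: pd)
  qed (use K1 K2 test_function_measurable[OF \<phi>] test_function_measurable[OF T] in auto)
  then show ?thesis using K1(2) K2(2) by (intro exI[of _ "K1 \<union> K2"]) auto
qed

text \<open>Weak gradients are obtained by choice and known only almost everywhere. If \<^term>\<open>f\<close> fails to be integrable,
  its integral is 0 by convention.\<close>

lemma integral_le_of_AE_eq:
  fixes f g :: "'a \<Rightarrow> real"
  assumes "AE x in M. f x = g x" "integrable M g" "\<And>x. 0 \<le> g x"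
  shows "integral\<^sup>L M f \<le> integral\<^sup>L M g"
proof (cases "integrable M f")
  case True
  then show ?thesis using assms by (intro integral_mono_AE) auto
next
  case False
  then show ?thesis using assms(3) by (simp add: not_integrable_integral_eq)
qed

lemma LINT_lebesgue_on_le_lborel:
  fixes f :: "'a::euclidean_space \<Rightarrow> real"
  assumes "integrable lborel f" "\<And>x. 0 \<le> f x" "S \<in> sets lebesgue"
  shows "(LINT x|lebesgue_on S. f x) \<le> (\<integral>x. f x \<partial>lborel)"
proof -
  have i: "integrable lebesgue f" using assms(1) by (simp add: integrable_completion)
  have "(LINT x|lebesgue_on S. f x) = (\<integral>x. indicator S x *\<^sub>R f x \<partial>lebesgue)"
    using assms(3) by (intro integral_restrict_space) auto
  also have "\<dots> \<le> (\<integral>x. f x \<partial>lebesgue)"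
    using assms(2,3) i by (intro integral_mono integrable_mult_indicator) (auto simp: indicator_def)
  also have "\<dots> = (\<integral>x. f x \<partial>lborel)"
    using assms(1) by (intro integral_completion) auto
  finally show ?thesis .
qed

lemma integral_norm_le_of_nn_integral:
  fixes f :: "'a \<Rightarrow> 'b::{banach, second_countable_topology}"
  assumes "f \<in> borel_measurable M" "(\<integral>\<^sup>+x. norm (f x) \<partial>M) \<le> ennreal e" "e \<ge> 0"
  shows "(\<integral>x. norm (f x) \<partial>M) \<le> e"
  using assms by (subst integral_eq_nn_integral) (auto intro!: enn2real_leI)

lemma integral_square_le:
  fixes f :: "'a::euclidean_space \<Rightarrow> 'b::euclidean_space"
  assumes f: "f \<in> borel_measurable borel" "\<And>x. norm (f x) \<le> B" "integrable lborel f"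
    and e: "(\<integral>\<^sup>+x. norm (f x) \<partial>lborel) \<le> ennreal e" "e \<ge> 0" "B \<ge> 0"
  shows "(\<integral>x. (norm (f x))\<^sup>2 \<partial>lborel) \<le> B * e"
proof -
  have "(\<integral>x. (norm (f x))\<^sup>2 \<partial>lborel) \<le> (\<integral>x. B * norm (f x) \<partial>lborel)"
  proof (rule integral_mono_AE')
    show "integrable lborel (\<lambda>x. B * norm (f x))" using f(3) by simp
  qed (use f(2) e(3) in \<open>auto simp: power2_eq_square intro!: mult_right_mono\<close>)
  also have "\<dots> = B * (\<integral>x. norm (f x) \<partial>lborel)" by simp
  also have "\<dots> \<le> B * e"
    using f(1) e by (intro mult_left_mono integral_norm_le_of_nn_integral) auto
  finally show ?thesis .
qed

text \<open>The mollifications are test functions in \<^term>\<open>\<Omega>\<close> that converge in the mean, together with their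
  gradients. All functions involved are bounded by the same constant, so the convergence also holds in
  the quadratic mean.\<close>

theorem compact_sobolev_W12_0:
  fixes v :: "real^'n \<Rightarrow> real^'m"
  assumes P: "compact_sobolev K v H" and \<Omega>: "open \<Omega>" "K \<subseteq> \<Omega>"
  shows "W12_0 \<Omega> v"
proof -
  have K: "compact K" and [measurable]: "v \<in> borel_measurable borel" "H \<in> borel_measurable borel"
    and z: "\<And>x. x \<notin> K \<Longrightarrow> v x = 0" "\<And>x. x \<notin> K \<Longrightarrow> H x = 0"
    using P unfolding compact_sobolev_def by auto
  obtain B where B: "\<And>x. norm (v x) \<le> B" "\<And>x. norm (H x) \<le> B"
    using P unfolding compact_sobolev_def by blast
  have B0: "B \<ge> 0" using order_trans[OF norm_ge_zero B(1)] .
  note iv = compact_sobolev_integrable[OF P]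
  obtain r where r: "r > 0" "\<And>x y. x \<in> K \<Longrightarrow> norm y \<le> r \<Longrightarrow> x + y \<in> \<Omega>"
  proof -
    obtain e where e: "e > 0" "(\<Union>x\<in>K. cball x e) \<subseteq> \<Omega>"
      using compact_subset_open_imp_cball_epsilon_subset[OF K \<Omega>] by blast
    have xy: "x + y \<in> \<Omega>" if "x \<in> K" "norm y \<le> e" for x y
    proof -
      have "x + y \<in> cball x e" using that by (simp add: dist_norm)
      then show ?thesis using that e(2) by blast
    qed
    show ?thesis by (rule that[OF e(1) xy])
  qed
  have "\<exists>\<phi>. test_function \<Omega> \<phi> \<and> W12_norm \<Omega> (\<lambda>x. \<phi> x - v x) \<le> sqrt (4 * B * e)"
    if e: "e > 0" for e
  proof -
    obtain \<rho> :: "real^'n \<Rightarrow> real" where \<rho>: "test_function (ball 0 r) \<rho>" "\<And>x. \<rho> x \<ge> 0" "integral\<^sup>L lborel \<rho> = 1"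
      and le: "(\<integral>\<^sup>+x. norm (mollify \<rho> v x - v x) \<partial>lborel) \<le> ennreal e"
        "(\<integral>\<^sup>+x. norm (mollify \<rho> H x - H x) \<partial>lborel) \<le> ennreal e"
      by (rule mollifier_exists[OF iv e r(1)]) (rule that; simp)
    have \<rho>U: "test_function UNIV \<rho>" using \<rho>(1) test_function_mono by blast
    have t: "test_function \<Omega> (mollify \<rho> v)" "test_function \<Omega> (mollify \<rho> H)"
      using test_function_mollify[OF \<rho>(1) iv(1) K z(1) r(2)] test_function_mollify[OF \<rho>(1) iv(2) K z(2) r(2)] by blast+
    obtain K' where K': "K' \<subseteq> \<Omega>" "compact_sobolev K' (mollify \<rho> v) (mollify \<rho> H)"
      using compact_sobolev_test_function[OF t frechet_derivative_mollify_sobolev[OF P \<rho>U]] by blast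
    let ?w = "\<lambda>x. mollify \<rho> v x - v x" and ?T = "\<lambda>x. mollify \<rho> H x - H x"
    have cK: "compact (K \<union> K')" using K K'(2) unfolding compact_sobolev_def by auto
    have Q: "compact_sobolev (K \<union> K') ?w ?T"
      by (rule compact_sobolev_diff) (use P K'(2) cK compact_sobolev_mono in blast)+
    have sub: "K \<union> K' \<subseteq> \<Omega>" using K' \<Omega> by auto
    note W = compact_sobolev_W12[OF Q \<Omega>(1) sub]
    note iw = compact_sobolev_integrable[OF Q]
    note sw = compact_sobolev_square_integrable[OF Q]
    have \<Omega>s: "\<Omega> \<in> sets lebesgue" using \<Omega>(1) by simp
    have bw: "norm (?w x) \<le> 2 * B" "norm (?T x) \<le> 2 * B" for x
      using norm_mollify_le[OF \<rho> iv(1) B(1), of x] norm_mollify_le[OF \<rho> iv(2) B(2), of x] B(1)[of x] B(2)[of x]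
        norm_triangle_ineq4[of "mollify \<rho> v x" "v x"] norm_triangle_ineq4[of "mollify \<rho> H x" "H x"]
      by linarith+
    have "(LINT x|lebesgue_on \<Omega>. (norm (?w x))\<^sup>2) \<le> (\<integral>x. (norm (?w x))\<^sup>2 \<partial>lborel)"
      by (rule LINT_lebesgue_on_le_lborel[OF sw(1) _ \<Omega>s]) simp
    also have "\<dots> \<le> 2 * B * e"
      using iw(1) bw(1) le(1) e B0 by (intro integral_square_le) auto
    finally have 1: "(LINT x|lebesgue_on \<Omega>. (norm (?w x))\<^sup>2) \<le> 2 * B * e" .
    have "(LINT x|lebesgue_on \<Omega>. (norm (weak_gradient \<Omega> ?w x))\<^sup>2) \<le> (LINT x|lebesgue_on \<Omega>. (norm (?T x))\<^sup>2)"
    proof (rule integral_le_of_AE_eq)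
      show "AE x in lebesgue_on \<Omega>. (norm (weak_gradient \<Omega> ?w x))\<^sup>2 = (norm (?T x))\<^sup>2"
        using weak_gradient_AE[OF \<Omega>(1) W(1)] by eventually_elim simp
    qed (use W(3) in \<open>auto simp: L2_on_def\<close>)
    also have "\<dots> \<le> (\<integral>x. (norm (?T x))\<^sup>2 \<partial>lborel)"
      by (rule LINT_lebesgue_on_le_lborel[OF sw(2) _ \<Omega>s]) simp
    also have "\<dots> \<le> 2 * B * e"
      using iw(2) bw(2) le(2) e B0 by (intro integral_square_le) auto
    finally have "W12_norm \<Omega> ?w \<le> sqrt (4 * B * e)"
      using 1 unfolding W12_norm_def by simp
    then show ?thesis using t(1) by blast
  qed
  then have "\<exists>\<phi>. test_function \<Omega> \<phi> \<and> W12_norm \<Omega> (\<lambda>x. \<phi> x - v x) \<le> sqrt (4 * B * inverse (Suc k))" for k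
    by simp
  then obtain \<phi> where \<phi>: "\<And>k. test_function \<Omega> (\<phi> k)"
    "\<And>k. W12_norm \<Omega> (\<lambda>x. \<phi> k x - v x) \<le> sqrt (4 * B * inverse (Suc k))" by metis
  have "(\<lambda>k. W12_norm \<Omega> (\<lambda>x. \<phi> k x - v x)) \<longlonglongrightarrow> 0"
  proof (rule Lim_null_comparison)
    have "(\<lambda>k. sqrt (4 * B * inverse (Suc k))) \<longlonglongrightarrow> sqrt (4 * B * 0)"
      by (intro tendsto_intros LIMSEQ_inverse_real_of_nat)
    then show "(\<lambda>k. sqrt (4 * B * inverse (Suc k))) \<longlonglongrightarrow> 0" by simp
    have "0 \<le> W12_norm \<Omega> w" for w :: "real^'n \<Rightarrow> real^'m" unfolding W12_norm_def by (simp add: integral_nonneg)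
    then show "\<forall>\<^sub>F k in sequentially. norm (W12_norm \<Omega> (\<lambda>x. \<phi> k x - v x)) \<le> sqrt (4 * B * inverse (Suc k))"
      using \<phi>(2) by (intro always_eventually allI) simp
  qed
  then show ?thesis
    unfolding W12_0_def W12_def
    using \<phi>(1) compact_sobolev_W12[OF P \<Omega>] by blast
qed

subsection \<open>Bounded gradients and Lipschitz continuity\<close>

lemma norm_matrix_vector_mult_le:
  fixes A :: "real^'n^'m"
  shows "norm (A *v x) \<le> norm A * norm x"
proof -
  have "norm ((A *v x) $ i) \<le> norm (A $ i) * norm x" for i
    using Cauchy_Schwarz_ineq2[of "A $ i" x] by (simp add: matrix_vector_mul_component)
  then have "norm (A *v x) \<le> L2_set (\<lambda>i. norm (A $ i) * norm x) UNIV"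
    unfolding norm_vec_def[of "A *v x"] by (intro L2_set_mono) auto
  also have "\<dots> = norm A * norm x"
    by (simp add: norm_vec_def[of A] L2_set_left_distrib)
  finally show ?thesis .
qed

text \<open>The mollifications are Lipschitz with the same constant and converge almost everywhere along a
  subsequence. The limit is Lipschitz on a set of full measure, which is dense.\<close>

theorem compact_sobolev_lipschitz:
  fixes v :: "real^'n \<Rightarrow> real^'m"
  assumes P: "compact_sobolev K v H" and L: "\<And>x. norm (H x) \<le> L"
  obtains w where "L-lipschitz_on UNIV w" "AE x in lborel. v x = w x"
proof -
  note iv = compact_sobolev_integrable[OF P]
  have L0: "L \<ge> 0" using order_trans[OF norm_ge_zero L] .
  have ex: "\<exists>\<phi>. L-lipschitz_on UNIV \<phi> \<and> integrable lborel (\<lambda>x. \<phi> x - v x) \<and>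
      (\<integral>x. norm (\<phi> x - v x) \<partial>lborel) \<le> inverse (Suc k)" for k
  proof -
    obtain \<rho> :: "real^'n \<Rightarrow> real" where \<rho>: "test_function (ball 0 1) \<rho>" "\<And>x. \<rho> x \<ge> 0" "integral\<^sup>L lborel \<rho> = 1"
      and le: "(\<integral>\<^sup>+x. norm (mollify \<rho> v x - v x) \<partial>lborel) \<le> ennreal (inverse (Suc k))"
      using mollifier_exists[OF iv, of "inverse (Suc k)" 1] by auto
    have \<rho>U: "test_function UNIV \<rho>" using \<rho>(1) test_function_mono by blast
    have "compact K" "\<And>x. x \<notin> K \<Longrightarrow> v x = 0" using P unfolding compact_sobolev_def by auto
    from test_function_mollify[OF \<rho>(1) iv(1) this, of UNIV]
    have t: "test_function UNIV (mollify \<rho> v)" by simp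
    have "L-lipschitz_on UNIV (mollify \<rho> v)"
    proof (rule bounded_derivative_imp_lipschitz)
      fix x
      show "(mollify \<rho> v has_derivative (\<lambda>h. mollify \<rho> H x *v h)) (at x within UNIV)"
        using test_function_has_derivative[OF t, of x]
        by (simp add: frechet_derivative_mollify_sobolev[OF P \<rho>U, abs_def])
      have "norm (mollify \<rho> H x *v h) \<le> L * norm h" for h
        using norm_matrix_vector_mult_le[of "mollify \<rho> H x" h]
          mult_right_mono[OF norm_mollify_le[OF \<rho> iv(2) L, of x] norm_ge_zero[of h]] by linarith
      then show "onorm (\<lambda>h. mollify \<rho> H x *v h) \<le> L" by (rule onorm_le)
    qed (use L0 in auto)
    moreover have "integrable lborel (\<lambda>x. mollify \<rho> v x - v x)"
      using test_function_integrable[OF t] iv(1) by simp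
    moreover have "(\<integral>x. norm (mollify \<rho> v x - v x) \<partial>lborel) \<le> inverse (Suc k)"
      using calculation(2) le by (intro integral_norm_le_of_nn_integral) auto
    ultimately show ?thesis by (intro exI[of _ "mollify \<rho> v"] conjI)
  qed
  from choice[OF allI[OF ex]] obtain \<phi> where
    "\<forall>k. L-lipschitz_on UNIV (\<phi> k) \<and> integrable lborel (\<lambda>x. \<phi> k x - v x) \<and>
      (\<integral>x. norm (\<phi> k x - v x) \<partial>lborel) \<le> inverse (Suc k)" ..
  then have \<phi>: "\<And>k. L-lipschitz_on UNIV (\<phi> k)" "\<And>k. integrable lborel (\<lambda>x. \<phi> k x - v x)"
    "\<And>k. (\<integral>x. norm (\<phi> k x - v x) \<partial>lborel) \<le> inverse (Suc k)" by auto
  have "(\<lambda>k. \<integral>x. norm (\<phi> k x - v x) \<partial>lborel) \<longlonglongrightarrow> 0"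
    by (rule Lim_null_comparison[OF _ LIMSEQ_inverse_real_of_nat])
       (use \<phi>(3) in \<open>intro always_eventually allI, simp\<close>)
  from tendsto_L1_AE_subseq[OF \<phi>(2) this] obtain s :: "nat \<Rightarrow> nat"
    where s: "AE x in lborel. (\<lambda>k. \<phi> (s k) x - v x) \<longlonglongrightarrow> 0" by blast
  define S where "S = {x. (\<lambda>k. \<phi> (s k) x - v x) \<longlonglongrightarrow> 0}"
  have "L-lipschitz_on S v"
  proof (rule lipschitz_onI[OF _ L0])
    fix x y assume "x \<in> S" "y \<in> S"
    then have "(\<lambda>k. \<phi> (s k) x) \<longlonglongrightarrow> v x" "(\<lambda>k. \<phi> (s k) y) \<longlonglongrightarrow> v y"
      unfolding S_def by (auto intro: LIM_zero_cancel)
    then have "(\<lambda>k. dist (\<phi> (s k) x) (\<phi> (s k) y)) \<longlonglongrightarrow> dist (v x) (v y)"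
      by (intro tendsto_dist)
    then show "dist (v x) (v y) \<le> L * dist x y"
      by (rule tendsto_upperbound) (use lipschitz_onD[OF \<phi>(1)] in auto)
  qed
  from lipschitz_extend_closure[OF this] obtain w
    where w: "L-lipschitz_on (closure S) w" "\<And>x. x \<in> S \<Longrightarrow> w x = v x" by blast
  have "closure S = UNIV"
  proof (rule ccontr)
    assume "closure S \<noteq> UNIV"
    then have "- closure S \<noteq> {}" by auto
    moreover have "open (- closure S)" by (rule open_Compl[OF closed_closure])
    moreover have "negligible (- closure S)"
    proof -
      obtain N where "N \<in> null_sets lborel" "{x \<in> space lborel. \<not> (\<lambda>k. \<phi> (s k) x - v x) \<longlonglongrightarrow> 0} \<subseteq> N"
        using s unfolding eventually_ae_filter by blast
      moreover from this have "- closure S \<subseteq> N"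
        using closure_subset[of S] by (auto simp: S_def)
      ultimately show ?thesis
        unfolding negligible_iff_null_sets null_sets_completion_iff2 by blast
    qed
    ultimately show False using open_not_negligible by blast
  qed
  moreover have "AE x in lborel. v x = w x"
    using s by eventually_elim (use w(2) in \<open>simp add: S_def\<close>)
  ultimately show ?thesis using that w(1) by simp
qed

section \<open>Minimizers in terms of Borel representatives\<close>

lemma has_weak_gradient_add:
  fixes u v :: "real^'n \<Rightarrow> real^'m"
  assumes D: "open D" and u: "has_weak_gradient D u G" and v: "has_weak_gradient D v H"
  shows "has_weak_gradient D (\<lambda>x. u x + v x) (\<lambda>x. G x + H x)"
  unfolding has_weak_gradient_def
proof (intro conjI allI impI)
  have li: "locally_integrable D u" "locally_integrable D v" "locally_integrable D G" "locally_integrable D H"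
    using u v unfolding has_weak_gradient_def by auto
  show "locally_integrable D (\<lambda>x. u x + v x)" "locally_integrable D (\<lambda>x. G x + H x)"
    using li unfolding locally_integrable_def by auto
  fix \<phi> :: "real^'n \<Rightarrow> real" and i j assume \<phi>: "test_function D \<phi>"
  have 1: "(LINT x|lebesgue_on D. (u x $ i + v x $ i) * partial_deriv j \<phi> x) =
      (LINT x|lebesgue_on D. u x $ i * partial_deriv j \<phi> x) + (LINT x|lebesgue_on D. v x $ i * partial_deriv j \<phi> x)"
    unfolding distrib_right
    by (intro Bochner_Integration.integral_add integrable_times_test_function[OF D _ test_function_partial_deriv[OF \<phi>]]
        locally_integrable_bounded_linear[OF bounded_linear_vec_nth] li)
  have 2: "(LINT x|lebesgue_on D. (G x $ i $ j + H x $ i $ j) * \<phi> x) =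
      (LINT x|lebesgue_on D. G x $ i $ j * \<phi> x) + (LINT x|lebesgue_on D. H x $ i $ j * \<phi> x)"
    unfolding distrib_right
    by (intro Bochner_Integration.integral_add integrable_times_test_function[OF D _ \<phi>]
        locally_integrable_bounded_linear[OF bounded_linear_entry] li)
  have 3: "(LINT x|lebesgue_on D. u x $ i * partial_deriv j \<phi> x) = - (LINT x|lebesgue_on D. G x $ i $ j * \<phi> x)"
    using u \<phi> unfolding has_weak_gradient_def by blast
  have 4: "(LINT x|lebesgue_on D. v x $ i * partial_deriv j \<phi> x) = - (LINT x|lebesgue_on D. H x $ i $ j * \<phi> x)"
    using v \<phi> unfolding has_weak_gradient_def by blast
  show "(LINT x|lebesgue_on D. (u x + v x) $ i * partial_deriv j \<phi> x) = - (LINT x|lebesgue_on D. (G x + H x) $ i $ j * \<phi> x)"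
    using 1 2 3 4 by simp
qed

lemma energy_eq_lborel:
  fixes u :: "real^'n \<Rightarrow> real^'m"
  assumes "open \<Omega>" "AE x in lebesgue_on \<Omega>. weak_gradient \<Omega> u x = G x \<and> u x = U x"
  shows "energy W \<Omega> u = (\<integral>\<^sup>+x. ennreal (1/2 * (norm (G x))\<^sup>2 + W (U x)) * indicator \<Omega> x \<partial>lborel)"
proof -
  have "energy W \<Omega> u = (\<integral>\<^sup>+x. ennreal (1/2 * (norm (G x))\<^sup>2 + W (U x)) \<partial>lebesgue_on \<Omega>)"
    unfolding energy_def
  proof (rule nn_integral_cong_AE)
    show "AE x in lebesgue_on \<Omega>. ennreal (1/2 * (norm (weak_gradient \<Omega> u x))\<^sup>2 + W (u x)) =
        ennreal (1/2 * (norm (G x))\<^sup>2 + W (U x))"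
      using assms(2) by eventually_elim simp
  qed
  also have "\<dots> = (\<integral>\<^sup>+x. ennreal (1/2 * (norm (G x))\<^sup>2 + W (U x)) * indicator \<Omega> x \<partial>lebesgue)"
    using assms(1) by (intro nn_integral_restrict_space) auto
  finally show ?thesis by (simp add: nn_integral_completion)
qed

lemma measurable_of_locally_integrable:
  fixes f :: "real^'n \<Rightarrow> 'b::euclidean_space"
  assumes D: "open D" and f: "locally_integrable D f"
  shows "f \<in> borel_measurable (lebesgue_on D)"
proof -
  obtain C where C: "\<And>n::nat. compact (C n)" "\<And>n. C n \<subseteq> D" "\<And>n. C n \<subseteq> interior (C (Suc n))" "\<Union>(range C) = D"
    using open_Union_compact_subsets[OF D] by metis
  have inc: "C m \<subseteq> C n" if "m \<le> n" for m n
    by (rule lift_Suc_mono_le[OF _ that]) (use C(3) interior_subset in blast)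
  have m: "(\<lambda>x. indicator (C n) x *\<^sub>R f x) \<in> borel_measurable lebesgue" for n
  proof -
    have "integrable (lebesgue_on (C n)) f" using f C unfolding locally_integrable_def by blast
    then have "f \<in> borel_measurable (lebesgue_on (C n))" by simp
    then show ?thesis
      using C(1)[of n] by (subst (asm) borel_measurable_restrict_space_iff) (auto simp: compact_imp_closed)
  qed
  have "(\<lambda>x. indicator D x *\<^sub>R f x) \<in> borel_measurable lebesgue"
  proof (rule borel_measurable_LIMSEQ_metric[OF m])
    fix x
    show "(\<lambda>n. indicator (C n) x *\<^sub>R f x) \<longlonglongrightarrow> indicator D x *\<^sub>R f x"
    proof (cases "x \<in> D")
      case True
      then obtain m where "x \<in> C m" using C(4) by blast
      then have "\<forall>\<^sub>F n in sequentially. x \<in> C n"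
        using inc by (intro eventually_sequentiallyI[of m]) blast
      then have "\<forall>\<^sub>F n in sequentially. indicator (C n) x *\<^sub>R f x = indicator D x *\<^sub>R f x"
        by eventually_elim (simp add: True)
      then show ?thesis by (rule tendsto_eventually)
    next
      case False
      then have "x \<notin> C n" for n using C(2) by blast
      then show ?thesis using False by simp
    qed
  qed
  then show ?thesis using D by (subst borel_measurable_restrict_space_iff) auto
qed

lemma ex_bounded_borel_representative:
  fixes f :: "real^'n \<Rightarrow> 'b::euclidean_space"
  assumes D: "open D" and f: "f \<in> borel_measurable (lebesgue_on D)"
    and bd: "AE x in lebesgue_on D. norm (f x) < M" and "M > 0"
  obtains g where "g \<in> borel_measurable borel" "\<And>x. norm (g x) \<le> M" "AE x in lborel. x \<in> D \<longrightarrow> f x = g x"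
proof -
  have "(\<lambda>x. indicator D x *\<^sub>R f x) \<in> borel_measurable lebesgue"
    using f D by (subst (asm) borel_measurable_restrict_space_iff) auto
  then obtain h where [measurable]: "h \<in> borel_measurable borel" and h: "AE x in lborel. indicator D x *\<^sub>R f x = h x"
    using ex_borel_representative by blast
  show ?thesis
  proof
    show "(\<lambda>x. if norm (h x) \<le> M then h x else 0) \<in> borel_measurable borel" by measurable
    show "norm (if norm (h x) \<le> M then h x else 0) \<le> M" for x using \<open>M > 0\<close> by auto
    have "AE x in lborel. x \<in> D \<longrightarrow> norm (f x) < M" using bd by (simp add: AE_lebesgue_on_iff[OF D])
    then show "AE x in lborel. x \<in> D \<longrightarrow> f x = (if norm (h x) \<le> M then h x else 0)"
      using h by eventually_elim auto
  qed
qed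

definition minimal_pair ::
    "(real^'m \<Rightarrow> real) \<Rightarrow> real^'m \<Rightarrow> (real^'n) set \<Rightarrow> (real^'n \<Rightarrow> real^'m) \<Rightarrow> (real^'n \<Rightarrow> real^'n^'m) \<Rightarrow> bool" where
  "minimal_pair W a D U G \<longleftrightarrow>
     (\<forall>\<Omega> K v H. open \<Omega> \<and> bounded \<Omega> \<and> \<Omega> \<subseteq> D \<and> compact_sobolev K v H \<and> K \<subseteq> \<Omega> \<longrightarrow>
      (\<integral>\<^sup>+x. ennreal (1/2 * (norm (G x))\<^sup>2 + W (a + U x)) * indicator \<Omega> x \<partial>lborel) \<le>
      (\<integral>\<^sup>+x. ennreal (1/2 * (norm (G x + H x))\<^sup>2 + W (a + (U x + v x))) * indicator \<Omega> x \<partial>lborel))"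

text \<open>Everything that is used about a minimizer: after subtracting \<^term>\<open>a\<close>, it and its gradient
  have everywhere bounded Borel representatives, and perturbations by compactly supported pairs
  do not decrease the energy computed from these representatives.\<close>

lemma minimizer_representative:
  fixes W :: "real^'m \<Rightarrow> real" and u :: "real^'n \<Rightarrow> real^'m"
  assumes D: "open D" and HB: "hypothesis_HB W a M D u" and M: "M > 0"
  obtains U G where "U \<in> borel_measurable borel" "G \<in> borel_measurable borel"
    "\<And>x. norm (U x) \<le> M" "\<And>x. norm (G x) \<le> M" "AE x in lborel. x \<in> D \<longrightarrow> u x - a = U x"
    "\<And>\<phi> i j. test_function D \<phi> \<Longrightarrow>
      (\<integral>x. U x $ i * partial_deriv j \<phi> x \<partial>lborel) = - (\<integral>x. G x $ i $ j * \<phi> x \<partial>lborel)"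
    "minimal_pair W a D U G"
proof -
  define G0 where "G0 = weak_gradient D u"
  have "\<exists>G. has_weak_gradient D u G" using HB unfolding hypothesis_HB_def W12_loc_def by blast
  then have G0: "has_weak_gradient D u G0" unfolding G0_def weak_gradient_def by (rule someI_ex)
  then have liG: "locally_integrable D G0" unfolding has_weak_gradient_def by blast
  have um: "u \<in> borel_measurable (lebesgue_on D)"
    using HB unfolding hypothesis_HB_def Linfty_on_def by blast
  have Gm: "G0 \<in> borel_measurable (lebesgue_on D)" by (rule measurable_of_locally_integrable[OF D liG])
  have ub: "AE x in lebesgue_on D. norm (u x - a) < M" and Gb: "AE x in lebesgue_on D. norm (G0 x) < M"
    using HB unfolding hypothesis_HB_def G0_def by auto
  have "(\<lambda>x. u x - a) \<in> borel_measurable (lebesgue_on D)" using um by simp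
  from ex_bounded_borel_representative[OF D this ub M] obtain U
    where U[measurable]: "U \<in> borel_measurable borel" and UM: "\<And>x. norm (U x) \<le> M"
      and Uu: "AE x in lborel. x \<in> D \<longrightarrow> u x - a = U x" by blast
  from ex_bounded_borel_representative[OF D Gm Gb M] obtain G
    where G[measurable]: "G \<in> borel_measurable borel" and GM: "\<And>x. norm (G x) \<le> M"
      and GG: "AE x in lborel. x \<in> D \<longrightarrow> G0 x = G x" by blast
  show ?thesis
  proof (rule that[OF U G UM GM Uu])
    fix \<phi> :: "real^'n \<Rightarrow> real" and i j assume \<phi>: "test_function D \<phi>"
    note d = test_function_partial_deriv[OF \<phi>, of j]
    note [measurable] = test_function_measurable[OF \<phi>] test_function_measurable[OF d]
    have z: "\<And>x. x \<notin> D \<Longrightarrow> \<phi> x = 0" "\<And>x. x \<notin> D \<Longrightarrow> partial_deriv j \<phi> x = 0"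
      using \<phi> d unfolding test_function_def by blast+
    have iU: "integrable lborel (\<lambda>x. U x $ i * partial_deriv j \<phi> x)"
    proof (rule Bochner_Integration.integrable_bound)
      show "integrable lborel (\<lambda>x. M * partial_deriv j \<phi> x)"
        using test_function_integrable[OF d] by simp
      show "AE x in lborel. norm (U x $ i * partial_deriv j \<phi> x) \<le> norm (M * partial_deriv j \<phi> x)"
        using order_trans[OF component_le_norm_cart UM] M
        by (intro AE_I2) (simp add: abs_mult mult_right_mono)
    qed measurable
    have "(LINT x|lebesgue_on D. u x $ i * partial_deriv j \<phi> x) = (\<integral>x. (U x $ i + a $ i) * partial_deriv j \<phi> x \<partial>lborel)"
    proof (rule LINT_lebesgue_on_eq_lborel[OF D])
      show "(\<lambda>x. u x $ i * partial_deriv j \<phi> x) \<in> borel_measurable (lebesgue_on D)"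
        by (intro borel_measurable_times borel_measurable_vec_component um borel_imp_lebesgue_on) measurable
      show "AE x in lborel. x \<in> D \<longrightarrow> u x $ i * partial_deriv j \<phi> x = (U x $ i + a $ i) * partial_deriv j \<phi> x"
        using Uu by eventually_elim (metis diff_add_cancel vector_add_component)
    qed (use z in auto)
    also have "\<dots> = (\<integral>x. U x $ i * partial_deriv j \<phi> x \<partial>lborel) + a $ i * (\<integral>x. partial_deriv j \<phi> x \<partial>lborel)"
      unfolding distrib_right using iU test_function_integrable[OF d]
      by (subst Bochner_Integration.integral_add) auto
    finally have 1: "(LINT x|lebesgue_on D. u x $ i * partial_deriv j \<phi> x) = (\<integral>x. U x $ i * partial_deriv j \<phi> x \<partial>lborel)"
      by (simp add: integral_partial_deriv_eq_0[OF \<phi>])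
    have 2: "(LINT x|lebesgue_on D. G0 x $ i $ j * \<phi> x) = (\<integral>x. G x $ i $ j * \<phi> x \<partial>lborel)"
    proof (rule LINT_lebesgue_on_eq_lborel[OF D])
      show "(\<lambda>x. G0 x $ i $ j * \<phi> x) \<in> borel_measurable (lebesgue_on D)"
        by (intro borel_measurable_times borel_measurable_vec_component Gm borel_imp_lebesgue_on) measurable
      show "AE x in lborel. x \<in> D \<longrightarrow> G0 x $ i $ j * \<phi> x = G x $ i $ j * \<phi> x"
        using GG by eventually_elim auto
    qed (use z in auto)
    have "(LINT x|lebesgue_on D. u x $ i * partial_deriv j \<phi> x) = - (LINT x|lebesgue_on D. G0 x $ i $ j * \<phi> x)"
      using G0 \<phi> unfolding has_weak_gradient_def by blast
    then show "(\<integral>x. U x $ i * partial_deriv j \<phi> x \<partial>lborel) = - (\<integral>x. G x $ i $ j * \<phi> x \<partial>lborel)"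
      unfolding 1 2 .
  next
    show "minimal_pair W a D U G"
      unfolding minimal_pair_def
    proof (intro allI impI, elim conjE)
      fix \<Omega> K and v :: "real^'n \<Rightarrow> real^'m" and H
      assume \<Omega>: "open \<Omega>" "bounded \<Omega>" "\<Omega> \<subseteq> D" and P: "compact_sobolev K v H" and K: "K \<subseteq> \<Omega>"
      have min: "energy W \<Omega> u \<le> energy W \<Omega> (\<lambda>x. u x + v x)"
        using HB \<Omega> compact_sobolev_W12_0[OF P \<Omega>(1) K] unfolding hypothesis_HB_def minimal_def by blast
      have wu: "has_weak_gradient \<Omega> u G0" by (rule has_weak_gradient_subset[OF D \<Omega>(1,3) G0])
      have wv: "has_weak_gradient \<Omega> (\<lambda>x. u x + v x) (\<lambda>x. G0 x + H x)"
        by (rule has_weak_gradient_add[OF \<Omega>(1) wu compact_sobolev_W12(1)[OF P \<Omega>(1) K]])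
      have 1: "energy W \<Omega> u = (\<integral>\<^sup>+x. ennreal (1/2 * (norm (G x))\<^sup>2 + W (a + U x)) * indicator \<Omega> x \<partial>lborel)"
      proof (rule energy_eq_lborel[OF \<Omega>(1)])
        show "AE x in lebesgue_on \<Omega>. weak_gradient \<Omega> u x = G x \<and> u x = a + U x"
          using weak_gradient_AE[OF \<Omega>(1) wu] Uu GG unfolding AE_lebesgue_on_iff[OF \<Omega>(1)]
          by eventually_elim (use \<Omega>(3) in \<open>auto simp: algebra_simps\<close>)
      qed
      have 2: "energy W \<Omega> (\<lambda>x. u x + v x) =
          (\<integral>\<^sup>+x. ennreal (1/2 * (norm (G x + H x))\<^sup>2 + W (a + (U x + v x))) * indicator \<Omega> x \<partial>lborel)"
      proof (rule energy_eq_lborel[OF \<Omega>(1)])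
        show "AE x in lebesgue_on \<Omega>. weak_gradient \<Omega> (\<lambda>x. u x + v x) x = G x + H x \<and> u x + v x = a + (U x + v x)"
          using weak_gradient_AE[OF \<Omega>(1) wv] Uu GG unfolding AE_lebesgue_on_iff[OF \<Omega>(1)]
          by eventually_elim (use \<Omega>(3) in \<open>auto simp: algebra_simps\<close>)
      qed
      show "(\<integral>\<^sup>+x. ennreal (1/2 * (norm (G x))\<^sup>2 + W (a + U x)) * indicator \<Omega> x \<partial>lborel) \<le>
        (\<integral>\<^sup>+x. ennreal (1/2 * (norm (G x + H x))\<^sup>2 + W (a + (U x + v x))) * indicator \<Omega> x \<partial>lborel)"
        using min unfolding 1 2 .
    qed
  qed
qed

section \<open>An isoperimetric inequality for transition layers\<close>

lemma transition_interval:
  fixes p :: "real \<Rightarrow> real"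
  assumes p: "\<And>x y. x \<in> {0..1} \<Longrightarrow> y \<in> {0..1} \<Longrightarrow> \<bar>p x - p y\<bar> \<le> c * \<bar>x - y\<bar>" and cont: "continuous_on {0..1} p"
    and s: "s > 0" and p01: "p 0 > 2 * s" "p 1 \<le> s"
  shows "\<exists>t1 t2. 0 \<le> t1 \<and> t1 \<le> t2 \<and> t2 \<le> 1 \<and> s \<le> c * (t2 - t1) \<and>
    (\<forall>t. t1 < t \<longrightarrow> t < t2 \<longrightarrow> s < p t \<and> p t \<le> 2 * s)"
proof -
  \<comment> \<open>\<open>t2\<close> is the first time at which \<open>p \<le> s\<close>, and \<open>t1\<close> the last time before it at which \<open>p \<ge> 2 * s\<close>.\<close>
  have "closed ({0..1} \<inter> p -` {..s})"
    by (rule continuous_closed_preimage[OF cont]) auto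
  then have c2: "compact ({0..1} \<inter> p -` {..s})"
    by (metis Int_lower1 bounded_closed_interval bounded_subset compact_eq_bounded_closed)
  have "1 \<in> {0..1} \<inter> p -` {..s}" using p01 by auto
  then obtain t2 where t2: "t2 \<in> {0..1} \<inter> p -` {..s}" "\<And>t. t \<in> {0..1} \<inter> p -` {..s} \<Longrightarrow> t2 \<le> t"
    using compact_attains_inf[OF c2] by blast
  have "continuous_on {0..t2} p" using cont t2(1) by (auto intro: continuous_on_subset)
  then have "closed ({0..t2} \<inter> p -` {2 * s ..})"
    by (rule continuous_closed_preimage) auto
  then have c1: "compact ({0..t2} \<inter> p -` {2 * s ..})"
    by (metis Int_lower1 bounded_closed_interval bounded_subset compact_eq_bounded_closed)
  have "0 \<in> {0..t2} \<inter> p -` {2 * s ..}" using t2(1) p01 by auto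
  then obtain t1 where t1: "t1 \<in> {0..t2} \<inter> p -` {2 * s ..}" "\<And>t. t \<in> {0..t2} \<inter> p -` {2 * s ..} \<Longrightarrow> t \<le> t1"
    using compact_attains_sup[OF c1] by blast
  show ?thesis
  proof (intro exI conjI allI impI)
    show "0 \<le> t1" "t1 \<le> t2" "t2 \<le> 1" using t1(1) t2(1) by auto
    have "s \<le> p t1 - p t2" using t1(1) t2(1) by auto
    also have "\<dots> \<le> c * \<bar>t1 - t2\<bar>" using p[of t1 t2] t1(1) t2(1) by auto
    finally show "s \<le> c * (t2 - t1)" using t1(1) by (simp add: abs_minus_commute)
    show "s < p t" "p t \<le> 2 * s" if "t1 < t" "t < t2" for t
      using t1(1) t2(1) t1(2)[of t] t2(2)[of t] that by force+
  qed
qed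

text \<open>Translating the set where \<^term>\<open>g > 2 * s\<close> by a vector of length less than \<^term>\<open>r\<close>, all
  points that leave the set where \<^term>\<open>g > s\<close> cross the layer in between, and by the Lipschitz
  bound they stay in it for a definite fraction of the way. If the ball of radius \<^term>\<open>r\<close> has at
  least twice the volume of \<^term>\<open>{x. g x > s}\<close>, then, on average over the translation vectors, at
  least half of the points leave. This bounds the volume of the inner set by that of the layer;
  with the smallest admissible \<^term>\<open>r\<close> it is the isoperimetric inequality with a non-optimal
  constant.\<close>

theorem transition_layer_isoperimetric:
  fixes g :: "real^'n \<Rightarrow> real"
  assumes g: "L-lipschitz_on UNIV g" and L: "L > 0" and s: "s > 0" and r: "r > 0"
    and fin: "emeasure lborel {x. g x > s} < \<infinity>"
    and vol: "2 * measure lborel {x. g x > s} \<le> measure lborel (ball (0::real^'n) r)"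
  shows "measure lborel {x. g x > 2 * s} \<le> 2 * r * (L / s) * measure lborel {x. s < g x \<and> g x \<le> 2 * s}"
proof -
  have cg: "continuous_on UNIV g" using g by (rule lipschitz_on_continuous_on)
  then have [measurable]: "g \<in> borel_measurable borel" by (rule borel_measurable_continuous_onI)
  define A S T where "A = {x. g x > 2 * s}" and "S = {x. g x > s}" and "T = {x. s < g x \<and> g x \<le> 2 * s}"
  have [measurable]: "A \<in> sets borel" "S \<in> sets borel" "T \<in> sets borel"
    unfolding A_def S_def T_def by measurable
  let ?B = "ball (0::real^'n) r"
  have [measurable]: "?B \<in> sets borel" by simp
  define b where "b = measure lborel ?B"
  have b: "b > 0" "emeasure lborel ?B = ennreal b"
    using r emeasure_bounded_finite[of ?B] content_ball_pos[of r "0::real^'n"]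
    by (auto simp: b_def emeasure_eq_ennreal_measure)
  have fS: "emeasure lborel S = ennreal (measure lborel S)" using fin unfolding S_def
    by (intro emeasure_eq_ennreal_measure) auto
  have "emeasure lborel A \<le> emeasure lborel S" "emeasure lborel T \<le> emeasure lborel S"
    using s by (intro emeasure_mono; auto simp: A_def S_def T_def)+
  then have fA: "emeasure lborel A = ennreal (measure lborel A)" and fT: "emeasure lborel T = ennreal (measure lborel T)"
    using fin unfolding S_def by (auto intro!: emeasure_eq_ennreal_measure)
  let ?q = "s / (L * r)"
  have q: "?q > 0" using s L r by simp
  \<comment> \<open>Each segment that starts in \<open>A\<close> and ends outside \<open>S\<close> spends at least the fraction \<open>s / (L * r)\<close> of its
    length in \<open>T\<close>; integrate over the starting points.\<close>
  let ?N = "\<lambda>h. emeasure lborel {x \<in> A. g (x + h) \<le> s}"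
  have N: "ennreal ?q * ?N h \<le> emeasure lborel T" if h: "h \<in> ?B" for h
  proof -
    have meas: "{x \<in> A. g (x + h) \<le> s} \<in> sets lborel" by measurable
    have "ennreal ?q * ?N h = (\<integral>\<^sup>+x. ennreal ?q * indicator {x \<in> A. g (x + h) \<le> s} x \<partial>lborel)"
      by (rule nn_integral_cmult_indicator[symmetric, OF meas])
    also have "\<dots> \<le> (\<integral>\<^sup>+x. (\<integral>\<^sup>+t. indicator {0..1} t * indicator T (x + t *\<^sub>R h) \<partial>lborel) \<partial>lborel)"
    proof (rule nn_integral_mono)
      fix x
      show "ennreal ?q * indicator {x \<in> A. g (x + h) \<le> s} x \<le>
          (\<integral>\<^sup>+t. indicator {0..1} t * indicator T (x + t *\<^sub>R h) \<partial>lborel)"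
      proof (cases "x \<in> A \<and> g (x + h) \<le> s")
        case True
        let ?p = "\<lambda>t. g (x + t *\<^sub>R h)"
        have lip: "\<bar>?p t1 - ?p t2\<bar> \<le> (L * r) * \<bar>t1 - t2\<bar>" for t1 t2
        proof -
          have "\<bar>g (x + t1 *\<^sub>R h) - g (x + t2 *\<^sub>R h)\<bar> \<le> L * norm ((t1 - t2) *\<^sub>R h)"
            using lipschitz_onD[OF g, of "x + t1 *\<^sub>R h" "x + t2 *\<^sub>R h"]
            by (simp add: dist_norm scaleR_diff_left)
          also have "\<dots> \<le> L * (\<bar>t1 - t2\<bar> * r)"
            using h L by (auto intro!: mult_left_mono)
          finally show ?thesis by (simp add: mult_ac)
        qed
        have cont: "continuous_on {0..1} ?p"
          by (intro continuous_on_compose2[OF cg] continuous_intros) auto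
        have "?p 0 > 2 * s" "?p 1 \<le> s" using True by (auto simp: A_def)
        from transition_interval[of ?p, OF lip cont s this]
        obtain t1 t2 where "0 \<le> t1 \<and> t1 \<le> t2 \<and> t2 \<le> 1 \<and> s \<le> (L * r) * (t2 - t1) \<and>
          (\<forall>t. t1 < t \<longrightarrow> t < t2 \<longrightarrow> s < ?p t \<and> ?p t \<le> 2 * s)" by (elim exE)
        then have t: "0 \<le> t1" "t1 \<le> t2" "t2 \<le> 1" "s \<le> (L * r) * (t2 - t1)"
          "\<And>t. t1 < t \<Longrightarrow> t < t2 \<Longrightarrow> s < ?p t \<and> ?p t \<le> 2 * s" by blast+
        have "ennreal ?q \<le> ennreal (t2 - t1)"
          using t(4) L r by (intro ennreal_leI) (simp add: divide_le_eq mult.commute)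
        also have "\<dots> = (\<integral>\<^sup>+t. indicator {t1<..<t2} t \<partial>lborel)"
          using t(2) by simp
        also have "\<dots> \<le> (\<integral>\<^sup>+t. indicator {0..1} t * indicator T (x + t *\<^sub>R h) \<partial>lborel)"
          using t by (intro nn_integral_mono) (auto simp: indicator_def T_def)
        finally show ?thesis by (auto simp: indicator_def)
      next
        case False
        then have "indicator {x \<in> A. g (x + h) \<le> s} x = (0::ennreal)" by (auto simp: indicator_def)
        then show ?thesis by simp
      qed
    qed
    also have "\<dots> = (\<integral>\<^sup>+t. (\<integral>\<^sup>+x. indicator {0..1} t * indicator T (x + t *\<^sub>R h) \<partial>lborel) \<partial>lborel)"
      by (rule lborel_pair.Fubini') measurable
    also have "\<dots> = (\<integral>\<^sup>+t. indicator {0..1::real} t * emeasure lborel T \<partial>lborel)"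
    proof (rule nn_integral_cong)
      fix t :: real
      have "(\<integral>\<^sup>+x. indicator {0..1} t * indicator T (x + t *\<^sub>R h) \<partial>lborel) =
          indicator {0..1} t * (\<integral>\<^sup>+x. indicator T (x + t *\<^sub>R h) \<partial>lborel)"
        by (rule nn_integral_cmult) measurable
      also have "(\<integral>\<^sup>+x. indicator T (x + t *\<^sub>R h) \<partial>lborel) = (\<integral>\<^sup>+x. indicator T x \<partial>lborel)"
        using nn_integral_translate[of "indicator T" "- (t *\<^sub>R h)"] by simp
      finally show "(\<integral>\<^sup>+x. indicator {0..1} t * indicator T (x + t *\<^sub>R h) \<partial>lborel) = indicator {0..1} t * emeasure lborel T"
        by simp
    qed
    also have "\<dots> = emeasure lborel T"
      by (subst nn_integral_multc) auto
    finally show ?thesis .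
  qed
  \<comment> \<open>For each \<open>x\<close> in \<open>A\<close>, at least half of the vectors \<open>h\<close> in the ball lead outside \<open>S\<close>; integrate over \<open>x\<close> and
    exchange the integrals.\<close>
  have "ennreal ?q * (ennreal (b / 2) * emeasure lborel A) =
      ennreal ?q * (\<integral>\<^sup>+x. ennreal (b / 2) * indicator A x \<partial>lborel)"
    by (simp add: nn_integral_cmult_indicator)
  also have "\<dots> \<le> ennreal ?q * (\<integral>\<^sup>+x. (\<integral>\<^sup>+h. indicator A x * (indicator ?B h * indicator {..s} (g (x + h))) \<partial>lborel) \<partial>lborel)"
  proof (intro mult_left_mono nn_integral_mono)
    fix x
    have "emeasure lborel ?B \<le> emeasure lborel ({h \<in> ?B. g (x + h) \<le> s} \<union> {h. g (x + h) > s})"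
      by (rule emeasure_mono) auto
    also have "\<dots> \<le> emeasure lborel {h \<in> ?B. g (x + h) \<le> s} + emeasure lborel {h. g (x + h) > s}"
      by (rule emeasure_subadditive) measurable
    also have "emeasure lborel {h. g (x + h) > s} = (\<integral>\<^sup>+h. indicator {h. g (x + h) > s} h \<partial>lborel)"
      by (rule nn_integral_indicator[symmetric]) measurable
    also have "\<dots> = (\<integral>\<^sup>+h. indicator S (h - (- x)) \<partial>lborel)"
      by (intro nn_integral_cong) (simp add: indicator_def S_def add.commute)
    also have "\<dots> = emeasure lborel S"
      by (subst nn_integral_translate) auto
    finally have le: "ennreal b \<le> emeasure lborel {h \<in> ?B. g (x + h) \<le> s} + ennreal (measure lborel S)"
      unfolding b fS .
    have "ennreal (b / 2) \<le> emeasure lborel {h \<in> ?B. g (x + h) \<le> s}"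
    proof (cases "emeasure lborel {h \<in> ?B. g (x + h) \<le> s}")
      case (real e)
      then have "b \<le> e + measure lborel S"
        using le by (metis ennreal_le_iff ennreal_plus measure_nonneg add_nonneg_nonneg)
      then have "b / 2 \<le> e" using vol unfolding b_def S_def by simp
      then show ?thesis using real by (simp add: ennreal_leI)
    qed simp
    also have "\<dots> = (\<integral>\<^sup>+h. indicator ?B h * indicator {..s} (g (x + h)) \<partial>lborel)"
    proof -
      have "emeasure lborel {h \<in> ?B. g (x + h) \<le> s} = (\<integral>\<^sup>+h. indicator {h \<in> ?B. g (x + h) \<le> s} h \<partial>lborel)"
        by (rule nn_integral_indicator[symmetric]) measurable
      also have "\<dots> = (\<integral>\<^sup>+h. indicator ?B h * indicator {..s} (g (x + h)) \<partial>lborel)"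
        by (intro nn_integral_cong) (simp add: indicator_def)
      finally show ?thesis .
    qed
    finally show "ennreal (b / 2) * indicator A x \<le> (\<integral>\<^sup>+h. indicator A x * (indicator ?B h * indicator {..s} (g (x + h))) \<partial>lborel)"
      by (auto simp: indicator_def)
  qed simp
  also have "\<dots> = ennreal ?q * (\<integral>\<^sup>+h. (\<integral>\<^sup>+x. indicator A x * (indicator ?B h * indicator {..s} (g (x + h))) \<partial>lborel) \<partial>lborel)"
    by (intro arg_cong[where f = "(*) (ennreal ?q)"] lborel_pair.Fubini') measurable
  also have "\<dots> = (\<integral>\<^sup>+h. ennreal ?q * (\<integral>\<^sup>+x. indicator A x * (indicator ?B h * indicator {..s} (g (x + h))) \<partial>lborel) \<partial>lborel)"
    by (rule nn_integral_cmult[symmetric]) measurable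
  also have "\<dots> \<le> (\<integral>\<^sup>+h. emeasure lborel T * indicator ?B h \<partial>lborel)"
  proof (rule nn_integral_mono)
    fix h :: "real^'n"
    have "(\<integral>\<^sup>+x. indicator A x * (indicator ?B h * indicator {..s} (g (x + h))) \<partial>lborel) = indicator ?B h * ?N h"
    proof -
      have "(\<integral>\<^sup>+x. indicator A x * (indicator ?B h * indicator {..s} (g (x + h))) \<partial>lborel) =
          (\<integral>\<^sup>+x. indicator ?B h * indicator {x \<in> A. g (x + h) \<le> s} x \<partial>lborel)"
        by (rule nn_integral_cong) (auto simp: indicator_def)
      also have "\<dots> = indicator ?B h * ?N h" by (rule nn_integral_cmult_indicator) measurable
      finally show ?thesis .
    qed
    then show "ennreal ?q * (\<integral>\<^sup>+x. indicator A x * (indicator ?B h * indicator {..s} (g (x + h))) \<partial>lborel) \<le> emeasure lborel T * indicator ?B h"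
      using N[of h] by (auto simp: indicator_def)
  qed
  also have "\<dots> = emeasure lborel T * ennreal b"
    by (simp add: nn_integral_cmult_indicator b)
  finally have "ennreal ?q * (ennreal (b / 2) * emeasure lborel A) \<le> emeasure lborel T * ennreal b" .
  moreover have "ennreal (?q * (b / 2 * measure lborel A)) = ennreal ?q * (ennreal (b / 2) * emeasure lborel A)"
    unfolding fA using less_imp_le[OF q] b(1)
    by (intro trans[OF ennreal_mult] arg_cong2[where f = "(*)"] refl ennreal_mult mult_nonneg_nonneg) auto
  moreover have "ennreal (measure lborel T * b) = emeasure lborel T * ennreal b"
    unfolding fT using b(1) by (intro ennreal_mult) auto
  ultimately have "ennreal (?q * (b / 2 * measure lborel A)) \<le> ennreal (measure lborel T * b)"
    by simp
  then have "?q * (b / 2 * measure lborel A) \<le> measure lborel T * b"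
    using b(1) by (subst (asm) ennreal_le_iff) auto
  then have "b * measure lborel A \<le> b * (2 * r * (L / s) * measure lborel T)"
    using s L r by (simp add: field_simps)
  then show ?thesis
    unfolding A_def[symmetric] T_def[symmetric] by (rule mult_left_le_imp_le) (rule b(1))
qed

section \<open>The potential near its zero\<close>

lemma locally_holder_continuous:
  fixes f :: "'a::metric_space \<Rightarrow> 'b::metric_space"
  assumes "locally_holder \<gamma> f" "\<gamma> > 0"
  shows "continuous_on S f"
proof (intro continuous_at_imp_continuous_on ballI)
  fix x
  obtain r L where r: "r > 0" and L: "\<And>y z. y \<in> ball x r \<Longrightarrow> z \<in> ball x r \<Longrightarrow> dist (f y) (f z) \<le> L * dist y z powr \<gamma>"
    using assms(1) unfolding locally_holder_def by metis
  have "((\<lambda>y. L * dist y x powr \<gamma>) \<longlongrightarrow> L * 0) (at x)"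
  proof (intro tendsto_mult tendsto_const tendsto_zero_powrI)
    show "((\<lambda>y. dist y x) \<longlongrightarrow> 0) (at x)"
      using tendsto_dist[OF tendsto_ident_at[of x UNIV] tendsto_const[of x]] by simp
  qed (use assms(2) in auto)
  then have lim: "((\<lambda>y. L * dist y x powr \<gamma>) \<longlongrightarrow> 0) (at x)" by simp
  have "((\<lambda>y. dist (f y) (f x)) \<longlongrightarrow> 0) (at x)"
  proof (rule Lim_null_comparison[OF _ lim])
    have "\<forall>\<^sub>F y in at x. y \<in> ball x r"
      using r by (intro eventually_at_in_open') auto
    then show "\<forall>\<^sub>F y in at x. norm (dist (f y) (f x)) \<le> L * dist y x powr \<gamma>"
      by eventually_elim (use L[of _ x] r in simp)
  qed
  then show "isCont f x" unfolding isCont_def tendsto_dist_iff[of f] .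
qed

lemma HA_continuous:
  assumes "hypothesis_HA W a"
  shows "continuous_on UNIV W"
proof -
  obtain \<alpha> where \<alpha>: "0 < \<alpha>" "\<alpha> \<le> 2" "C_alpha \<alpha> W"
    using assms unfolding hypothesis_HA_def by blast
  consider "\<alpha> \<le> 1" | "1 < \<alpha>" "\<alpha> < 2" | "\<alpha> = 2" using \<alpha> by linarith
  then show ?thesis
  proof cases
    case 1
    then show ?thesis using \<alpha> locally_holder_continuous by (auto simp: C_alpha_def)
  next
    case 2
    then have "Ck_on 1 UNIV W" using \<alpha> by (simp add: C_alpha_def)
    then show ?thesis by (rule Ck_on_continuous)
  next
    case 3
    then have "Ck_on 2 UNIV W" using \<alpha> by (simp add: C_alpha_def)
    then show ?thesis by (rule Ck_on_continuous)
  qed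
qed

lemma gradient_inner:
  assumes "f differentiable at x"
  shows "gradient f x \<bullet> v = frechet_derivative f (at x) v"
  by (simp add: frechet_derivative_eq_sum_partial_deriv[OF assms] gradient_def inner_vec_def mult.commute)

lemma has_field_derivative_along_ray:
  fixes f :: "real^'m \<Rightarrow> real"
  assumes "f differentiable at (a + t *\<^sub>R \<nu>)"
  shows "((\<lambda>t. f (a + t *\<^sub>R \<nu>)) has_field_derivative frechet_derivative f (at (a + t *\<^sub>R \<nu>)) \<nu>) (at t)"
proof -
  have "((\<lambda>t. f (a + t *\<^sub>R \<nu>)) has_derivative (\<lambda>s. frechet_derivative f (at (a + t *\<^sub>R \<nu>)) (s *\<^sub>R \<nu>))) (at t)"
    by (rule has_derivative_compose[of "\<lambda>t. a + t *\<^sub>R \<nu>" "\<lambda>s. s *\<^sub>R \<nu>"])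
       (use assms in \<open>auto intro!: derivative_eq_intros simp: frechet_derivative_works\<close>)
  moreover have "frechet_derivative f (at (a + t *\<^sub>R \<nu>)) (s *\<^sub>R \<nu>) = frechet_derivative f (at (a + t *\<^sub>R \<nu>)) \<nu> * s" for s
    by (simp add: linear_scale[OF linear_frechet_derivative[OF assms]] mult.commute)
  ultimately show ?thesis by (simp add: has_field_derivative_def)
qed

text \<open>In the \<open>C\<^sup>2\<close> case the derivative of \<^term>\<open>W\<close> vanishes at its minimum \<^term>\<open>a\<close>, and the Hessian
  stays uniformly positive nearby, so that the radial derivative grows at least linearly. This is
  the same lower bound that holds, with room to spare, in the case of a smaller exponent.\<close>

lemma radial_derivative_of_hessian:
  fixes W :: "real^'m \<Rightarrow> real"
  assumes C2: "Ck_on 2 UNIV W" and min: "\<And>z. W a \<le> W z"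
    and C0: "C0 > 0" and hess: "\<And>\<nu>. norm \<nu> = 1 \<Longrightarrow> (hessian W a *v \<nu>) \<bullet> \<nu> \<ge> C0"
  shows "\<exists>c>0. \<exists>\<rho>0>0. \<forall>\<rho> \<nu>. 0 < \<rho> \<and> \<rho> \<le> \<rho>0 \<and> norm \<nu> = 1 \<longrightarrow>
    frechet_derivative W (at (a + \<rho> *\<^sub>R \<nu>)) \<nu> \<ge> c * \<rho>"
proof -
  have C2': "Ck_on (Suc (Suc 0)) UNIV W" using C2 by (simp add: numeral_2_eq_2)
  have dW: "W differentiable at z" for z using C2' by simp
  have dp: "partial_deriv i W differentiable at z" for i z
    using C2' unfolding partial_deriv_def[abs_def] by simp
  have cont: "continuous_on UNIV (partial_deriv j (partial_deriv i W))" for i j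
    using C2' unfolding partial_deriv_def[abs_def] by simp
  let ?N = "real CARD('m)"
  define e where "e = C0 / (2 * ?N * ?N)"
  have e: "e > 0" using C0 by (simp add: e_def)
  have "\<forall>\<^sub>F z in at a. \<forall>i. \<forall>j. \<bar>partial_deriv j (partial_deriv i W) z - partial_deriv j (partial_deriv i W) a\<bar> < e"
  proof (intro eventually_all_finite)
    fix i j
    have "isCont (partial_deriv j (partial_deriv i W)) a"
      using cont[of j i] by (simp add: continuous_on_eq_continuous_at)
    then have "(partial_deriv j (partial_deriv i W) \<longlongrightarrow> partial_deriv j (partial_deriv i W) a) (at a)"
      by (simp add: isCont_def)
    from tendstoD[OF this e]
    show "\<forall>\<^sub>F z in at a. \<bar>partial_deriv j (partial_deriv i W) z - partial_deriv j (partial_deriv i W) a\<bar> < e"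
      by (simp add: dist_real_def)
  qed
  then obtain \<delta> where \<delta>: "\<delta> > 0" and d: "\<And>i j z. z \<noteq> a \<Longrightarrow> dist z a < \<delta> \<Longrightarrow>
      \<bar>partial_deriv j (partial_deriv i W) z - partial_deriv j (partial_deriv i W) a\<bar> < e"
    unfolding eventually_at by blast
  have W0: "frechet_derivative W (at a) = (\<lambda>v. 0)"
    by (rule differential_zero_maxmin[of a UNIV W]) (use dW min in \<open>auto simp: frechet_derivative_works[symmetric]\<close>)
  have "frechet_derivative W (at (a + \<rho> *\<^sub>R \<nu>)) \<nu> \<ge> C0 / 2 * \<rho>" if \<rho>: "0 < \<rho>" "\<rho> \<le> \<delta> / 2" and \<nu>: "norm \<nu> = 1" for \<rho> \<nu>
  proof -
    let ?\<psi> = "\<lambda>t. \<Sum>i\<in>UNIV. \<nu> $ i * partial_deriv i W (a + t *\<^sub>R \<nu>)"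
    let ?\<psi>' = "\<lambda>t. \<Sum>i\<in>UNIV. \<nu> $ i * (\<Sum>j\<in>UNIV. \<nu> $ j * partial_deriv j (partial_deriv i W) (a + t *\<^sub>R \<nu>))"
    have \<psi>: "frechet_derivative W (at (a + t *\<^sub>R \<nu>)) \<nu> = ?\<psi> t" for t
      by (rule frechet_derivative_eq_sum_partial_deriv[OF dW])
    have der: "(?\<psi> has_field_derivative ?\<psi>' t) (at t)" for t
      by (intro DERIV_sum DERIV_cmult)
         (use has_field_derivative_along_ray[OF dp] in \<open>simp add: frechet_derivative_eq_sum_partial_deriv[OF dp]\<close>)
    obtain \<xi> where \<xi>: "0 < \<xi>" "\<xi> < \<rho>" "?\<psi> \<rho> - ?\<psi> 0 = (\<rho> - 0) * ?\<psi>' \<xi>"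
      using MVT2[OF \<rho>(1) der] by blast
    have "a + \<xi> *\<^sub>R \<nu> \<noteq> a" "dist (a + \<xi> *\<^sub>R \<nu>) a < \<delta>"
      using \<xi>(1,2) \<rho> \<nu> \<delta> by (auto simp: dist_norm)
    then have close: "\<bar>partial_deriv j (partial_deriv i W) (a + \<xi> *\<^sub>R \<nu>) - partial_deriv j (partial_deriv i W) a\<bar> < e" for i j
      by (rule d)
    have \<nu>1: "\<bar>\<nu> $ i\<bar> \<le> 1" for i using component_le_norm_cart[of \<nu> i] \<nu> by simp
    have "C0 \<le> (hessian W a *v \<nu>) \<bullet> \<nu>" by (rule hess[OF \<nu>])
    also have "\<dots> = (\<Sum>i\<in>UNIV. \<Sum>j\<in>UNIV. \<nu> $ i * \<nu> $ j * partial_deriv j (partial_deriv i W) a)"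
      by (simp add: inner_vec_def matrix_vector_mult_def hessian_def sum_distrib_left sum_distrib_right mult_ac)
    also have "\<dots> \<le> (\<Sum>i\<in>UNIV. \<Sum>j\<in>UNIV. \<nu> $ i * \<nu> $ j * partial_deriv j (partial_deriv i W) (a + \<xi> *\<^sub>R \<nu>) + e)"
    proof (intro sum_mono)
      fix i j
      let ?h = "partial_deriv j (partial_deriv i W)"
      have "\<nu> $ i * \<nu> $ j * (?h a - ?h (a + \<xi> *\<^sub>R \<nu>)) \<le> \<bar>\<nu> $ i\<bar> * \<bar>\<nu> $ j\<bar> * \<bar>?h a - ?h (a + \<xi> *\<^sub>R \<nu>)\<bar>"
        by (metis abs_ge_self abs_mult)
      also have "\<dots> \<le> 1 * 1 * e"
        using close[of j i] by (intro mult_mono \<nu>1) (auto simp: abs_minus_commute)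
      finally show "\<nu> $ i * \<nu> $ j * ?h a \<le> \<nu> $ i * \<nu> $ j * ?h (a + \<xi> *\<^sub>R \<nu>) + e"
        by (simp add: algebra_simps)
    qed
    also have "\<dots> = ?\<psi>' \<xi> + C0 / 2"
      using C0 by (simp add: sum.distrib sum_distrib_left mult_ac e_def)
    finally have "C0 / 2 \<le> ?\<psi>' \<xi>" by simp
    then have "\<rho> * (C0 / 2) \<le> \<rho> * ?\<psi>' \<xi>" using \<rho>(1) by (intro mult_left_mono) auto
    moreover have "?\<psi> 0 = 0" using \<psi>[of 0] W0 by simp
    ultimately show ?thesis unfolding \<psi> using \<xi>(3) by (simp add: mult.commute)
  qed
  then show ?thesis using C0 \<delta> by (intro exI[of _ "C0/2"] exI[of _ "\<delta>/2"] conjI allI impI) auto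
qed

lemma HA_radial_derivative:
  fixes W :: "real^'m \<Rightarrow> real"
  assumes HA: "hypothesis_HA W a"
  shows "\<exists>c>0. \<exists>\<rho>0>0. \<forall>\<rho> \<nu>. 0 < \<rho> \<and> \<rho> \<le> \<rho>0 \<and> norm \<nu> = 1 \<longrightarrow>
    frechet_derivative W (at (a + \<rho> *\<^sub>R \<nu>)) \<nu> \<ge> c * \<rho>"
proof -
  obtain \<alpha> where \<alpha>: "0 < \<alpha>" "\<alpha> \<le> 2" "C_alpha \<alpha> W" and C1: "Ck_on 1 (- {a}) W"
    and lt: "\<alpha> < 2 \<Longrightarrow> \<exists>Cs>0. \<exists>\<rho>0>0. \<forall>\<rho> \<nu>. 0 < \<rho> \<and> \<rho> \<le> \<rho>0 \<and> norm \<nu> = 1 \<longrightarrow>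
              gradient W (a + \<rho> *\<^sub>R \<nu>) \<bullet> \<nu> \<ge> Cs * \<rho> powr (\<alpha> - 1)"
    and eq: "\<alpha> = 2 \<Longrightarrow> \<exists>C0>0. \<forall>\<nu>. norm \<nu> = 1 \<longrightarrow> (hessian W a *v \<nu>) \<bullet> \<nu> \<ge> C0"
    using HA unfolding hypothesis_HA_def by blast
  have min: "W a \<le> W z" for z using HA unfolding hypothesis_HA_def by simp
  show ?thesis
  proof (cases "\<alpha> = 2")
    case True
    then have "Ck_on 2 UNIV W" using \<alpha> by (simp add: C_alpha_def)
    then show ?thesis using radial_derivative_of_hessian[where a = a and W = W, OF _ min] eq[OF True] by blast
  next
    case False
    then have "\<alpha> < 2" using \<alpha> by simp
    from lt[OF this] obtain Cs \<rho>0 where Cs: "Cs > 0" "\<rho>0 > 0"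
      "\<And>\<rho> \<nu>. 0 < \<rho> \<Longrightarrow> \<rho> \<le> \<rho>0 \<Longrightarrow> norm \<nu> = 1 \<Longrightarrow> gradient W (a + \<rho> *\<^sub>R \<nu>) \<bullet> \<nu> \<ge> Cs * \<rho> powr (\<alpha> - 1)" by blast
    have "frechet_derivative W (at (a + \<rho> *\<^sub>R \<nu>)) \<nu> \<ge> Cs * \<rho>" if \<rho>: "0 < \<rho>" "\<rho> \<le> min \<rho>0 1" and \<nu>: "norm \<nu> = 1" for \<rho> \<nu>
    proof -
      have "a + \<rho> *\<^sub>R \<nu> \<in> - {a}" using \<rho> \<nu> by auto
      then have "W differentiable at (a + \<rho> *\<^sub>R \<nu>)" using C1 by simp
      then have "frechet_derivative W (at (a + \<rho> *\<^sub>R \<nu>)) \<nu> \<ge> Cs * \<rho> powr (\<alpha> - 1)"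
        using Cs(3)[of \<rho> \<nu>] \<rho> \<nu> by (simp add: gradient_inner)
      moreover have "\<rho> powr 1 \<le> \<rho> powr (\<alpha> - 1)"
        using \<rho> \<open>\<alpha> < 2\<close> by (intro powr_mono') auto
      then have "Cs * \<rho> \<le> Cs * \<rho> powr (\<alpha> - 1)"
        using Cs(1) \<rho> by simp
      ultimately show ?thesis by linarith
    qed
    then show ?thesis using Cs(1,2) by (intro exI[of _ Cs] exI[of _ "min \<rho>0 1"] conjI allI impI) auto
  qed
qed

text \<open>The two consequences of the hypothesis on the potential near \<^term>\<open>a\<close> that enter the energy
  comparison.\<close>

lemma HA_quadratic_growth:
  fixes W :: "real^'m \<Rightarrow> real"
  assumes HA: "hypothesis_HA W a"
  obtains c \<rho>0 where "c > 0" "\<rho>0 > 0"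
    "\<And>y. norm y \<le> \<rho>0 \<Longrightarrow> c * (norm y)\<^sup>2 \<le> W (a + y)"
    "\<And>y t. norm y \<le> \<rho>0 \<Longrightarrow> 0 \<le> t \<Longrightarrow> t \<le> 1 \<Longrightarrow> W (a + t *\<^sub>R y) \<le> W (a + y)"
proof -
  obtain c \<rho>0 where c: "c > 0" "\<rho>0 > 0"
    "\<And>\<rho> \<nu>. 0 < \<rho> \<Longrightarrow> \<rho> \<le> \<rho>0 \<Longrightarrow> norm \<nu> = 1 \<Longrightarrow> frechet_derivative W (at (a + \<rho> *\<^sub>R \<nu>)) \<nu> \<ge> c * \<rho>"
    using HA_radial_derivative[OF HA] by blast
  have C1: "Ck_on 1 (- {a}) W" and Wa: "W a = 0"
    using HA unfolding hypothesis_HA_def by auto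
  have cW: "continuous_on UNIV W" by (rule HA_continuous[OF HA])
  have der: "((\<lambda>t. W (a + t *\<^sub>R \<nu>)) has_field_derivative frechet_derivative W (at (a + \<rho> *\<^sub>R \<nu>)) \<nu>) (at \<rho>)"
    if "0 < \<rho>" "norm \<nu> = 1" for \<rho> \<nu>
  proof (rule has_field_derivative_along_ray)
    have "a + \<rho> *\<^sub>R \<nu> \<in> - {a}" using that by auto
    then show "W differentiable at (a + \<rho> *\<^sub>R \<nu>)" using C1 by simp
  qed
  have cont: "continuous_on S (\<lambda>t. W (a + t *\<^sub>R \<nu>))" for S \<nu>
    by (intro continuous_on_compose2[OF cW] continuous_intros) auto
  show ?thesis
  proof (rule that[of "c/2" \<rho>0])
    show "c / 2 * (norm y)\<^sup>2 \<le> W (a + y)" if y: "norm y \<le> \<rho>0" for y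
    proof (cases "y = 0")
      case False
      define \<nu> where "\<nu> = y /\<^sub>R norm y"
      have \<nu>: "norm \<nu> = 1" "y = norm y *\<^sub>R \<nu>" using False by (auto simp: \<nu>_def)
      let ?f = "\<lambda>t. W (a + t *\<^sub>R \<nu>) - c / 2 * t\<^sup>2"
      have "?f 0 \<le> ?f (norm y)"
      proof (rule DERIV_nonneg_imp_increasing_open[of 0 "norm y" ?f])
        show "\<exists>d. DERIV ?f x :> d \<and> 0 \<le> d" if "0 < x" "x < norm y" for x
        proof (intro exI conjI)
          show "DERIV ?f x :> frechet_derivative W (at (a + x *\<^sub>R \<nu>)) \<nu> - c / 2 * (2 * x)"
            by (auto intro!: derivative_eq_intros der that \<nu>)
          show "0 \<le> frechet_derivative W (at (a + x *\<^sub>R \<nu>)) \<nu> - c / 2 * (2 * x)"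
            using c(3)[of x \<nu>] that y \<nu> by simp
        qed
        show "continuous_on {0..norm y} ?f" by (intro continuous_intros cont)
      qed simp
      then show ?thesis using Wa \<nu>(2) by simp
    qed (simp add: Wa)
    show "W (a + t *\<^sub>R y) \<le> W (a + y)" if y: "norm y \<le> \<rho>0" and t: "0 \<le> t" "t \<le> 1" for y t
    proof (cases "y = 0")
      case False
      define \<nu> where "\<nu> = y /\<^sub>R norm y"
      have \<nu>: "norm \<nu> = 1" "y = norm y *\<^sub>R \<nu>" using False by (auto simp: \<nu>_def)
      let ?f = "\<lambda>t. W (a + t *\<^sub>R \<nu>)"
      have "?f (t * norm y) \<le> ?f (norm y)"
      proof (rule DERIV_nonneg_imp_increasing_open[of "t * norm y" "norm y" ?f])
        show "t * norm y \<le> norm y" using t by (simp add: mult_left_le_one_le)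
        show "\<exists>d. DERIV ?f x :> d \<and> 0 \<le> d" if x: "t * norm y < x" "x < norm y" for x
        proof (intro exI conjI)
          have "0 \<le> t * norm y" using t by simp
          then have x0: "0 < x" using x by linarith
          show "DERIV ?f x :> frechet_derivative W (at (a + x *\<^sub>R \<nu>)) \<nu>" by (rule der[OF x0 \<nu>(1)])
          have "0 \<le> c * x" using c(1) x0 by simp
          also have "\<dots> \<le> frechet_derivative W (at (a + x *\<^sub>R \<nu>)) \<nu>" using c(3)[of x \<nu>] x x0 y \<nu> by simp
          finally show "0 \<le> frechet_derivative W (at (a + x *\<^sub>R \<nu>)) \<nu>" .
        qed
      qed (rule cont)
      moreover have "(t * norm y) *\<^sub>R \<nu> = t *\<^sub>R y" "norm y *\<^sub>R \<nu> = y" using \<nu>(2) by (metis scaleR_scaleR)+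
      ultimately show ?thesis by simp
    qed simp
  qed (use c in auto)
qed

lemma HA_positive_on_annulus:
  fixes W :: "real^'m \<Rightarrow> real"
  assumes HA: "hypothesis_HA W a" and s: "0 < s" and l: "ereal l < dist_other_zeros W a"
  obtains c where "c > 0" "\<And>y. s \<le> norm y \<Longrightarrow> norm y \<le> l \<Longrightarrow> c \<le> W (a + y)"
proof -
  let ?K = "cball a l - ball a s"
  have cK: "compact ?K" by (intro compact_diff) auto
  have pos: "W z > 0" if "z \<in> ?K" for z
  proof -
    have "W z \<noteq> 0"
    proof
      assume "W z = 0"
      then have "z \<in> {z. W z = 0} - {a}" using that s by auto
      then have "dist_other_zeros W a \<le> ereal (dist a z)" unfolding dist_other_zeros_def by (rule INF_lower)
      then have "ereal l < ereal (dist a z)" using l by (rule order_less_le_trans[rotated])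
      then show False using that by simp
    qed
    moreover have "W z \<ge> 0" using HA unfolding hypothesis_HA_def by blast
    ultimately show ?thesis by simp
  qed
  have mem: "a + y \<in> ?K" if "s \<le> norm y" "norm y \<le> l" for y
    using that by (simp add: dist_norm)
  show ?thesis
  proof (cases "?K = {}")
    case True
    then show ?thesis using that[of 1] mem by (metis empty_iff zero_less_one)
  next
    case False
    obtain z where z: "z \<in> ?K" "\<And>w. w \<in> ?K \<Longrightarrow> W z \<le> W w"
      using continuous_attains_inf[OF cK False, of W] continuous_on_subset[OF HA_continuous[OF HA]] by blast
    show ?thesis by (rule that[OF pos[OF z(1)] z(2)[OF mem]])
  qed
qed

section \<open>Cutting off a Sobolev function\<close>

definition cutoff_function :: "real^'n \<Rightarrow> real \<Rightarrow> real \<Rightarrow> (real^'n \<Rightarrow> real) \<Rightarrow> bool" where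
  "cutoff_function x0 R Q \<eta> \<longleftrightarrow> test_function (ball x0 (R + 1)) \<eta> \<and> (\<forall>x. 0 \<le> \<eta> x \<and> \<eta> x \<le> 1) \<and>
     (\<forall>x\<in>ball x0 R. \<eta> x = 1 \<and> gradient \<eta> x = 0) \<and> (\<forall>x. norm (gradient \<eta> x) \<le> Q)"

text \<open>Mollify the indicator function of a ball of an intermediate radius with a fixed kernel: the gradient
  is then bounded in terms of the kernel alone, for all centers and radii.\<close>

lemma cutoff_exists:
  "\<exists>Q\<ge>0. \<forall>(x0 :: real^'n) R. R > 0 \<longrightarrow> (\<exists>\<eta>. cutoff_function x0 R Q \<eta>)"
proof -
  obtain \<rho> :: "real^'n \<Rightarrow> real" where \<rho>: "test_function (ball 0 (1/4)) \<rho>" "\<And>x. \<rho> x \<ge> 0" "integral\<^sup>L lborel \<rho> = 1"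
    using bump_exists[of "1/4"] by auto
  define q where "q = (\<lambda>j. \<integral>x. \<bar>partial_deriv j \<rho> x\<bar> \<partial>lborel)"
  have q0: "q j \<ge> 0" for j unfolding q_def by simp
  show ?thesis
  proof (intro exI[of _ "\<Sum>j\<in>UNIV. q j"] conjI allI impI)
    show "sum q UNIV \<ge> 0" using q0 by (simp add: sum_nonneg)
    fix x0 :: "real^'n" and R :: real assume R: "R > 0"
    let ?B = "cball x0 (R + 1/2)"
    define f :: "real^'n \<Rightarrow> real" where "f = indicator ?B"
    have f: "integrable lborel f"
      unfolding f_def
    proof (rule integrable_bounded_support[of _ 1 ?B])
      show "indicator ?B \<in> borel_measurable borel" by (intro borel_measurable_indicator) simp
    qed (auto simp: indicator_def)
    have f1: "norm (f x) \<le> 1" for x by (simp add: f_def indicator_def)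
    define \<eta> where "\<eta> = mollify \<rho> f"
    have t: "test_function (ball x0 (R + 1)) \<eta>"
      unfolding \<eta>_def
    proof (rule test_function_mollify[OF \<rho>(1) f, of ?B])
      show "x + y \<in> ball x0 (R + 1)" if "x \<in> ?B" "norm y \<le> 1/4" for x y
        using that dist_triangle[of x0 "x + y" x] by (simp add: dist_norm)
    qed (auto simp: f_def)
    have one: "\<eta> x = 1" if x: "x \<in> ball x0 (R + 1/4)" for x
    proof -
      have "\<rho> (x - y) *\<^sub>R f y = \<rho> (x - y)" for y
      proof (cases "y \<in> ?B")
        case False
        then have "dist x y \<ge> 1/4"
          using x dist_triangle[of x0 y x] unfolding mem_ball mem_cball by linarith
        then have "x - y \<notin> ball 0 (1/4)" by (simp add: dist_norm norm_minus_commute)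
        then have "\<rho> (x - y) = 0" using \<rho>(1) unfolding test_function_def by blast
        then show ?thesis by simp
      qed (simp add: f_def)
      then have "\<eta> x = (\<integral>y. \<rho> (x - y) \<partial>lborel)" by (simp only: \<eta>_def mollify_def)
      also have "\<dots> = 1"
        using integral_reflect[of \<rho> x] test_function_measurable[OF \<rho>(1)] \<rho>(3) by simp
      finally show ?thesis .
    qed
    have grad0: "gradient \<eta> x = 0" if x: "x \<in> ball x0 R" for x
    proof -
      have "(\<eta> has_derivative (\<lambda>_. 0)) (at x)"
        by (rule has_derivative_transform_within_open[of "\<lambda>_. 1" "\<lambda>_. 0" x UNIV "ball x0 (R + 1/4)" \<eta>])
           (use one x in auto)
      then have "frechet_derivative \<eta> (at x) v = 0" for v by (rule frechet_derivative_eqI)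
      then show ?thesis by (simp add: gradient_def partial_deriv_def vec_eq_iff)
    qed
    have pd: "\<bar>partial_deriv j \<eta> x\<bar> \<le> q j" for j x
    proof -
      note tj = test_function_partial_deriv[OF \<rho>(1), of j]
      have "partial_deriv j \<eta> x = mollify (partial_deriv j \<rho>) f x"
        unfolding partial_deriv_def \<eta>_def frechet_derivative_mollify[OF \<rho>(1) f] ..
      also have "\<bar>\<dots>\<bar> \<le> (\<integral>y. \<bar>partial_deriv j \<rho> (x - y)\<bar> \<partial>lborel)"
        unfolding mollify_def real_norm_def[symmetric]
      proof (rule order_trans[OF integral_norm_bound integral_mono[OF integrable_norm]])
        show "integrable lborel (\<lambda>y. partial_deriv j \<rho> (x - y) *\<^sub>R f y)"
          by (rule mollify_integrable[OF tj f])
        show "integrable lborel (\<lambda>y. norm (partial_deriv j \<rho> (x - y)))"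
          by (intro integrable_norm integrable_reflect test_function_integrable[OF tj])
        show "norm (partial_deriv j \<rho> (x - y) *\<^sub>R f y) \<le> norm (partial_deriv j \<rho> (x - y))" for y
          using mult_left_mono[OF f1[of y] norm_ge_zero[of "partial_deriv j \<rho> (x - y)"]] by (simp add: abs_mult)
      qed
      also have "\<dots> = q j"
        unfolding q_def using integral_reflect[of "\<lambda>y. \<bar>partial_deriv j \<rho> y\<bar>" x] test_function_measurable[OF tj] by simp
      finally show ?thesis .
    qed
    have gr: "norm (gradient \<eta> x) \<le> sum q UNIV" for x
      using order_trans[OF norm_le_l1_cart sum_mono, of "gradient \<eta> x" q] pd by (simp add: gradient_def)
    have "0 \<le> \<eta> x \<and> \<eta> x \<le> 1" for x
    proof
      show "0 \<le> \<eta> x" unfolding \<eta>_def mollify_def f_def using \<rho>(2) by (simp add: integral_nonneg)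
      have "norm (\<eta> x) \<le> 1" unfolding \<eta>_def by (rule norm_mollify_le[OF \<rho> f f1])
      then show "\<eta> x \<le> 1" by simp
    qed
    then show "\<exists>\<eta>. cutoff_function x0 R (sum q UNIV) \<eta>"
      unfolding cutoff_function_def using t one grad0 gr by (intro exI[of _ \<eta>]) auto
  qed
qed

definition outer_product :: "real^'m \<Rightarrow> real^'n \<Rightarrow> real^'n^'m" where
  "outer_product p q = (\<chi> i. (p $ i) *\<^sub>R q)"

lemma norm_outer_product: "norm (outer_product p q) = norm p * norm q"
proof -
  have "norm (outer_product p q) = L2_set (\<lambda>i. norm (p $ i) * norm q) UNIV"
    unfolding norm_vec_def[of "outer_product p q"] by (simp add: outer_product_def)
  then show ?thesis by (simp only: L2_set_left_distrib[OF norm_ge_zero] norm_vec_def[of p])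
qed

lemma continuous_on_outer_product: "continuous_on UNIV (\<lambda>x. outer_product (fst x) (snd x))"
  unfolding outer_product_def
  by (intro continuous_on_vec_lambda continuous_intros)

lemma compact_sobolev_uminus:
  "compact_sobolev K v H \<Longrightarrow> compact_sobolev K (\<lambda>x. - v x) (\<lambda>x. - H x)"
  unfolding compact_sobolev_def by auto

text \<open>The product rule. The identity that defines the weak gradient of \<^term>\<open>U\<close> is applied to the product of
  \<^term>\<open>\<eta>\<close> with a test function on the whole space, which has compact support in \<^term>\<open>D\<close>.\<close>

lemma compact_sobolev_cutoff:
  fixes U :: "real^'n \<Rightarrow> real^'m" and \<eta> :: "real^'n \<Rightarrow> real"
  assumes U: "U \<in> borel_measurable borel" "\<And>x. norm (U x) \<le> M"
    and G: "G \<in> borel_measurable borel" "\<And>x. norm (G x) \<le> M"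
    and weak: "\<And>\<phi> i j. test_function D \<phi> \<Longrightarrow>
      (\<integral>x. U x $ i * partial_deriv j \<phi> x \<partial>lborel) = - (\<integral>x. G x $ i $ j * \<phi> x \<partial>lborel)"
    and \<eta>: "test_function \<Omega> \<eta>" and \<Omega>: "\<Omega> \<subseteq> D"
  shows "\<exists>K\<subseteq>\<Omega>. compact_sobolev K (\<lambda>x. \<eta> x *\<^sub>R U x) (\<lambda>x. \<eta> x *\<^sub>R G x + outer_product (U x) (gradient \<eta> x))"
proof -
  obtain K where K: "compact K" "K \<subseteq> \<Omega>" "\<And>x. x \<notin> K \<Longrightarrow> \<eta> x = 0"
    using \<eta> unfolding test_function_def by blast
  have M0: "M \<ge> 0" using order_trans[OF norm_ge_zero U(2)] .
  have \<eta>K: "test_function K \<eta>" using \<eta> K unfolding test_function_def by blast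
  have gK: "gradient \<eta> x = 0" if "x \<notin> K" for x
    using test_function_partial_deriv[OF \<eta>K] that unfolding test_function_def gradient_def
    by (auto simp: vec_eq_iff)
  have cg: "continuous_on UNIV (gradient \<eta>)"
    unfolding gradient_def[abs_def]
    by (intro continuous_on_vec_lambda test_function_continuous[OF test_function_partial_deriv[OF \<eta>]])
  have [measurable]: "U \<in> borel_measurable borel" "G \<in> borel_measurable borel" "\<eta> \<in> borel_measurable borel"
    "gradient \<eta> \<in> borel_measurable borel"
    using U G test_function_measurable[OF \<eta>] borel_measurable_continuous_onI[OF cg] by auto
  have om[measurable]: "(\<lambda>x. outer_product (U x) (gradient \<eta> x)) \<in> borel_measurable borel"
    by (rule borel_measurable_continuous_Pair[where H = outer_product, OF _ _ continuous_on_outer_product]) measurable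
  obtain B1 where B1: "\<And>x. norm (\<eta> x) \<le> B1" using test_function_bounded[OF \<eta>] by blast
  have "bounded (gradient \<eta> ` K)"
    by (intro compact_imp_bounded compact_continuous_image continuous_on_subset[OF cg] K) simp
  then obtain B2 where "\<And>x. x \<in> K \<Longrightarrow> norm (gradient \<eta> x) \<le> B2"
    unfolding bounded_iff by auto
  then have B2: "norm (gradient \<eta> x) \<le> max B2 0" for x
    using gK[of x] by (cases "x \<in> K") (auto simp: le_max_iff_disj)
  have B0: "B1 \<ge> 0" using order_trans[OF norm_ge_zero B1] .
  have "compact_sobolev K (\<lambda>x. \<eta> x *\<^sub>R U x) (\<lambda>x. \<eta> x *\<^sub>R G x + outer_product (U x) (gradient \<eta> x))"
    unfolding compact_sobolev_def
  proof (intro conjI allI impI)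
    have "norm (\<eta> x *\<^sub>R U x) \<le> B1 * M" "norm (\<eta> x *\<^sub>R G x + outer_product (U x) (gradient \<eta> x)) \<le> B1 * M + M * max B2 0" for x
    proof -
      show "norm (\<eta> x *\<^sub>R U x) \<le> B1 * M"
        unfolding norm_scaleR using B1[of x] U(2)[of x] B0 by (intro mult_mono) auto
      have "norm (\<eta> x *\<^sub>R G x) \<le> B1 * M"
        unfolding norm_scaleR using B1[of x] G(2)[of x] B0 by (intro mult_mono) auto
      moreover have "norm (outer_product (U x) (gradient \<eta> x)) \<le> M * max B2 0"
        unfolding norm_outer_product using U(2)[of x] B2[of x] M0 by (intro mult_mono) auto
      ultimately show "norm (\<eta> x *\<^sub>R G x + outer_product (U x) (gradient \<eta> x)) \<le> B1 * M + M * max B2 0"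
        using norm_triangle_ineq[of "\<eta> x *\<^sub>R G x" "outer_product (U x) (gradient \<eta> x)"] by linarith
    qed
    moreover have "B1 * M \<le> B1 * M + M * max B2 0" using M0 by simp
    ultimately show "\<exists>B. \<forall>x. norm (\<eta> x *\<^sub>R U x) \<le> B \<and> norm (\<eta> x *\<^sub>R G x + outer_product (U x) (gradient \<eta> x)) \<le> B"
      by (meson order_trans)
    fix \<phi> :: "real^'n \<Rightarrow> real" and i j assume \<phi>: "test_function UNIV \<phi>"
    have t: "test_function D (\<lambda>x. \<phi> x * \<eta> x)"
      by (intro test_function_mult test_function_mono[OF \<eta> \<Omega>] test_function_Ck[OF \<phi>])
    have dif: "\<eta> differentiable at x" "\<phi> differentiable at x" for x
      using test_function_has_derivative \<eta> \<phi> by (auto simp: differentiable_def)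
    have p: "partial_deriv j (\<lambda>x. \<phi> x * \<eta> x) x = \<phi> x * partial_deriv j \<eta> x + partial_deriv j \<phi> x * \<eta> x" for x
      by (rule partial_deriv_mult[OF dif])
    have bi: "integrable lborel (\<lambda>x. h x * \<psi> x)" if "test_function D' \<psi>" "h \<in> borel_measurable borel" "\<And>x. \<bar>h x\<bar> \<le> M" for D' \<psi> and h :: "real^'n \<Rightarrow> real"
    proof (rule Bochner_Integration.integrable_bound)
      show "integrable lborel (\<lambda>x. M * \<psi> x)" using test_function_integrable[OF that(1)] by simp
      show "(\<lambda>x. h x * \<psi> x) \<in> borel_measurable lborel" using that test_function_measurable[OF that(1)] by simp
      show "AE x in lborel. norm (h x * \<psi> x) \<le> norm (M * \<psi> x)"
        using that(3) M0 by (intro AE_I2) (simp add: abs_mult mult_right_mono)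
    qed
    have Ui: "\<bar>U x $ i\<bar> \<le> M" for x using order_trans[OF component_le_norm_cart U(2)] .
    have Gij: "\<bar>G x $ i $ j\<bar> \<le> M" for x
      using order_trans[OF component_le_norm_cart order_trans[OF Finite_Cartesian_Product.norm_nth_le G(2)]] .
    have t1: "test_function D (\<lambda>x. partial_deriv j \<phi> x * \<eta> x)"
      by (intro test_function_mult test_function_mono[OF \<eta> \<Omega>] test_function_Ck[OF test_function_partial_deriv[OF \<phi>]])
    have t2: "test_function D (\<lambda>x. \<phi> x * partial_deriv j \<eta> x)"
      by (intro test_function_mult test_function_partial_deriv test_function_mono[OF \<eta> \<Omega>] test_function_Ck[OF \<phi>])
    have i1: "integrable lborel (\<lambda>x. U x $ i * (partial_deriv j \<phi> x * \<eta> x))" by (rule bi[OF t1]) (use Ui in auto)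
    have i2: "integrable lborel (\<lambda>x. U x $ i * (\<phi> x * partial_deriv j \<eta> x))" by (rule bi[OF t2]) (use Ui in auto)
    have i3: "integrable lborel (\<lambda>x. G x $ i $ j * (\<phi> x * \<eta> x))" by (rule bi[OF t]) (use Gij in auto)
    have "(\<integral>x. (\<eta> x *\<^sub>R U x) $ i * partial_deriv j \<phi> x \<partial>lborel) = (\<integral>x. U x $ i * (partial_deriv j \<phi> x * \<eta> x) \<partial>lborel)"
      by (simp add: mult_ac)
    also have "\<dots> = (\<integral>x. U x $ i * partial_deriv j (\<lambda>x. \<phi> x * \<eta> x) x \<partial>lborel) - (\<integral>x. U x $ i * (\<phi> x * partial_deriv j \<eta> x) \<partial>lborel)"
      unfolding p distrib_left using i1 i2 by simp
    also have "(\<integral>x. U x $ i * partial_deriv j (\<lambda>x. \<phi> x * \<eta> x) x \<partial>lborel) = - (\<integral>x. G x $ i $ j * (\<phi> x * \<eta> x) \<partial>lborel)"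
      by (rule weak[OF t])
    also have "- (\<integral>x. G x $ i $ j * (\<phi> x * \<eta> x) \<partial>lborel) - (\<integral>x. U x $ i * (\<phi> x * partial_deriv j \<eta> x) \<partial>lborel) =
        - (\<integral>x. G x $ i $ j * (\<phi> x * \<eta> x) + U x $ i * (\<phi> x * partial_deriv j \<eta> x) \<partial>lborel)"
      using i2 i3 by simp
    also have "\<dots> = - (\<integral>x. (\<eta> x *\<^sub>R G x + outer_product (U x) (gradient \<eta> x)) $ i $ j * \<phi> x \<partial>lborel)"
      by (simp add: outer_product_def gradient_def algebra_simps)
    finally show "(\<integral>x. (\<eta> x *\<^sub>R U x) $ i * partial_deriv j \<phi> x \<partial>lborel) =
        - (\<integral>x. (\<eta> x *\<^sub>R G x + outer_product (U x) (gradient \<eta> x)) $ i $ j * \<phi> x \<partial>lborel)" .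
  next
    show "(\<lambda>x. \<eta> x *\<^sub>R G x + outer_product (U x) (gradient \<eta> x)) \<in> borel_measurable borel" by measurable
  next
    fix x assume "x \<notin> K"
    then show "\<eta> x *\<^sub>R U x = 0" "\<eta> x *\<^sub>R G x + outer_product (U x) (gradient \<eta> x) = 0"
      using K(3)[of x] gK[of x] by (auto simp: outer_product_def vec_eq_iff)
  qed (use K in auto)
  then show ?thesis using K(2) by blast
qed

section \<open>Energy and volume of a minimizer in balls\<close>

text \<open>Here \<^term>\<open>U\<close> stands for $u - a$ and \<^term>\<open>G\<close> for its gradient, and \<^term>\<open>2 * s\<close> is a radius within which the
  potential grows at least quadratically and increases along rays from \<^term>\<open>a\<close>.\<close>

locale minimizer_near_zero =
  fixes W :: "real^'m \<Rightarrow> real" and a :: "real^'m" and M c0 s KW Q :: real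
    and D :: "(real^'n) set" and U :: "real^'n \<Rightarrow> real^'m" and G :: "real^'n \<Rightarrow> real^'n^'m"
  assumes W_continuous: "continuous_on UNIV W" and W_nonneg: "\<And>z. 0 \<le> W z" and W_zero: "W a = 0"
    and pos: "M > 0" "c0 > 0" "s > 0" "Q \<ge> 0"
    and growth: "\<And>y. norm y \<le> 2 * s \<Longrightarrow> c0 * (norm y)\<^sup>2 \<le> W (a + y)"
    and radial: "\<And>y t. norm y \<le> 2 * s \<Longrightarrow> 0 \<le> t \<Longrightarrow> t \<le> 1 \<Longrightarrow> W (a + t *\<^sub>R y) \<le> W (a + y)"
    and W_bound: "\<And>y. norm y \<le> M \<Longrightarrow> W (a + y) \<le> KW"
    and cutoff: "\<And>(x0 :: real^'n) R. R > 0 \<Longrightarrow> \<exists>\<eta>. cutoff_function x0 R Q \<eta>"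
    and U_measurable [measurable]: "U \<in> borel_measurable borel"
    and G_measurable [measurable]: "G \<in> borel_measurable borel"
    and U_bound: "\<And>x. norm (U x) \<le> M" and G_bound: "\<And>x. norm (G x) \<le> M"
    and weak: "\<And>\<phi> i j. test_function D \<phi> \<Longrightarrow>
      (\<integral>x. U x $ i * partial_deriv j \<phi> x \<partial>lborel) = - (\<integral>x. G x $ i $ j * \<phi> x \<partial>lborel)"
    and minimal: "minimal_pair W a D U G"
begin

definition energy_density :: "real^'n \<Rightarrow> real" where
  "energy_density x = 1/2 * (norm (G x))\<^sup>2 + W (a + U x)"

definition energy_in :: "(real^'n) set \<Rightarrow> real" where
  "energy_in A = (\<integral>x. indicator A x * energy_density x \<partial>lborel)"

definition volume_in :: "(real^'n) set \<Rightarrow> real" where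
  "volume_in A = measure lborel (A \<inter> {x. norm (U x) > 2 * s})"

definition mass_in :: "(real^'n) set \<Rightarrow> real" where
  "mass_in A = energy_in A + volume_in A"

text \<open>The names refer to the comparison of energies, to the bound of the volume of the transition layer by
  the energy, to the bound of the density of the mass, and to the isoperimetric step. The constants do not
  depend on \<^term>\<open>D\<close>, \<^term>\<open>U\<close> and \<^term>\<open>G\<close>, so that one choice serves all minimizers.\<close>

definition C_cmp :: real where
  "C_cmp = 2 + Q\<^sup>2 / c0 + M\<^sup>2 + M\<^sup>2 * Q\<^sup>2 + KW"

definition C_layer :: real where
  "C_layer = 1 / (c0 * s\<^sup>2)"

definition C_dens :: real where
  "C_dens = M\<^sup>2 / 2 + KW + 1"

definition C_iso :: real where
  "C_iso = 2 * ((M + M * Q) / s) * (C_layer * C_cmp + 1)"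

lemma KW_nonneg: "KW \<ge> 0"
  using W_bound[of 0] pos W_zero by simp

lemma energy_density_measurable [measurable]: "energy_density \<in> borel_measurable borel"
proof -
  have "W \<in> borel_measurable borel" by (rule borel_measurable_continuous_onI[OF W_continuous])
  then show ?thesis unfolding energy_density_def[abs_def] by measurable
qed

lemma energy_density_nonneg: "0 \<le> energy_density x"
  unfolding energy_density_def using W_nonneg by simp

lemma energy_density_le: "energy_density x \<le> M\<^sup>2 / 2 + KW"
  unfolding energy_density_def
  using W_bound[OF U_bound, of x] power_mono[OF G_bound norm_ge_zero, of x 2] by simp

lemma integrable_energy:
  assumes [measurable]: "A \<in> sets borel" and "bounded A"
  shows "integrable lborel (\<lambda>x. indicator A x * energy_density x)"
proof (rule integrable_bounded_support[of _ "M\<^sup>2 / 2 + KW" A])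
  show "norm (indicator A x * energy_density x) \<le> M\<^sup>2 / 2 + KW" for x
    using energy_density_nonneg[of x] energy_density_le[of x] by (auto simp: indicator_def)
qed (use assms in auto)

lemma integrable_indicator_bounded:
  fixes A :: "(real^'n) set"
  assumes [measurable]: "A \<in> sets borel" and "bounded A"
  shows "integrable lborel (indicator A :: _ \<Rightarrow> real)"
  by (rule integrable_bounded_support[of _ 1 A]) (use assms in \<open>auto simp: indicator_def\<close>)

lemma energy_in_nonneg: "0 \<le> energy_in A"
  unfolding energy_in_def using energy_density_nonneg by (auto intro!: integral_nonneg)

lemma volume_in_nonneg: "0 \<le> volume_in A"
  unfolding volume_in_def by simp

lemma energy_in_mono:
  assumes "A \<in> sets borel" "B \<in> sets borel" "bounded B" "A \<subseteq> B"
  shows "energy_in A \<le> energy_in B"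
  unfolding energy_in_def
proof (rule integral_mono)
  show "integrable lborel (\<lambda>x. indicator A x * energy_density x)"
    "integrable lborel (\<lambda>x. indicator B x * energy_density x)"
    using assms by (auto intro!: integrable_energy intro: bounded_subset)
  show "indicator A x * energy_density x \<le> indicator B x * energy_density x" for x
    using assms(4) energy_density_nonneg[of x] by (auto simp: indicator_def)
qed

lemma mass_in_eq:
  assumes [measurable]: "A \<in> sets borel" and "bounded A"
  shows "mass_in A = (\<integral>x. indicator A x * (energy_density x + indicator {x. norm (U x) > 2 * s} x) \<partial>lborel)"
    "integrable lborel (\<lambda>x. indicator A x * (energy_density x + indicator {x. norm (U x) > 2 * s} x))"
proof -
  have [measurable]: "{x. norm (U x) > 2 * s} \<in> sets borel" by measurable
  have i: "integrable lborel (indicator (A \<inter> {x. norm (U x) > 2 * s}) :: _ \<Rightarrow> real)"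
    using assms(2) by (intro integrable_indicator_bounded) (auto intro: bounded_subset)
  have eq: "indicator A x * (energy_density x + indicator {x. norm (U x) > 2 * s} x) =
      indicator A x * energy_density x + indicator (A \<inter> {x. norm (U x) > 2 * s}) x" for x
    by (auto simp: indicator_def)
  show "mass_in A = (\<integral>x. indicator A x * (energy_density x + indicator {x. norm (U x) > 2 * s} x) \<partial>lborel)"
    "integrable lborel (\<lambda>x. indicator A x * (energy_density x + indicator {x. norm (U x) > 2 * s} x))"
    unfolding eq mass_in_def energy_in_def volume_in_def
    using i integrable_energy[OF assms] by (simp_all del: indicator_inter_arith)
qed

lemma mass_in_diff:
  assumes "A \<in> sets borel" "B \<in> sets borel" "bounded B" "A \<subseteq> B"
  shows "mass_in (B - A) = mass_in B - mass_in A"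
proof -
  have bA: "bounded A" and bd: "bounded (B - A)" using assms bounded_subset by blast+
  have "mass_in B - mass_in A = (\<integral>x. indicator B x * (energy_density x + indicator {x. norm (U x) > 2 * s} x) -
      indicator A x * (energy_density x + indicator {x. norm (U x) > 2 * s} x) \<partial>lborel)"
    using assms bA by (subst Bochner_Integration.integral_diff) (auto simp: mass_in_eq intro!: mass_in_eq(2))
  also have "\<dots> = mass_in (B - A)"
    using assms bd by (subst mass_in_eq) (auto intro!: Bochner_Integration.integral_cong simp: indicator_def)
  finally show ?thesis ..
qed

lemma mass_in_le:
  assumes [measurable]: "A \<in> sets borel" and "bounded A"
  shows "mass_in A \<le> C_dens * measure lborel A"
proof -
  have "mass_in A \<le> (\<integral>x. C_dens * indicator A x \<partial>lborel)"
    unfolding mass_in_eq(1)[OF assms]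
  proof (rule integral_mono[OF mass_in_eq(2)[OF assms]])
    show "integrable lborel (\<lambda>x. C_dens * indicator A x)"
      using integrable_indicator_bounded[OF assms] by simp
    show "indicator A x * (energy_density x + indicator {x. norm (U x) > 2 * s} x) \<le> C_dens * indicator A x" for x
      using energy_density_le[of x] unfolding C_dens_def by (auto simp: indicator_def)
  qed
  then show ?thesis by simp
qed

text \<open>In the transition layer the potential is at least \<^term>\<open>c0 * s\<^sup>2\<close>, by quadratic growth.\<close>

lemma layer_volume_le:
  assumes [measurable]: "A \<in> sets borel" and "bounded A"
  shows "measure lborel (A \<inter> {x. s < norm (U x) \<and> norm (U x) \<le> 2 * s}) \<le> C_layer * energy_in A"
proof -
  let ?T = "A \<inter> {x. s < norm (U x) \<and> norm (U x) \<le> 2 * s}"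
  have T[measurable]: "?T \<in> sets borel" by measurable
  have iT: "integrable lborel (indicator ?T :: _ \<Rightarrow> real)"
    using assms(2) by (intro integrable_indicator_bounded T) (auto intro: bounded_subset)
  have "(\<integral>x. c0 * s\<^sup>2 * indicator ?T x \<partial>lborel) \<le> energy_in A"
    unfolding energy_in_def
  proof (rule integral_mono[OF _ integrable_energy[OF assms]])
    show "integrable lborel (\<lambda>x. c0 * s\<^sup>2 * indicator ?T x)" using iT by simp
    fix x
    show "c0 * s\<^sup>2 * indicator ?T x \<le> indicator A x * energy_density x"
    proof (cases "x \<in> ?T")
      case True
      then have "c0 * s\<^sup>2 \<le> c0 * (norm (U x))\<^sup>2"
        using pos by (intro mult_left_mono power_mono) auto
      also have "\<dots> \<le> W (a + U x)" using True by (intro growth) auto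
      also have "\<dots> \<le> energy_density x" unfolding energy_density_def by simp
      finally show ?thesis using True by (simp add: indicator_def)
    next
      case False
      then have "indicator ?T x = (0::real)" by (simp add: indicator_def)
      then show ?thesis using energy_density_nonneg[of x] by simp
    qed
  qed
  then have "(c0 * s\<^sup>2) * measure lborel ?T \<le> energy_in A" by simp
  then show ?thesis using pos unfolding C_layer_def by (simp add: field_simps)
qed

text \<open>The competitor equals \<^term>\<open>a\<close> in the small ball, hence has no energy there. In the annulus, where
  the minimizer is close to \<^term>\<open>a\<close> its energy is comparable to that of the minimizer, because scaling
  towards \<^term>\<open>a\<close> decreases the potential and the potential controls the squared distance; elsewhere
  it is bounded.\<close>

lemma energy_comparison:
  assumes R: "R > 0" and sub: "ball x0 (R + 1) \<subseteq> D"
  shows "energy_in (ball x0 (R + 1)) \<le> C_cmp * mass_in (ball x0 (R + 1) - ball x0 R)"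
proof -
  let ?B = "ball x0 R" and ?B' = "ball x0 (R + 1)"
  let ?A = "?B' - ?B"
  have [measurable]: "?A \<in> sets borel" "?B' \<in> sets borel" by auto
  have bA: "bounded ?A" by (rule bounded_subset[OF bounded_ball]) auto
  obtain \<eta> where \<eta>: "test_function ?B' \<eta>" "\<And>x. 0 \<le> \<eta> x" "\<And>x. \<eta> x \<le> 1"
    "\<And>x. x \<in> ?B \<Longrightarrow> \<eta> x = 1" "\<And>x. x \<in> ?B \<Longrightarrow> gradient \<eta> x = 0" "\<And>x. norm (gradient \<eta> x) \<le> Q"
    using cutoff[OF R, of x0] unfolding cutoff_function_def by blast
  let ?H = "\<lambda>x. \<eta> x *\<^sub>R G x + outer_product (U x) (gradient \<eta> x)"
  obtain K where K: "K \<subseteq> ?B'" "compact_sobolev K (\<lambda>x. \<eta> x *\<^sub>R U x) ?H"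
    using compact_sobolev_cutoff[OF U_measurable U_bound G_measurable G_bound weak \<eta>(1) sub] by blast
  let ?f = "\<lambda>x. energy_density x + indicator {x. norm (U x) > 2 * s} x"
  have C0: "C_cmp \<ge> 0" unfolding C_cmp_def using pos KW_nonneg by (intro add_nonneg_nonneg) auto
  have le: "1/2 * (norm (G x + - ?H x))\<^sup>2 + W (a + (U x + - (\<eta> x *\<^sub>R U x))) \<le> C_cmp * (indicator ?A x * ?f x)"
    if x: "x \<in> ?B'" for x
  proof (cases "x \<in> ?B")
    case True
    have "?H x = G x" using \<eta>(4,5)[OF True] by (simp add: outer_product_def vec_eq_iff)
    then show ?thesis using True \<eta>(4)[OF True] W_zero by simp
  next
    case False
    then have xA: "indicator ?A x = (1::real)" using x by simp
    define t where "t = 1 - \<eta> x"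
    have t: "0 \<le> t" "t \<le> 1" using \<eta>(2,3)[of x] by (auto simp: t_def)
    have Ut: "U x + - (\<eta> x *\<^sub>R U x) = t *\<^sub>R U x" by (simp add: t_def algebra_simps)
    have Gt: "G x + - ?H x = t *\<^sub>R G x - outer_product (U x) (gradient \<eta> x)" by (simp add: t_def algebra_simps)
    have n1: "norm (t *\<^sub>R G x) \<le> norm (G x)" using t by (simp add: mult_left_le_one_le)
    have n2: "norm (outer_product (U x) (gradient \<eta> x)) \<le> norm (U x) * Q"
      unfolding norm_outer_product by (intro mult_left_mono \<eta>(6)) auto
    have "norm (G x + - ?H x) \<le> norm (G x) + norm (U x) * Q"
      unfolding Gt using norm_triangle_ineq4[of "t *\<^sub>R G x" "outer_product (U x) (gradient \<eta> x)"] n1 n2 by linarith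
    then have "(norm (G x + - ?H x))\<^sup>2 \<le> (norm (G x) + norm (U x) * Q)\<^sup>2"
      by (intro power_mono) auto
    also have "\<dots> \<le> 2 * (norm (G x))\<^sup>2 + 2 * (norm (U x) * Q)\<^sup>2"
      using zero_le_power2[of "norm (G x) - norm (U x) * Q"] by (simp add: power2_eq_square algebra_simps)
    finally have sq: "1/2 * (norm (G x + - ?H x))\<^sup>2 \<le> (norm (G x))\<^sup>2 + (norm (U x))\<^sup>2 * Q\<^sup>2"
      by (simp add: power_mult_distrib)
    have e0: "0 \<le> energy_density x" by (rule energy_density_nonneg)
    have Q0: "Q\<^sup>2 / c0 \<ge> 0" using pos by simp
    show ?thesis
    proof (cases "norm (U x) \<le> 2 * s")
      case True
      have Wt: "W (a + t *\<^sub>R U x) \<le> W (a + U x)" by (rule radial[OF True t])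
      have "(norm (U x))\<^sup>2 \<le> W (a + U x) / c0" using growth[OF True] pos by (simp add: field_simps)
      then have "(norm (U x))\<^sup>2 * Q\<^sup>2 \<le> W (a + U x) / c0 * Q\<^sup>2" by (rule mult_right_mono) simp
      also have "\<dots> = Q\<^sup>2 / c0 * W (a + U x)" by simp
      finally have "1/2 * (norm (G x + - ?H x))\<^sup>2 + W (a + t *\<^sub>R U x) \<le>
          2 * (1/2 * (norm (G x))\<^sup>2) + Q\<^sup>2 / c0 * W (a + U x) + W (a + U x)"
        using sq Wt by linarith
      also have "\<dots> \<le> (2 + Q\<^sup>2 / c0) * energy_density x"
      proof -
        have "2 * h + q * w + w \<le> (2 + q) * (h + w)" if "0 \<le> q * h" "0 \<le> w" for q h w :: real
          using that by (simp add: algebra_simps)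
        then show ?thesis
          unfolding energy_density_def using Q0 W_nonneg by (simp only: mult_nonneg_nonneg zero_le_power2 zero_le_divide_1_iff zero_le_numeral)
      qed
      also have "\<dots> \<le> C_cmp * energy_density x"
        using e0 KW_nonneg unfolding C_cmp_def by (intro mult_right_mono) auto
      finally show ?thesis using True unfolding Ut xA by (simp add: indicator_def)
    next
      case False
      have "norm (t *\<^sub>R U x) \<le> M" using t U_bound[of x] pos(1)
        by (simp add: mult_le_one) (meson mult_left_le_one_le norm_ge_zero order_trans)
      then have "W (a + t *\<^sub>R U x) \<le> KW" by (rule W_bound)
      moreover have "(norm (G x))\<^sup>2 \<le> M\<^sup>2" "(norm (U x))\<^sup>2 \<le> M\<^sup>2"
        using G_bound[of x] U_bound[of x] by (auto intro: power_mono)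
      moreover from this(2) have "(norm (U x))\<^sup>2 * Q\<^sup>2 \<le> M\<^sup>2 * Q\<^sup>2" by (rule mult_right_mono) simp
      ultimately have "1/2 * (norm (G x + - ?H x))\<^sup>2 + W (a + t *\<^sub>R U x) \<le> M\<^sup>2 + M\<^sup>2 * Q\<^sup>2 + KW"
        using sq by linarith
      also have "\<dots> \<le> C_cmp * 1" using Q0 unfolding C_cmp_def by simp
      also have "\<dots> \<le> C_cmp * ?f x" using False e0 C0 by (intro mult_left_mono) (auto simp: indicator_def)
      finally show ?thesis unfolding Ut xA by simp
    qed
  qed
  have mf: "integrable lborel (\<lambda>x. C_cmp * (indicator ?A x * ?f x))"
    using mass_in_eq(2)[of ?A] bA by (intro integrable_mult_right) auto
  have f0: "0 \<le> ?f x" for x using energy_density_nonneg[of x] by simp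
  have "ennreal (energy_in ?B') = (\<integral>\<^sup>+x. ennreal (indicator ?B' x * energy_density x) \<partial>lborel)"
    unfolding energy_in_def using energy_density_nonneg
    by (intro nn_integral_eq_integral[symmetric] integrable_energy) auto
  also have "\<dots> = (\<integral>\<^sup>+x. ennreal (1/2 * (norm (G x))\<^sup>2 + W (a + U x)) * indicator ?B' x \<partial>lborel)"
    by (intro nn_integral_cong) (auto simp: indicator_def energy_density_def)
  also have "\<dots> \<le> (\<integral>\<^sup>+x. ennreal (1/2 * (norm (G x + - ?H x))\<^sup>2 + W (a + (U x + - (\<eta> x *\<^sub>R U x)))) * indicator ?B' x \<partial>lborel)"
    by (rule minimal[unfolded minimal_pair_def, rule_format, OF conjI[OF open_ball conjI[OF bounded_ball
          conjI[OF sub conjI[OF compact_sobolev_uminus[OF K(2)] K(1)]]]]])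
  also have "\<dots> \<le> (\<integral>\<^sup>+x. ennreal (C_cmp * (indicator ?A x * ?f x)) \<partial>lborel)"
  proof (rule nn_integral_mono)
    fix x
    show "ennreal (1/2 * (norm (G x + - ?H x))\<^sup>2 + W (a + (U x + - (\<eta> x *\<^sub>R U x)))) * indicator ?B' x
        \<le> ennreal (C_cmp * (indicator ?A x * ?f x))"
    proof (cases "x \<in> ?B'")
      case True
      then show ?thesis using ennreal_leI[OF le[OF True]] by simp
    qed simp
  qed
  also have "\<dots> = ennreal (\<integral>x. C_cmp * (indicator ?A x * ?f x) \<partial>lborel)"
    using C0 f0 by (intro nn_integral_eq_integral mf) auto
  also have "(\<integral>x. C_cmp * (indicator ?A x * ?f x) \<partial>lborel) = C_cmp * mass_in ?A"
    using mass_in_eq(1)[of ?A] bA by simp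
  finally have "ennreal (energy_in ?B') \<le> ennreal (C_cmp * mass_in ?A)" .
  moreover have "0 \<le> C_cmp * mass_in ?A"
    using C0 energy_in_nonneg volume_in_nonneg unfolding mass_in_def by simp
  ultimately show ?thesis by simp
qed

lemma measure_mono_AE:
  fixes A B :: "(real^'n) set"
  assumes "A \<in> sets borel" "B \<in> sets borel" "bounded B" "AE x in lborel. x \<in> A \<longrightarrow> x \<in> B"
  shows "measure lborel A \<le> measure lborel B" "emeasure lborel A < \<infinity>"
proof -
  have fB: "emeasure lborel B < \<infinity>" by (rule emeasure_bounded_finite[OF assms(3)])
  have "emeasure lborel A \<le> emeasure lborel B"
    using assms by (intro emeasure_mono_AE) auto
  then show "emeasure lborel A < \<infinity>" "measure lborel A \<le> measure lborel B"
    using fB by (auto simp: measure_def intro!: enn2real_mono)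
qed

text \<open>The isoperimetric inequality is applied to the norm of the Lipschitz representative of the cut-off
  minimizer. Its transition layer consists of points of the annulus and of points where the
  potential is bounded below, so that its volume is controlled by the energy.\<close>

lemma volume_growth_step:
  assumes R: "R > 0" and sub: "ball x0 (R + 1) \<subseteq> D" and r: "r > 0"
    and vol: "2 * ((C_layer + 1) * mass_in (ball x0 (R + 1))) \<le> measure lborel (ball (0::real^'n) r)"
  shows "volume_in (ball x0 R) \<le> C_iso * r * mass_in (ball x0 (R + 1) - ball x0 R)"
proof -
  let ?B = "ball x0 R" and ?B' = "ball x0 (R + 1)"
  let ?A = "?B' - ?B"
  let ?L = "M + M * Q"
  have [measurable]: "?A \<in> sets borel" "?B' \<in> sets borel" "?B \<in> sets borel" by auto
  have L: "?L > 0" using pos by (simp add: add_pos_nonneg)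
  have cl: "C_layer \<ge> 0" unfolding C_layer_def using pos by simp
  obtain \<eta> where \<eta>: "test_function ?B' \<eta>" "\<And>x. 0 \<le> \<eta> x" "\<And>x. \<eta> x \<le> 1"
    "\<And>x. x \<in> ?B \<Longrightarrow> \<eta> x = 1" "\<And>x. norm (gradient \<eta> x) \<le> Q"
    using cutoff[OF R, of x0] unfolding cutoff_function_def by blast
  have \<eta>0: "\<eta> x = 0" if "x \<notin> ?B'" for x using \<eta>(1) that unfolding test_function_def by blast
  let ?v = "\<lambda>x. \<eta> x *\<^sub>R U x" and ?H = "\<lambda>x. \<eta> x *\<^sub>R G x + outer_product (U x) (gradient \<eta> x)"
  obtain K where K: "K \<subseteq> ?B'" "compact_sobolev K ?v ?H"
    using compact_sobolev_cutoff[OF U_measurable U_bound G_measurable G_bound weak \<eta>(1) sub] by blast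
  have "norm (?H x) \<le> ?L" for x
  proof -
    have "norm (\<eta> x *\<^sub>R G x) \<le> 1 * M"
      unfolding norm_scaleR using \<eta>(2,3)[of x] G_bound[of x] by (intro mult_mono) auto
    moreover have "norm (outer_product (U x) (gradient \<eta> x)) \<le> M * Q"
      unfolding norm_outer_product using \<eta>(5)[of x] U_bound[of x] pos by (intro mult_mono) auto
    ultimately show ?thesis
      using norm_triangle_ineq[of "\<eta> x *\<^sub>R G x" "outer_product (U x) (gradient \<eta> x)"] by linarith
  qed
  from compact_sobolev_lipschitz[OF K(2) this] obtain w
    where w: "?L-lipschitz_on UNIV w" "AE x in lborel. ?v x = w x" by blast
  define g where "g = (\<lambda>x. norm (w x))"
  have g: "?L-lipschitz_on UNIV g"
  proof (rule lipschitz_onI)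
    fix x y
    have "dist (g x) (g y) \<le> dist (w x) (w y)"
      unfolding g_def dist_norm real_norm_def by (rule norm_triangle_ineq3)
    then show "dist (g x) (g y) \<le> ?L * dist x y" using lipschitz_onD[OF w(1), of x y] by simp
  qed (use L in simp)
  have [measurable]: "g \<in> borel_measurable borel"
    by (rule borel_measurable_continuous_onI[OF lipschitz_on_continuous_on[OF g]])
  have gU: "AE x in lborel. g x = \<eta> x * norm (U x)"
    using w(2)
  proof eventually_elim
    case (elim x)
    have "g x = norm (\<eta> x *\<^sub>R U x)" unfolding g_def elim ..
    then show ?case using \<eta>(2)[of x] by simp
  qed
  let ?big = "{x. norm (U x) > 2 * s}" and ?layer = "{x. s < norm (U x) \<and> norm (U x) \<le> 2 * s}"
  have [measurable]: "?big \<in> sets borel" "?layer \<in> sets borel" by measurable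
  have bd: "bounded (?B' \<inter> S)" "bounded (?A \<inter> S)" for S
    by (auto intro: bounded_subset[OF bounded_ball[of x0 "R + 1"]])
  have up: "\<eta> x * norm (U x) \<le> norm (U x)" for x using \<eta>(2,3)[of x] by (simp add: mult_left_le_one_le)
  have S: "measure lborel {x. g x > s} \<le> measure lborel (?B' \<inter> ?layer \<union> ?B' \<inter> ?big)"
    and fin: "emeasure lborel {x. g x > s} < \<infinity>"
  proof -
    have ae: "AE x in lborel. x \<in> {x. g x > s} \<longrightarrow> x \<in> ?B' \<inter> ?layer \<union> ?B' \<inter> ?big"
      using gU
    proof eventually_elim
      case (elim x)
      show ?case
      proof
        assume "x \<in> {x. g x > s}"
        then have gt: "\<eta> x * norm (U x) > s" using elim by simp
        then have "x \<in> ?B'" using \<eta>0[of x] pos by (cases "x \<in> ?B'") auto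
        moreover have "norm (U x) > s" using gt up[of x] by linarith
        ultimately show "x \<in> ?B' \<inter> ?layer \<union> ?B' \<inter> ?big" by auto
      qed
    qed
    have "bounded (?B' \<inter> ?layer \<union> ?B' \<inter> ?big)" using bd by simp
    from measure_mono_AE[OF _ _ this ae]
    show "measure lborel {x. g x > s} \<le> measure lborel (?B' \<inter> ?layer \<union> ?B' \<inter> ?big)" "emeasure lborel {x. g x > s} < \<infinity>"
      by measurable
  qed
  have fm: "?B' \<inter> ?layer \<in> fmeasurable lborel" "?B' \<inter> ?big \<in> fmeasurable lborel" "?A \<inter> ?big \<in> fmeasurable lborel"
    using bd by (auto intro!: fmeasurableI emeasure_bounded_finite)
  have "measure lborel (?B' \<inter> ?layer \<union> ?B' \<inter> ?big) \<le> measure lborel (?B' \<inter> ?layer) + measure lborel (?B' \<inter> ?big)"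
    using fm by (intro measure_Un_le) auto
  also have "\<dots> \<le> C_layer * energy_in ?B' + volume_in ?B'"
    unfolding volume_in_def by (intro add_right_mono layer_volume_le) auto
  also have "\<dots> \<le> (C_layer + 1) * mass_in ?B'"
    using cl energy_in_nonneg[of ?B'] volume_in_nonneg[of ?B'] unfolding mass_in_def by (simp add: algebra_simps)
  finally have "2 * measure lborel {x. g x > s} \<le> measure lborel (ball (0::real^'n) r)"
    using S vol by linarith
  from transition_layer_isoperimetric[OF g L pos(3) r fin this]
  have iso: "measure lborel {x. g x > 2 * s} \<le> 2 * r * (?L / s) * measure lborel {x. s < g x \<and> g x \<le> 2 * s}" .
  have "measure lborel {x. s < g x \<and> g x \<le> 2 * s} \<le> measure lborel (?B' \<inter> ?layer \<union> ?A \<inter> ?big)"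
  proof (rule measure_mono_AE(1))
    show "AE x in lborel. x \<in> {x. s < g x \<and> g x \<le> 2 * s} \<longrightarrow> x \<in> ?B' \<inter> ?layer \<union> ?A \<inter> ?big"
      using gU
    proof eventually_elim
      case (elim x)
      show ?case
      proof
        assume "x \<in> {x. s < g x \<and> g x \<le> 2 * s}"
        then have gt: "\<eta> x * norm (U x) > s" "\<eta> x * norm (U x) \<le> 2 * s" using elim by auto
        then have "x \<in> ?B'" using \<eta>0[of x] pos by (cases "x \<in> ?B'") auto
        moreover have "norm (U x) > s" using gt up[of x] by linarith
        moreover have "norm (U x) \<le> 2 * s" if "x \<in> ?B" using \<eta>(4)[OF that] gt(2) by simp
        ultimately show "x \<in> ?B' \<inter> ?layer \<union> ?A \<inter> ?big" by auto
      qed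
    qed
    show "bounded (?B' \<inter> ?layer \<union> ?A \<inter> ?big)" using bd by simp
  qed measurable
  also have "\<dots> \<le> measure lborel (?B' \<inter> ?layer) + measure lborel (?A \<inter> ?big)"
    using fm by (intro measure_Un_le) auto
  also have "\<dots> \<le> C_layer * energy_in ?B' + volume_in ?A"
    unfolding volume_in_def by (intro add_right_mono layer_volume_le) auto
  also have "\<dots> \<le> C_layer * (C_cmp * mass_in ?A) + mass_in ?A"
    using energy_in_nonneg[of ?A] cl unfolding mass_in_def[of ?A]
    by (intro add_mono mult_left_mono energy_comparison[OF R sub, unfolded mass_in_def[of ?A]]) auto
  finally have T: "measure lborel {x. s < g x \<and> g x \<le> 2 * s} \<le> (C_layer * C_cmp + 1) * mass_in ?A"
    by (simp add: algebra_simps)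
  have "volume_in ?B \<le> measure lborel {x. g x > 2 * s}"
  proof -
    have "emeasure lborel {x. g x > 2 * s} \<le> emeasure lborel {x. g x > s}"
      using pos by (intro emeasure_mono) auto
    then have fA: "emeasure lborel {x. g x > 2 * s} < \<infinity>" using fin by (rule order_le_less_trans)
    have "emeasure lborel (?B \<inter> ?big) \<le> emeasure lborel {x. g x > 2 * s}"
    proof (rule emeasure_mono_AE)
      show "AE x in lborel. x \<in> ?B \<inter> ?big \<longrightarrow> x \<in> {x. g x > 2 * s}"
        using gU by eventually_elim (use \<eta>(4) in auto)
    qed measurable
    then show ?thesis
      unfolding volume_in_def measure_def using fA by (intro enn2real_mono) auto
  qed
  also have "\<dots> \<le> 2 * r * (?L / s) * ((C_layer * C_cmp + 1) * mass_in ?A)"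
    using L r pos by (intro order_trans[OF iso mult_left_mono[OF T]]) auto
  also have "\<dots> = C_iso * r * mass_in ?A" unfolding C_iso_def by simp
  finally show ?thesis .
qed

end

section \<open>Growth of the mass\<close>

lemma power_diff_le:
  fixes x :: real
  assumes "x \<ge> 0" "n \<ge> 1"
  shows "(x + 1) ^ n - x ^ n \<le> real n * (x + 1) ^ (n - 1)"
proof -
  have "(x + 1) ^ n - x ^ n = (\<Sum>i<n. x ^ (n - Suc i) * (x + 1) ^ i)"
    by (subst power_diff_sumr2) simp
  also have "\<dots> \<le> (\<Sum>i<n. (x + 1) ^ (n - 1))"
  proof (rule sum_mono)
    fix i assume "i \<in> {..<n}"
    then have "i < n" by simp
    have "x ^ (n - Suc i) * (x + 1) ^ i \<le> (x + 1) ^ (n - Suc i) * (x + 1) ^ i"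
      using assms(1) by (intro mult_right_mono power_mono) auto
    also have "\<dots> = (x + 1) ^ (n - 1)"
      using \<open>i < n\<close> by (simp flip: power_add)
    finally show "x ^ (n - Suc i) * (x + 1) ^ i \<le> (x + 1) ^ (n - 1)" .
  qed
  finally show ?thesis by simp
qed

text \<open>If \<^term>\<open>F (k + 1)\<close> were smaller than \<^term>\<open>c * (k + 1) ^ n\<close>, the hypothesis could be applied with a
  radius \<^term>\<open>r\<close> that is a small multiple of \<^term>\<open>k + 1\<close>, and \<^term>\<open>F k\<close> would be at most a small
  multiple of \<^term>\<open>k\<close> times the increment, which is at most a multiple of \<^term>\<open>c * k ^ (n - 1)\<close>.\<close>

lemma growth_iteration:
  fixes A B C \<omega> \<mu> :: real and n :: nat
  assumes n: "n \<ge> 1" and pos: "A > 0" "B > 0" "C > 0" "\<omega> > 0" "\<mu> > 0"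
  shows "\<exists>c>0. \<exists>k0\<ge>1. \<forall>F N. F k0 \<ge> \<mu> \<longrightarrow>
    (\<forall>k r. k \<ge> k0 \<and> k + 1 \<le> N \<and> r > 0 \<and> 2 * (C * F (k + 1)) \<le> \<omega> * r ^ n \<longrightarrow>
      F k \<le> (A + B * r) * (F (k + 1) - F k)) \<longrightarrow>
    (\<forall>k. k0 \<le> k \<and> k \<le> N \<longrightarrow> F k \<ge> c * real k ^ n)"
proof -
  define \<theta> where "\<theta> = 1 / (real n * 2 ^ (n + 1) * B)"
  have \<theta>: "\<theta> > 0" using n pos by (simp add: \<theta>_def)
  define k0 where "k0 = Suc (nat \<lceil>real n * 2 ^ n * A\<rceil>)"
  have k0: "k0 \<ge> 1" "real n * 2 ^ n * A < real k0"
    unfolding k0_def by (simp, linarith)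
  define c where "c = min (\<omega> * \<theta> ^ n / (2 * C)) (\<mu> / real k0 ^ n)"
  have c: "c > 0" unfolding c_def using pos \<theta> k0 by simp
  have c1: "2 * (C * c) \<le> \<omega> * \<theta> ^ n"
  proof -
    have "c \<le> \<omega> * \<theta> ^ n / (2 * C)" by (simp add: c_def)
    then show ?thesis using pos by (simp add: field_simps)
  qed
  have c2: "c * real k0 ^ n \<le> \<mu>"
  proof -
    have "c \<le> \<mu> / real k0 ^ n" by (simp add: c_def)
    then show ?thesis using k0 by (simp add: field_simps)
  qed
  show ?thesis
  proof (intro exI[of _ c] exI[of _ k0] conjI allI impI c k0(1))
    fix F :: "nat \<Rightarrow> real" and N k :: nat
    assume base: "F k0 \<ge> \<mu>"
      and rec: "\<forall>k r. k \<ge> k0 \<and> k + 1 \<le> N \<and> r > 0 \<and> 2 * (C * F (k + 1)) \<le> \<omega> * r ^ n \<longrightarrow>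
        F k \<le> (A + B * r) * (F (k + 1) - F k)"
      and kN: "k0 \<le> k \<and> k \<le> N"
    from kN have "k0 \<le> k" "k \<le> N" by auto
    then show "F k \<ge> c * real k ^ n"
    proof (induction k rule: dec_induct)
      case base
      show ?case using c2 \<open>F k0 \<ge> \<mu>\<close> by linarith
    next
      case (step k)
      note IH = step.IH
      show ?case
      proof (rule ccontr)
        assume "\<not> c * real (Suc k) ^ n \<le> F (Suc k)"
        then have lt: "F (k + 1) < c * (real k + 1) ^ n" by (simp add: add.commute)
        let ?r = "\<theta> * (real k + 1)"
        have k1: "real k \<ge> 1" "k > 0" using step.hyps k0(1) by simp_all
        have "2 * (C * F (k + 1)) \<le> 2 * (C * (c * (real k + 1) ^ n))"
          using lt pos by simp
        also have "\<dots> = 2 * (C * c) * (real k + 1) ^ n" by simp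
        also have "\<dots> \<le> \<omega> * \<theta> ^ n * (real k + 1) ^ n"
          using c1 by (intro mult_right_mono) auto
        finally have "2 * (C * F (k + 1)) \<le> \<omega> * ?r ^ n" by (simp add: power_mult_distrib)
        then have Fk: "F k \<le> (A + B * ?r) * (F (k + 1) - F k)"
          using step.prems step.hyps \<theta> by (intro rec[rule_format]) auto
        have IH': "c * real k ^ n \<le> F k" using IH step.prems by simp
        have "F (k + 1) - F k \<le> c * ((real k + 1) ^ n - real k ^ n)"
          using lt IH' by (simp add: algebra_simps)
        also have "\<dots> \<le> c * (real n * (real k + 1) ^ (n - 1))"
          using c n by (intro mult_left_mono power_diff_le) auto
        also have "\<dots> \<le> c * (real n * (2 * real k) ^ (n - 1))"
          using c k1 by (intro mult_left_mono power_mono) (auto intro: less_imp_le)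
        finally have d: "F (k + 1) - F k \<le> c * (real n * (2 * real k) ^ (n - 1))" .
        have AB: "A + B * ?r > 0" using pos \<theta> k1 by (intro add_pos_pos mult_pos_pos) auto
        have "c * real k ^ n \<le> (A + B * ?r) * (c * (real n * (2 * real k) ^ (n - 1)))"
          using IH' Fk mult_left_mono[OF d, of "A + B * ?r"] AB by linarith
        then have "c * (real k ^ n) \<le> c * ((A + B * ?r) * (real n * (2 * real k) ^ (n - 1)))"
          by (simp add: mult_ac)
        then have "real k ^ n \<le> (A + B * ?r) * (real n * (2 * real k) ^ (n - 1))"
          using c by simp
        also have "\<dots> \<le> (A + B * (\<theta> * (2 * real k))) * (real n * (2 * real k) ^ (n - 1))"
          using pos \<theta> k1 by (intro mult_right_mono add_left_mono mult_left_mono) auto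
        also have "\<dots> = (real n * 2 ^ (n - 1) * A + real n * 2 ^ (n - 1) * B * \<theta> * 2 * real k) * real k ^ (n - 1)"
          by (simp add: power_mult_distrib algebra_simps)
        also have "real n * 2 ^ (n - 1) * B * \<theta> * 2 * real k = real k / 2"
        proof -
          have e: "(2::real) ^ (n + 1) = 4 * 2 ^ (n - 1)" using n by (cases n) auto
          show ?thesis unfolding \<theta>_def e using n pos(2) by (simp add: divide_simps)
        qed
        finally have le: "real k ^ n \<le> (real n * 2 ^ (n - 1) * A + real k / 2) * real k ^ (n - 1)" .
        have "real n * 2 ^ (n - 1) * A < real k / 2"
        proof -
          have "real n * 2 ^ n * A < real k" using k0(2) step.hyps by linarith
          moreover have "real n * 2 ^ n * A = 2 * (real n * 2 ^ (n - 1) * A)"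
            using n by (cases n) auto
          ultimately show ?thesis by linarith
        qed
        then have "(real n * 2 ^ (n - 1) * A + real k / 2) * real k ^ (n - 1) < (real k / 2 + real k / 2) * real k ^ (n - 1)"
          using k1 by (intro mult_strict_right_mono) auto
        with le have "real k ^ n < (real k / 2 + real k / 2) * real k ^ (n - 1)" by (rule order_le_less_trans)
        also have "\<dots> = real k ^ n" using n by (cases n) auto
        finally show False by simp
      qed
    qed
  qed
qed

context minimizer_near_zero
begin

lemma mass_growth:
  assumes sub: "ball x0 (real N) \<subseteq> D" and "k \<ge> 1" "k + 1 \<le> N" "r > 0"
    and vol: "2 * ((C_layer + 1) * mass_in (ball x0 (real (k + 1)))) \<le> unit_ball_vol (real CARD('n)) * r ^ CARD('n)"
  shows "mass_in (ball x0 (real k)) \<le> (C_cmp + C_iso * r) *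
    (mass_in (ball x0 (real (k + 1))) - mass_in (ball x0 (real k)))"
proof -
  have R: "real k > 0" using assms by simp
  have sub': "ball x0 (real k + 1) \<subseteq> D"
    using sub assms(3) by (auto simp: subset_iff)
  let ?A = "ball x0 (real k + 1) - ball x0 (real k)"
  have "energy_in (ball x0 (real k)) \<le> energy_in (ball x0 (real k + 1))"
    by (rule energy_in_mono) auto
  also have "\<dots> \<le> C_cmp * mass_in ?A" by (rule energy_comparison[OF R sub'])
  finally have 1: "energy_in (ball x0 (real k)) \<le> C_cmp * mass_in ?A" .
  have "measure lborel (ball (0::real^'n) r) = unit_ball_vol (real CARD('n)) * r ^ CARD('n)"
    using content_ball[of r "0::real^'n"] assms(4) by simp
  then have 2: "volume_in (ball x0 (real k)) \<le> C_iso * r * mass_in ?A"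
    using vol by (intro volume_growth_step[OF R sub' assms(4)]) (simp add: add.commute)
  have "mass_in ?A = mass_in (ball x0 (real k + 1)) - mass_in (ball x0 (real k))"
    by (rule mass_in_diff) auto
  then show ?thesis using 1 2 unfolding mass_in_def[of "ball x0 (real k)"]
    by (simp add: distrib_right add.commute[of 1])
qed

text \<open>The energy grows at most like the area of spheres: it is controlled by the mass of the outermost
  annulus, where the density is bounded.\<close>

lemma energy_le_area:
  assumes sub: "ball x0 (real k) \<subseteq> D" and k: "k \<ge> 2"
  shows "energy_in (ball x0 (real k)) \<le>
    C_cmp * C_dens * unit_ball_vol (real CARD('n)) * real CARD('n) * real k ^ (CARD('n) - 1)"
proof -
  let ?R = "real k - 1" and ?\<omega> = "unit_ball_vol (real CARD('n))"
  let ?A = "ball x0 (?R + 1) - ball x0 ?R"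
  have R: "?R > 0" using k by simp
  have C0: "C_cmp \<ge> 0" "C_dens \<ge> 0" unfolding C_cmp_def C_dens_def using pos KW_nonneg
    by (auto intro!: add_nonneg_nonneg)
  have "energy_in (ball x0 (real k)) \<le> C_cmp * mass_in ?A"
    using energy_comparison[OF R, of x0] sub by simp
  also have "\<dots> \<le> C_cmp * (C_dens * measure lborel ?A)"
    using C0 by (intro mult_left_mono mass_in_le) (auto intro: bounded_subset[OF bounded_ball[of x0 "?R + 1"]])
  also have "measure lborel ?A = ?\<omega> * ((?R + 1) ^ CARD('n) - ?R ^ CARD('n))"
  proof -
    have "ball x0 (?R + 1) \<in> fmeasurable lborel" by (intro fmeasurableI emeasure_bounded_finite) auto
    then have "measure lborel ?A = measure lborel (ball x0 (?R + 1)) - measure lborel (ball x0 ?R)"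
      by (intro measure_Diff) (auto simp: fmeasurable_def)
    then show ?thesis
      using content_ball[of "?R + 1" x0] content_ball[of ?R x0] R by (simp add: right_diff_distrib)
  qed
  also have "C_cmp * (C_dens * (?\<omega> * ((?R + 1) ^ CARD('n) - ?R ^ CARD('n)))) \<le>
      C_cmp * (C_dens * (?\<omega> * (real CARD('n) * (?R + 1) ^ (CARD('n) - 1))))"
    using C0 R by (intro mult_left_mono power_diff_le) (auto simp: Suc_leI)
  finally show ?thesis by (simp add: mult_ac)
qed

end

section \<open>The density estimate\<close>

theorem theoremA:
  fixes W :: "real^'m \<Rightarrow> real" and a :: "real^'m" and M :: real
  assumes "hypothesis_HA W a" and "M > 0"
  shows "\<forall>\<mu>0 l. \<mu>0 > 0 \<and> 0 < l \<and> ereal l < dist_other_zeros W a \<longrightarrow>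
    (\<exists>C>0. \<forall>(D :: (real^'n) set) u x0.
       open D \<and> hypothesis_HB W a M D u \<and> x0 \<in> D \<and>
       measure lebesgue (ball x0 1 \<inter> {x \<in> D. norm (u x - a) > l}) \<ge> \<mu>0 \<longrightarrow>
       (\<forall>R. R \<ge> 1 \<and> ball x0 R \<subseteq> D \<longrightarrow>
          measure lebesgue (ball x0 R \<inter> {x \<in> D. norm (u x - a) > l}) \<ge> C * R ^ CARD('n)))"
proof (intro allI impI)
  fix \<mu>0 l :: real
  assume A: "\<mu>0 > 0 \<and> 0 < l \<and> ereal l < dist_other_zeros W a"
  let ?n = "CARD('n)" and ?\<omega> = "unit_ball_vol (real CARD('n))"
  obtain c0 \<rho>0 where c0: "c0 > 0" "\<rho>0 > 0"
    "\<And>y. norm y \<le> \<rho>0 \<Longrightarrow> c0 * (norm y)\<^sup>2 \<le> W (a + y)"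
    "\<And>y t. norm y \<le> \<rho>0 \<Longrightarrow> 0 \<le> t \<Longrightarrow> t \<le> 1 \<Longrightarrow> W (a + t *\<^sub>R y) \<le> W (a + y)"
    using HA_quadratic_growth[OF assms(1)] by blast
  \<comment> \<open>\<open>2 * s\<close> is at most \<open>l\<close>, so that \<open>{norm (U x) > 2 * s}\<close> contains the set in question, and it is small enough
    for the comparison near \<open>a\<close>.\<close>
  define s where "s = min l \<rho>0 / 2"
  have s: "s > 0" "2 * s \<le> l" "2 * s \<le> \<rho>0" using A c0(2) by (auto simp: s_def)
  obtain c2 where c2: "c2 > 0" "\<And>y. 2 * s \<le> norm y \<Longrightarrow> norm y \<le> l \<Longrightarrow> c2 \<le> W (a + y)"
    using HA_positive_on_annulus[OF assms(1), of "2 * s" l] s A by auto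
  have Wc: "continuous_on UNIV W" by (rule HA_continuous[OF assms(1)])
  obtain KW where KW: "\<And>y. norm y \<le> M \<Longrightarrow> W (a + y) \<le> KW"
  proof -
    have "compact (W ` cball a M)"
      by (intro compact_continuous_image continuous_on_subset[OF Wc]) auto
    from compact_imp_bounded[OF this] obtain B where B: "\<forall>z\<in>cball a M. norm (W z) \<le> B"
      unfolding bounded_iff by auto
    have "W (a + y) \<le> B" if "norm y \<le> M" for y
      using bspec[OF B, of "a + y"] that by (simp add: dist_norm)
    then show ?thesis by (rule that)
  qed
  obtain Q where Q: "Q \<ge> 0" "\<forall>(x0 :: real^'n) R. R > 0 \<longrightarrow> (\<exists>\<eta>. cutoff_function x0 R Q \<eta>)"
    using cutoff_exists by (elim exE conjE)
  have KW0: "KW \<ge> 0" using KW[of 0] assms unfolding hypothesis_HA_def by simp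
  \<comment> \<open>These are the constants of the locale; they have to be fixed before the minimizer.\<close>
  define Cc where "Cc = 2 + Q\<^sup>2 / c0 + M\<^sup>2 + M\<^sup>2 * Q\<^sup>2 + KW"
  define Cl where "Cl = 1 / (c0 * s\<^sup>2)"
  define Cd where "Cd = M\<^sup>2 / 2 + KW + 1"
  define Ci where "Ci = 2 * ((M + M * Q) / s) * (Cl * Cc + 1)"
  have sq: "Q\<^sup>2 / c0 \<ge> 0" "M\<^sup>2 \<ge> 0" "M\<^sup>2 * Q\<^sup>2 \<ge> 0" using c0(1) by auto
  have Cpos: "Cc > 0" "Cl > 0" "Cd > 0"
  proof -
    show "Cc > 0" "Cd > 0" unfolding Cc_def Cd_def using sq KW0 by linarith+
    show "Cl > 0" unfolding Cl_def using c0(1) s(1) by simp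
  qed
  have Ci: "Ci > 0"
  proof -
    have "M * Q \<ge> 0" using assms(2) Q(1) by simp
    then have "(M + M * Q) / s > 0" using assms(2) s(1) by (intro divide_pos_pos) auto
    moreover have "Cl * Cc + 1 > 0" using mult_pos_pos[OF Cpos(2,1)] by linarith
    ultimately show ?thesis unfolding Ci_def by (intro mult_pos_pos) auto
  qed
  have W0: "\<And>z. 0 \<le> W z" "W a = 0" using assms(1) unfolding hypothesis_HA_def by auto
  have near: "\<And>y. norm y \<le> 2 * s \<Longrightarrow> c0 * (norm y)\<^sup>2 \<le> W (a + y)"
    "\<And>y t. norm y \<le> 2 * s \<Longrightarrow> 0 \<le> t \<Longrightarrow> t \<le> 1 \<Longrightarrow> W (a + t *\<^sub>R y) \<le> W (a + y)"
    using c0(3,4) s(3) by auto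
  have \<omega>: "?\<omega> > 0" by simp
  have n1: "?n \<ge> 1" by (simp add: Suc_leI)
  have "0 < Cl + 1" using Cpos by simp
  from growth_iteration[OF n1 Cpos(1) Ci this \<omega>, of \<mu>0] A
  obtain c k0 where c: "c > 0" "k0 \<ge> 1" and grow: "\<forall>F N. F k0 \<ge> \<mu>0 \<longrightarrow>
    (\<forall>k r. k \<ge> k0 \<and> k + 1 \<le> N \<and> r > 0 \<and> 2 * ((Cl + 1) * F (k + 1)) \<le> ?\<omega> * r ^ ?n \<longrightarrow>
      F k \<le> (Cc + Ci * r) * (F (k + 1) - F k)) \<longrightarrow>
    (\<forall>k. k0 \<le> k \<and> k \<le> N \<longrightarrow> F k \<ge> c * real k ^ ?n)"
    by (elim conjE exE impE) auto
  define P where "P = (1 + 1 / c2) * (Cc * Cd * ?\<omega> * real ?n)"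
  have P: "P > 0" unfolding P_def using c2 Cpos \<omega> by (intro mult_pos_pos add_pos_pos) auto
  \<comment> \<open>From \<open>K0\<close> on, the energy, at most \<open>P * k ^ (n - 1)\<close>, uses up no more than half of the mass \<open>c * k ^ n\<close>.\<close>
  define K0 where "K0 = max k0 (Suc (Suc (nat \<lceil>2 * P / c\<rceil>)))"
  have K0: "K0 \<ge> k0" "K0 \<ge> 2" "2 * P / c \<le> real K0"
    unfolding K0_def by (auto, linarith)
  define C where "C = min (c / 2 / 2 ^ ?n) (\<mu>0 / real K0 ^ ?n)"
  have C: "C > 0" unfolding C_def using c A K0(2) by simp
  show "\<exists>C>0. \<forall>(D :: (real^'n) set) u x0.
       open D \<and> hypothesis_HB W a M D u \<and> x0 \<in> D \<and>
       measure lebesgue (ball x0 1 \<inter> {x \<in> D. norm (u x - a) > l}) \<ge> \<mu>0 \<longrightarrow>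
       (\<forall>R. R \<ge> 1 \<and> ball x0 R \<subseteq> D \<longrightarrow>
          measure lebesgue (ball x0 R \<inter> {x \<in> D. norm (u x - a) > l}) \<ge> C * R ^ ?n)"
  proof (intro exI[of _ C] conjI C allI impI)
    fix D :: "(real^'n) set" and u x0 R
    assume H: "open D \<and> hypothesis_HB W a M D u \<and> x0 \<in> D \<and>
       measure lebesgue (ball x0 1 \<inter> {x \<in> D. norm (u x - a) > l}) \<ge> \<mu>0"
      and R: "R \<ge> 1 \<and> ball x0 R \<subseteq> D"
    have D: "open D" and HB: "hypothesis_HB W a M D u" using H by auto
    let ?u = "\<lambda>R. measure lebesgue (ball x0 R \<inter> {x \<in> D. norm (u x - a) > l})"
    show "C * R ^ ?n \<le> ?u R"
    proof (rule minimizer_representative[OF D HB assms(2)])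
      fix U G assume U: "U \<in> borel_measurable borel" "G \<in> borel_measurable borel"
        "\<And>x. norm (U x) \<le> M" "\<And>x. norm (G x) \<le> M" "AE x in lborel. x \<in> D \<longrightarrow> u x - a = U x"
        "\<And>\<phi> i j. test_function D \<phi> \<Longrightarrow>
          (\<integral>x. U x $ i * partial_deriv j \<phi> x \<partial>lborel) = - (\<integral>x. G x $ i $ j * \<phi> x \<partial>lborel)"
        "minimal_pair W a D U G"
      interpret minimizer_near_zero W a M c0 s KW Q D U G
        by unfold_locales (fact Wc W0 assms(2) c0(1) s(1) Q(1) near KW Q(2)[rule_format] U(1-4,6,7))+
      have const: "C_cmp = Cc" "C_layer = Cl" "C_dens = Cd" "C_iso = Ci"
        unfolding C_cmp_def C_layer_def C_dens_def C_iso_def Cc_def Cl_def Cd_def Ci_def by simp_all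
      note [measurable] = U(1,2)
      let ?V = "\<lambda>R. measure lborel (ball x0 R \<inter> {x. norm (U x) > l})"
      have uV: "?u R = ?V R" if "ball x0 R \<subseteq> D" for R
      proof -
        have "u \<in> borel_measurable (lebesgue_on D)"
          using HB unfolding hypothesis_HB_def Linfty_on_def by blast
        then have "(\<lambda>x. norm (u x - a)) \<in> borel_measurable (lebesgue_on D)" by simp
        then have "{x \<in> space (lebesgue_on D). norm (u x - a) > l} \<in> sets (lebesgue_on D)" by measurable
        then have m: "{x \<in> D. norm (u x - a) > l} \<in> sets lebesgue"
          using D by (auto simp: sets_restrict_space_iff)
        have "?u R = measure lebesgue (ball x0 R \<inter> {x. norm (U x) > l})"
        proof (rule measure_eq_AE)
          show "AE x in lebesgue. x \<in> ball x0 R \<inter> {x \<in> D. norm (u x - a) > l} \<longleftrightarrow> x \<in> ball x0 R \<inter> {x. norm (U x) > l}"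
            unfolding AE_completion_iff using U(5) by eventually_elim (use that in auto)
          show "ball x0 R \<inter> {x \<in> D. norm (u x - a) > l} \<in> sets lebesgue" using m by auto
          have "{x. norm (U x) > l} \<in> sets borel" by measurable
          then show "ball x0 R \<inter> {x. norm (U x) > l} \<in> sets lebesgue" by auto
        qed
        then show ?thesis by simp
      qed
      have Vmono: "?V r \<le> ?V r'" if "r \<le> r'" for r r'
      proof (rule measure_mono_fmeasurable)
        show "ball x0 r' \<inter> {x. norm (U x) > l} \<in> fmeasurable lborel"
          by (intro fmeasurableI emeasure_bounded_finite) (auto intro: bounded_subset[OF bounded_ball[of x0 r']])
      qed (use that in auto)
      have "ball x0 1 \<subseteq> D" using R by (auto simp: subset_iff)
      then have V1: "?V 1 \<ge> \<mu>0" using H uV[of 1] by simp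
      have "C * R ^ ?n \<le> ?V R"
      proof (cases "R < real K0")
        case True
        have "C * R ^ ?n \<le> \<mu>0 / real K0 ^ ?n * real K0 ^ ?n"
          using True R C A unfolding C_def by (intro mult_mono power_mono) auto
        also have "\<dots> = \<mu>0" using K0(2) by simp
        also have "\<dots> \<le> ?V R" using V1 Vmono[of 1 R] R by linarith
        finally show ?thesis .
      next
        case False
        define k where "k = nat \<lfloor>R\<rfloor>"
        have k: "real k \<le> R" "R < real k + 1" "K0 \<le> k"
        proof -
          show "real k \<le> R" "R < real k + 1" using R unfolding k_def by linarith+
          show "K0 \<le> k" using False unfolding k_def by (intro le_nat_floor) simp
        qed
        have subk: "ball x0 (real k) \<subseteq> D" using k(1) R by (auto simp: subset_iff)
        have bdd: "bounded (ball x0 (real k) \<inter> S)" for S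
          by (rule bounded_subset[OF bounded_ball]) auto
        have volV: "volume_in (ball x0 r) \<ge> ?V r" for r
          unfolding volume_in_def
        proof (rule measure_mono_fmeasurable)
          show "ball x0 r \<inter> {x. norm (U x) > 2 * s} \<in> fmeasurable lborel"
            by (intro fmeasurableI emeasure_bounded_finite) (auto intro: bounded_subset[OF bounded_ball[of x0 r]])
        qed (use s(2) in auto)
        have "mass_in (ball x0 (real k)) \<ge> c * real k ^ ?n"
        proof (rule grow[rule_format, of "\<lambda>k. mass_in (ball x0 (real k))" k k])
          show "\<mu>0 \<le> mass_in (ball x0 (real k0))"
            using V1 Vmono[of 1 "real k0"] volV[of "real k0"] c(2) energy_in_nonneg[of "ball x0 (real k0)"]
            unfolding mass_in_def by simp
          show "mass_in (ball x0 (real j)) \<le> (Cc + Ci * r) * (mass_in (ball x0 (real (j + 1))) - mass_in (ball x0 (real j)))"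
            if "j \<ge> k0 \<and> j + 1 \<le> k \<and> r > 0 \<and> 2 * ((Cl + 1) * mass_in (ball x0 (real (j + 1)))) \<le> ?\<omega> * r ^ ?n" for j r
            using mass_growth[OF subk, of j r] that c(2) unfolding const by simp
        qed (use k K0 in auto)
        moreover have "volume_in (ball x0 (real k)) \<le> ?V (real k) + energy_in (ball x0 (real k)) / c2"
        proof -
          let ?T = "ball x0 (real k) \<inter> {x. norm (U x) > 2 * s \<and> norm (U x) \<le> l}"
          have Tm: "?T \<in> sets borel" by measurable
          have iT: "integrable lborel (indicator ?T :: _ \<Rightarrow> real)"
            by (rule integrable_indicator_bounded[OF Tm bdd])
          have "(\<integral>x. c2 * indicator ?T x \<partial>lborel) \<le> energy_in (ball x0 (real k))"
            unfolding energy_in_def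
          proof (rule integral_mono)
            show "integrable lborel (\<lambda>x. c2 * indicator ?T x)" using iT by simp
            show "integrable lborel (\<lambda>x. indicator (ball x0 (real k)) x * energy_density x)"
              by (rule integrable_energy) auto
            fix x
            show "c2 * indicator ?T x \<le> indicator (ball x0 (real k)) x * energy_density x"
            proof (cases "x \<in> ?T")
              case True
              then have "c2 \<le> W (a + U x)" by (intro c2(2)) auto
              also have "\<dots> \<le> energy_density x" unfolding energy_density_def by simp
              finally show ?thesis using True by (simp add: indicator_def)
            next
              case False
              then have "indicator ?T x = (0::real)" by (simp add: indicator_def)
              then show ?thesis using energy_density_nonneg[of x] by simp
            qed
          qed
          then have T: "measure lborel ?T \<le> energy_in (ball x0 (real k)) / c2"
            using c2(1) by (simp add: field_simps)
          have "volume_in (ball x0 (real k)) \<le> measure lborel ((ball x0 (real k) \<inter> {x. norm (U x) > l}) \<union> ?T)"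
            unfolding volume_in_def
          proof (rule measure_mono_fmeasurable)
            show "ball x0 (real k) \<inter> {x. norm (U x) > l} \<union> ?T \<in> fmeasurable lborel"
              using bdd by (intro fmeasurableI emeasure_bounded_finite) auto
          qed auto
          also have "\<dots> \<le> ?V (real k) + measure lborel ?T"
            using bdd by (intro measure_Un_le fmeasurableI emeasure_bounded_finite) auto
          finally show ?thesis using T by linarith
        qed
        moreover have "energy_in (ball x0 (real k)) \<le> Cc * Cd * ?\<omega> * real ?n * real k ^ (?n - 1)"
          using energy_le_area[OF subk] k(3) K0(2) unfolding const by simp
        then have "(1 + 1 / c2) * energy_in (ball x0 (real k)) \<le> P * real k ^ (?n - 1)"
          unfolding P_def mult.assoc using c2(1) by (intro mult_left_mono) (auto simp: mult.assoc)
        then have "energy_in (ball x0 (real k)) + energy_in (ball x0 (real k)) / c2 \<le> P * real k ^ (?n - 1)"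
          by (simp add: distrib_right)
        ultimately have V: "?V (real k) \<ge> c * real k ^ ?n - P * real k ^ (?n - 1)"
          unfolding mass_in_def by linarith
        have "P \<le> c / 2 * real k"
        proof -
          have "2 * P / c \<le> real k" using K0(3) k(3) by linarith
          then show ?thesis using c(1) by (simp add: field_simps)
        qed
        then have "P * real k ^ (?n - 1) \<le> c / 2 * real k * real k ^ (?n - 1)"
          by (rule mult_right_mono) simp
        also have "\<dots> = c / 2 * real k ^ ?n"
          using n1 by (metis One_nat_def Suc_diff_le diff_Suc_Suc diff_zero mult.assoc power_Suc)
        finally have "c / 2 * real k ^ ?n \<le> ?V (real k)" using V by linarith
        also have "\<dots> \<le> ?V R" by (rule Vmono[OF k(1)])
        finally have VR: "c / 2 * real k ^ ?n \<le> ?V R" .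
        have "R \<le> 2 * real k" using k K0(2) by linarith
        then have "C * R ^ ?n \<le> c / 2 / 2 ^ ?n * (2 * real k) ^ ?n"
          using R C c unfolding C_def by (intro mult_mono power_mono) auto
        also have "\<dots> = c / 2 * real k ^ ?n" by (simp add: power_mult_distrib)
        finally show ?thesis using VR by linarith
      qed
      then show "C * R ^ ?n \<le> ?u R" using uV R by simp
    qed
  qed
qed

end
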